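(* Let $\mathbb{F}$ be a field of characteristic different from $2$. Let $b$ be a non-degenerate symmetric bilinear form on a finite-dimensional vector space $V$ over $\mathbb{F}$, and let $u$ be a bijective $b$-selfadjoint endomorphism of $V$. The following conditions are equivalent: (a) there exist $b$-selfadjoint endomorphisms $a_1,a_2$ of $V$ with $a_1^2=a_2^2=0$ and $u=a_1+a_2$; (b) for every $p\in\mathrm{Irr}_0(\mathbb{F})$ and every integer $k\ge1$, the quadratic form attached to $(b,u)_{p,k}$ is skew-representable, and for every $p\in\mathrm{Irr}(\mathbb{F})\setminus\mathrm{Irr}_0(\mathbb{F})$ and every integer $k\ge1$, the symmetric bilinear forms $(b,u)_{p,k}$ and $(-1)^{1+(k-1)\deg p}\,\bigl((b,u)_{p^{\mathrm{op}},k}\bigr)^{\mathrm{op}}$ are equivalent over the field $\mathbb{F}[t]/(p)$.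
   Context: $u$ is $b$-selfadjoint if $b(u(x),y)=b(x,u(y))$ for all $x,y$. $\mathrm{Irr}(\mathbb{F})$ is the set of monic irreducible polynomials of $\mathbb{F}[t]$, and $\mathrm{Irr}_0(\mathbb{F})=\mathrm{Irr}(\mathbb{F})\cap\mathbb{F}[t^2]$. For nonzero $p\in\mathbb{F}[t]$, $p^{\mathrm{op}}:=(-1)^{\deg p}p(-t)$. Quadratic invariants. Let $p\in\mathrm{Irr}(\mathbb{F})$ have degree $d$, $k\ge1$ and $\mathbb{L}:=\mathbb{F}[t]/(p)$. Let $e_p:\mathbb{L}\to\mathbb{F}$ be the $\mathbb{F}$-linear form with $e_p(\overline{1})=1$ and $e_p(\overline{t^i})=0$ for $1\le i\le d-1$. Set $V_{p,k}:=\mathrm{Ker}\,p(u)^k/\bigl(\mathrm{Ker}\,p(u)^{k-1}+(\mathrm{Ker}\,p(u)^k\cap\mathrm{Im}\,p(u))\bigr)$, an $\mathbb{L}$-vector space (the class of $t$ acting through $u$). The form $(x,y)\mapsto b(x,p(u)^{k-1}[y])$ induces a non-degenerate $\mathbb{F}$-bilinear form $B$ on $V_{p,k}$, and $(b,u)_{p,k}$ denotes the unique map $B^{\mathbb{L}}:V_{p,k}^2\to\mathbb{L}$ such that $B(x,\lambda y)=e_p(\lambda B^{\mathbb{L}}(x,y))$ for all $\lambda\in\mathbb{L}$ and all $x,y$; it is a non-degenerate symmetric $\mathbb{L}$-bilinear form. Skew-representability. For $p\in\mathrm{Irr}_0(\mathbb{F})$, $\mathbb{L}=\mathbb{F}[t]/(p)$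 carries the involution $x\mapsto x^\bullet$ taking the class of $r(t)$ to that of $r(-t)$. A quadratic form $Q$ on a finite-dimensional $\mathbb{L}$-vector space is skew-representable if there is a $Q$-orthogonal basis $(e_1,\dots,e_n)$ of the space with $Q(e_i)^\bullet=-Q(e_i)$ for all $i$. The quadratic form attached to a symmetric bilinear form $C$ is $x\mapsto C(x,x)$. Opposite form. For $p\in\mathrm{Irr}(\mathbb{F})\setminus\mathrm{Irr}_0(\mathbb{F})$, let $\mathbb{L}=\mathbb{F}[t]/(p)$, $\mathbb{L}^{\mathrm{op}}=\mathbb{F}[t]/(p^{\mathrm{op}})$ and let $\varphi:\mathbb{L}^{\mathrm{op}}\to\mathbb{L}$ be the isomorphism taking the class of $q(t)$ to the class of $q(-t)$. For a bilinear form $C$ on an $\mathbb{L}^{\mathrm{op}}$-vector space $W$, $C^{\mathrm{op}}:=\varphi\circ C$ is the bilinear form on the $\mathbb{L}$-vector space having the same underlying abelian group as $W$ and scalar multiplication $\lambda\cdot x:=\varphi^{-1}(\lambda)x$. *)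

theory Defs
  imports
    "Jordan_Normal_Form.Missing_VectorSpace"
    "HOL-Algebra.QuotRing"
    "HOL-Algebra.Algebraic_Closure_Type"
    "HOL-Computational_Algebra.Computational_Algebra"
begin

section \<open>Symmetric bilinear forms and selfadjoint endomorphisms\<close>

definition sym_bilinear_form ::
    "('a::field \<Rightarrow> 'v::ab_group_add \<Rightarrow> 'v) \<Rightarrow> ('v \<Rightarrow> 'v \<Rightarrow> 'a) \<Rightarrow> bool" where
  "sym_bilinear_form sc b \<longleftrightarrow>
     (\<forall>x. Vector_Spaces.linear sc (*) (\<lambda>y. b x y)) \<and>
     (\<forall>y. Vector_Spaces.linear sc (*) (\<lambda>x. b x y)) \<and>
     (\<forall>x y. b x y = b y x)"

definition nondegenerate_form :: "('v::zero \<Rightarrow> 'v \<Rightarrow> 'a::zero) \<Rightarrow> bool" where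
  "nondegenerate_form b \<longleftrightarrow> (\<forall>x. (\<forall>y. b x y = 0) \<longrightarrow> x = 0)"

definition selfadjoint_endo ::
    "('a::field \<Rightarrow> 'v::ab_group_add \<Rightarrow> 'v) \<Rightarrow> ('v \<Rightarrow> 'v \<Rightarrow> 'a) \<Rightarrow> ('v \<Rightarrow> 'v) \<Rightarrow> bool" where
  "selfadjoint_endo sc b u \<longleftrightarrow>
     Vector_Spaces.linear sc sc u \<and> (\<forall>x y. b (u x) y = b x (u y))"


section \<open>Irreducible polynomials and the substitution of -t for t\<close>

definition Irr :: "'a::field poly set" where
  "Irr = {p. lead_coeff p = 1 \<and> irreducible p}"

definition Irr0 :: "'a::field poly set" where
  "Irr0 = Irr \<inter> {pcompose q (monom 1 2) | q. True}"

definition subst_neg :: "'a::field poly \<Rightarrow> 'a poly" where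
  "subst_neg q = pcompose q [:0, - 1:]"

definition op_poly :: "'a::field poly \<Rightarrow> 'a poly" where
  "op_poly p = Polynomial.smult ((- 1) ^ degree p) (subst_neg p)"


section \<open>The residue field F[t]/(p)\<close>

abbreviation poly_ring :: "'a::field poly ring" where
  "poly_ring \<equiv> ring_of_type_algebra"

definition res_field :: "'a::field poly \<Rightarrow> 'a poly set ring" where
  "res_field p = poly_ring Quot (PIdl\<^bsub>poly_ring\<^esub> p)"

text \<open>
  The linear form \<open>e_p\<close>: the remainder modulo \<open>p\<close> of a representative is its expansion in
  \<open>1, t, \<dots>, t^(d-1)\<close>, so its constant coefficient is the coordinate on the class of \<open>1\<close>.
\<close>
definition e_form :: "'a::field poly \<Rightarrow> 'a poly set \<Rightarrow> 'a" where
  "e_form p \<Lambda> = (THE c. \<forall>r\<in>\<Lambda>. coeff (r mod p) 0 = c)"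

text \<open>
  The direct image under \<open>q(t) \<mapsto> q(-t)\<close> sends the coset of \<open>q(t)\<close> modulo \<open>p^op\<close> to the coset
  of \<open>q(-t)\<close> modulo \<open>p\<close>, and the coset of \<open>q(t)\<close> modulo \<open>p\<close> to the coset of \<open>q(-t)\<close> modulo \<open>p^op\<close>.
  So \<open>res_refl\<close> is the isomorphism \<open>\<phi>\<close> as well as its inverse; when \<open>p \<in> Irr0\<close>, where \<open>p^op = p\<close>,
  it is the involution of \<open>F[t]/(p)\<close>.
\<close>
definition res_refl :: "'a::field poly set \<Rightarrow> 'a poly set" where
  "res_refl \<Lambda> = subst_neg ` \<Lambda>"


section \<open>Forms on vector spaces over a field given by a record\<close>

definition attached_quadratic_form :: "('x \<Rightarrow> 'x \<Rightarrow> 'l) \<Rightarrow> 'x \<Rightarrow> 'l" where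
  "attached_quadratic_form C x = C x x"

text \<open>Orthogonality with respect to \<open>Q\<close> is the vanishing of the polar form \<open>Q(x+y) - Q(x) - Q(y)\<close>.\<close>
definition skew_representable ::
    "('l, 'm) ring_scheme \<Rightarrow> ('l \<Rightarrow> 'l) \<Rightarrow> ('l, 'x, 'n) module_scheme \<Rightarrow> ('x \<Rightarrow> 'l) \<Rightarrow> bool" where
  "skew_representable K \<sigma> W Q \<longleftrightarrow>
     (\<exists>E. finite E \<and> vectorspace.basis K W E \<and>
          (\<forall>x\<in>E. \<forall>y\<in>E. x \<noteq> y \<longrightarrow> Q (x \<oplus>\<^bsub>W\<^esub> y) \<ominus>\<^bsub>K\<^esub> Q x \<ominus>\<^bsub>K\<^esub> Q y = \<zero>\<^bsub>K\<^esub>) \<and>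
          (\<forall>x\<in>E. \<sigma> (Q x) = \<ominus>\<^bsub>K\<^esub> Q x))"

definition equivalent_forms ::
    "('l, 'm) ring_scheme \<Rightarrow> ('l, 'x, 'n) module_scheme \<Rightarrow> ('x \<Rightarrow> 'x \<Rightarrow> 'l) \<Rightarrow>
     ('l, 'y, 'o) module_scheme \<Rightarrow> ('y \<Rightarrow> 'y \<Rightarrow> 'l) \<Rightarrow> bool" where
  "equivalent_forms K W C W' C' \<longleftrightarrow>
     (\<exists>f \<in> LinearCombinations.module_hom K W W'. bij_betw f (carrier W) (carrier W') \<and>
          (\<forall>x\<in>carrier W. \<forall>y\<in>carrier W. C' (f x) (f y) = C x y))"

text \<open>
  The form \<open>C^op\<close> and its underlying space, for \<open>W\<close> a vector space over \<open>F[t]/(p^op)\<close>;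
  in \<open>op_space\<close>, \<open>res_refl\<close> plays the role of the inverse of \<open>\<phi>\<close>.
\<close>
definition op_space :: "('a::field poly set, 'x) module \<Rightarrow> ('a poly set, 'x) module" where
  "op_space W = W\<lparr>module.smult := (\<lambda>\<Lambda> x. res_refl \<Lambda> \<odot>\<^bsub>W\<^esub> x)\<rparr>"

definition op_form :: "('x \<Rightarrow> 'x \<Rightarrow> 'a::field poly set) \<Rightarrow> 'x \<Rightarrow> 'x \<Rightarrow> 'a poly set" where
  "op_form C x y = res_refl (C x y)"


section \<open>The quadratic invariants\<close>

definition poly_endo ::
    "('a::field \<Rightarrow> 'v::ab_group_add \<Rightarrow> 'v) \<Rightarrow> ('v \<Rightarrow> 'v) \<Rightarrow> 'a poly \<Rightarrow> 'v \<Rightarrow> 'v" where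
  "poly_endo sc u q x = (\<Sum>i\<le>degree q. sc (coeff q i) ((u ^^ i) x))"

definition ker_pow ::
    "('a::field \<Rightarrow> 'v::ab_group_add \<Rightarrow> 'v) \<Rightarrow> ('v \<Rightarrow> 'v) \<Rightarrow> 'a poly \<Rightarrow> nat \<Rightarrow> 'v set" where
  "ker_pow sc u p k = {x. (poly_endo sc u p ^^ k) x = 0}"

text \<open>\<open>Ker p(u)^k\<close> as a module over \<open>F[t]\<close>; the record fields \<open>mult\<close> and \<open>one\<close> are irrelevant.\<close>
definition ker_module ::
    "('a::field \<Rightarrow> 'v::ab_group_add \<Rightarrow> 'v) \<Rightarrow> ('v \<Rightarrow> 'v) \<Rightarrow> 'a poly \<Rightarrow> nat \<Rightarrow> ('a poly, 'v) module" where
  "ker_module sc u p k =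
     \<lparr>carrier = ker_pow sc u p k, monoid.mult = undefined, one = undefined,
      ring.zero = 0, add = (+), module.smult = poly_endo sc u\<rparr>"

definition inv_denominator ::
    "('a::field \<Rightarrow> 'v::ab_group_add \<Rightarrow> 'v) \<Rightarrow> ('v \<Rightarrow> 'v) \<Rightarrow> 'a poly \<Rightarrow> nat \<Rightarrow> 'v set" where
  "inv_denominator sc u p k =
     {x + y | x y. x \<in> ker_pow sc u p (k - 1) \<and> y \<in> ker_pow sc u p k \<inter> range (poly_endo sc u p)}"

text \<open>
  Quotient of an \<open>R\<close>-module by a submodule \<open>N\<close>, with cosets of an ideal of \<open>R\<close> as scalars;
  the scalar multiplication imitates \<^const>\<open>rcoset_mult\<close>.
\<close>
definition quot_module :: "('r, 'v) module \<Rightarrow> 'v set \<Rightarrow> ('r set, 'v set) module" where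
  "quot_module M N =
     \<lparr>carrier = a_rcosets\<^bsub>M\<^esub> N, monoid.mult = undefined, one = undefined,
      ring.zero = N, add = set_add M,
      module.smult = (\<lambda>\<Lambda> A. \<Union>r\<in>\<Lambda>. \<Union>x\<in>A. N +>\<^bsub>M\<^esub> (r \<odot>\<^bsub>M\<^esub> x))\<rparr>"

definition inv_space ::
    "('a::field \<Rightarrow> 'v::ab_group_add \<Rightarrow> 'v) \<Rightarrow> ('v \<Rightarrow> 'v) \<Rightarrow> 'a poly \<Rightarrow> nat \<Rightarrow>
     ('a poly set, 'v set) module" where
  "inv_space sc u p k = quot_module (ker_module sc u p k) (inv_denominator sc u p k)"

definition induced_form ::
    "('a::field \<Rightarrow> 'v::ab_group_add \<Rightarrow> 'v) \<Rightarrow> ('v \<Rightarrow> 'v \<Rightarrow> 'a) \<Rightarrow> ('v \<Rightarrow> 'v) \<Rightarrow> 'a poly \<Rightarrow> nat \<Rightarrow>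
     'v set \<Rightarrow> 'v set \<Rightarrow> 'a" where
  "induced_form sc b u p k A B =
     (THE c. \<forall>x\<in>A. \<forall>y\<in>B. b x ((poly_endo sc u p ^^ (k - 1)) y) = c)"

text \<open>The defining condition of \<open>(b,u)_{p,k}\<close> is pointwise in the two arguments.\<close>
definition quad_invariant ::
    "('a::field \<Rightarrow> 'v::ab_group_add \<Rightarrow> 'v) \<Rightarrow> ('v \<Rightarrow> 'v \<Rightarrow> 'a) \<Rightarrow> ('v \<Rightarrow> 'v) \<Rightarrow> 'a poly \<Rightarrow> nat \<Rightarrow>
     'v set \<Rightarrow> 'v set \<Rightarrow> 'a poly set" where
  "quad_invariant sc b u p k A B =
     (THE z. z \<in> carrier (res_field p) \<and>
        (\<forall>\<Lambda>\<in>carrier (res_field p).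
           induced_form sc b u p k A (\<Lambda> \<odot>\<^bsub>inv_space sc u p k\<^esub> B)
             = e_form p (\<Lambda> \<otimes>\<^bsub>res_field p\<^esub> z)))"

end

theory Submission
  imports Defs
begin

text \<open>
  The decompositions \<open>u = a1 + a2\<close> correspond to involutions \<open>s\<close> of \<open>V\<close> with \<open>s u = - u s\<close> and
  \<open>b (s x) (s y) = - b x y\<close>. From a decomposition one gets \<open>s = (a1 - a2) u\<^sup>-\<^sup>1\<close>; conversely, the
  two eigenspaces of \<open>s\<close> are totally isotropic, exchanged by \<open>u\<close> and have sum \<open>V\<close>, and \<open>a1\<close> and \<open>a2\<close>
  are \<open>u\<close> composed with the two projections. So the theorem says that the quadratic invariants
  decide whether such an \<open>s\<close> exists.

  From an involution to the invariants. The map \<open>s\<close> carries \<open>V_{p,k}\<close> to \<open>V_{p^op,k}\<close> and changes the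
  sign of \<open>b\<close>, which gives the equivalence of forms if \<open>p\<close> is not in \<open>F[t\<^sup>2]\<close>. If it is, \<open>s\<close> acts
  semilinearly on \<open>V_{p,k}\<close>, the invariant takes skew values on eigenvectors of \<open>s\<close>, and there
  are enough eigenvectors to form an orthogonal basis (\<open>exists_eigen_residual_basis\<close>).

  From the invariants to an involution. The hypotheses provide, on representatives, orthogonal
  bases of all the \<open>V_{p,k}\<close> with a matching \<open>\<tau>\<close> between the basis for \<open>p\<close> and the one for \<open>p^op\<close>
  (the identity if \<open>p\<close> is in \<open>F[t\<^sup>2]\<close>), such that the residual form of \<open>\<tau> i\<close>, the
  restriction of \<open>r \<mapsto> b x (r(u) x)\<close> to the multiples of \<open>p^(k-1)\<close>, is opposite to the reflected residual
  form of \<open>i\<close>. These data lift to \<open>V\<close>. A Gram-Schmidt process over \<open>F[u]\<close>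
  makes the cyclic submodules of the representatives mutually orthogonal and does not change the
  classes (\<open>orthogonalise_family\<close>). The form \<open>r \<mapsto> b x (r(u) x)\<close> of a generator can be changed to any
  form on \<open>F[t]/(p^k)\<close> with the same restriction to the socle, because \<open>F[t]/(p^k)\<close> is a Frobenius
  algebra in which a factor congruent to 1 modulo \<open>p\<close> is a square if the characteristic is not 2
  (\<open>normalise_generator\<close>); so the matching can be made exact. The orthogonal cyclic submodules span
  \<open>V\<close> (\<open>orthogonal_family_spans\<close>), and \<open>\<Sum> r\<^sub>i(u) x\<^sub>i \<mapsto> \<Sum> r\<^sub>i(-u) x\<^bsub>\<tau> i\<^esub>\<close> is the required involution.
\<close>

section \<open>Linear forms on residue rings of polynomials\<close>

lemma bezout_irreducible:
  fixes p r :: "'a::field poly"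
  assumes "irreducible p" and "\<not> p dvd r"
  obtains \<alpha> \<beta> where "\<alpha> * r + \<beta> * p = 1"
proof -
  define I where "I = {x. \<exists>\<alpha> \<beta>. x = \<alpha> * r + \<beta> * p}"
  have rI: "r \<in> I" unfolding I_def by (rule CollectI, rule exI[of _ 1], rule exI[of _ 0]) simp
  have pI: "p \<in> I" unfolding I_def by (rule CollectI, rule exI[of _ 0], rule exI[of _ 1]) simp
  have mod_I: "x mod y \<in> I" if "x \<in> I" "y \<in> I" for x y
  proof -
    from that obtain a c a' c' where x: "x = a * r + c * p" and y: "y = a' * r + c' * p"
      unfolding I_def by blast
    have "x mod y = x - (x div y) * y" by (simp add: minus_div_mult_eq_mod)
    also have "\<dots> = (a - (x div y) * a') * r + (c - (x div y) * c') * p"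
      unfolding x y by (simp add: algebra_simps)
    finally show ?thesis unfolding I_def by blast
  qed
  have ex: "\<exists>x. x \<in> I \<and> x \<noteq> 0" using pI assms(1) by auto
  define d where "d = arg_min degree (\<lambda>x. x \<in> I \<and> x \<noteq> 0)"
  have d: "d \<in> I" "d \<noteq> 0" and d_min: "\<And>y. y \<in> I \<Longrightarrow> y \<noteq> 0 \<Longrightarrow> degree d \<le> degree y"
    unfolding d_def using arg_min_natI[of "\<lambda>x. x \<in> I \<and> x \<noteq> 0" _ degree]
      arg_min_nat_le[of "\<lambda>x. x \<in> I \<and> x \<noteq> 0" _ degree] ex by blast+
  have d_dvd: "d dvd x" if "x \<in> I" for x
    using mod_I[OF that d(1)] d_min d(2) degree_mod_less[of d x] by (force simp: dvd_eq_mod_eq_0)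
  obtain e where e: "p = d * e" using d_dvd[OF pI] by blast
  from assms(1) e have "is_unit d \<or> is_unit e" using irreducibleD by blast
  moreover have "\<not> is_unit e"
  proof
    assume "is_unit e"
    then have "p dvd d" using e by (simp add: mult_unit_dvd_iff)
    with d_dvd[OF rI] assms(2) show False using dvd_trans by blast
  qed
  ultimately obtain d' where "1 = d * d'" by blast
  moreover obtain a c where "d = a * r + c * p" using d(1) unfolding I_def by blast
  ultimately have "(d' * a) * r + (d' * c) * p = 1" by (simp add: algebra_simps)
  then show thesis by (rule that)
qed

lemma irreducible_dvd_mult:
  fixes p :: "'a::field poly"
  assumes "irreducible p" and "p dvd r * q" and "\<not> p dvd r"
  shows "p dvd q"
  using prime_elem_dvd_multD[OF field_poly_irreducible_imp_prime[OF assms(1)] assms(2)] assms(3) by blast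

lemma bezout_prime_power:
  fixes p r :: "'a::field poly"
  assumes "irreducible p" and "\<not> p dvd r"
  obtains \<alpha> \<beta> where "\<alpha> * r + \<beta> * p ^ n = 1"
proof -
  obtain \<alpha> \<beta> where ab: "\<alpha> * r + \<beta> * p = 1" using bezout_irreducible[OF assms] .
  have "\<exists>x y. x * r + y * p ^ n = 1"
  proof (induction n)
    case 0
    show ?case by (rule exI[of _ 0], rule exI[of _ 1]) simp
  next
    case (Suc n)
    then obtain x y where xy: "x * r + y * p ^ n = 1" by blast
    have "1 = x * r + y * p ^ n * (\<alpha> * r + \<beta> * p)" using xy ab by simp
    also have "\<dots> = (x + y * p ^ n * \<alpha>) * r + (y * \<beta>) * p ^ Suc n" by (simp add: algebra_simps)
    finally show ?case by metis
  qed
  then show thesis using that by blast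
qed

text \<open>A nonzero ideal of \<open>F[t]/(p^k)\<close> contains the socle \<open>p^(k-1)\<close>, so an additive map that does not
  vanish on the socle has no nonzero ideal in its kernel. Maps on \<open>F[t]/(p^k)\<close> are represented by
  maps on polynomials that kill the multiples of \<open>p^k\<close>.\<close>
lemma socle_form_faithful:
  fixes p :: "'a::field poly" and \<phi> :: "'a poly \<Rightarrow> 'b::group_add"
  assumes "irreducible p" and "k \<ge> 1"
    and add: "\<And>r s. \<phi> (r + s) = \<phi> r + \<phi> s"
    and zero: "\<And>r. \<phi> (p ^ k * r) = 0"
    and socle: "\<phi> (p ^ (k - 1) * r0) \<noteq> 0"
    and r: "\<And>q. \<phi> (r * q) = 0"
  shows "p ^ k dvd r"
proof (rule ccontr)
  assume not_dvd: "\<not> p ^ k dvd r"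
  define j where "j = (GREATEST j. p ^ j dvd r)"
  have "p ^ 0 dvd r" by simp
  moreover have bound: "\<And>j. p ^ j dvd r \<Longrightarrow> j \<le> k"
    using not_dvd by (meson le_imp_power_dvd nle_le dvd_trans)
  ultimately have pj: "p ^ j dvd r" unfolding j_def by (metis (mono_tags, lifting) GreatestI_nat)
  have "\<not> p ^ Suc j dvd r" unfolding j_def using bound
    by (metis (mono_tags, lifting) Greatest_le_nat Suc_n_not_le_n)
  have "j < k" using bound[OF pj] pj not_dvd by (metis le_neq_implies_less)
  obtain r' where r': "r = p ^ j * r'" using pj by blast
  then have ndvd: "\<not> p dvd r'" using \<open>\<not> p ^ Suc j dvd r\<close> by (auto simp: mult.assoc dvd_def)
  obtain \<alpha> \<beta> where ab: "\<alpha> * r' + \<beta> * p ^ k = 1" using bezout_prime_power[OF assms(1) ndvd] .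
  have "p ^ (k - 1) * r0 = p ^ (k - 1 - j) * p ^ j * r0 * (\<alpha> * r' + \<beta> * p ^ k)"
    using ab \<open>j < k\<close> by (simp flip: power_add)
  also have "\<dots> = r * (p ^ (k - 1 - j) * r0 * \<alpha>) + p ^ k * (p ^ (k - 1 - j) * p ^ j * r0 * \<beta>)"
    unfolding r' by (simp add: algebra_simps)
  finally have "\<phi> (p ^ (k - 1) * r0) = 0" using add r zero by (metis add.right_neutral)
  then show False using socle by contradiction
qed

text \<open>Linear algebra without dimensions: a form that vanishes on the common kernel of finitely many
  forms is a combination of them.\<close>
lemma form_in_span_of_forms:
  fixes g :: "'i \<Rightarrow> 'w::ab_group_add \<Rightarrow> 'a::field"
  assumes "finite I"
    and f: "\<And>x y. x \<in> W \<Longrightarrow> y \<in> W \<Longrightarrow> f (x - y) = f x - f y"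
      "\<And>c x. x \<in> W \<Longrightarrow> f (sc c x) = c * f x"
    and g: "\<And>i x y. i \<in> I \<Longrightarrow> x \<in> W \<Longrightarrow> y \<in> W \<Longrightarrow> g i (x - y) = g i x - g i y"
      "\<And>i c x. i \<in> I \<Longrightarrow> x \<in> W \<Longrightarrow> g i (sc c x) = c * g i x"
    and W: "\<And>x y. x \<in> W \<Longrightarrow> y \<in> W \<Longrightarrow> x - y \<in> W" "\<And>c x. x \<in> W \<Longrightarrow> sc c x \<in> W"
    and "\<And>x. x \<in> W \<Longrightarrow> \<forall>i\<in>I. g i x = 0 \<Longrightarrow> f x = 0"
  shows "\<exists>c. \<forall>x\<in>W. f x = (\<Sum>i\<in>I. c i * g i x)"
  using assms
proof (induction I arbitrary: f W rule: finite_induct)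
  case empty
  then show ?case by auto
next
  case (insert j I)
  note f = insert.prems(1,2) and g = insert.prems(3,4) and W = insert.prems(5,6)
    and ker = insert.prems(7)
  define W' where "W' = {x \<in> W. g j x = 0}"
  have "\<exists>c. \<forall>x\<in>W'. f x = (\<Sum>i\<in>I. c i * g i x)"
    by (rule insert.IH) (auto simp: W'_def f g W ker)
  then obtain c where c: "\<And>x. x \<in> W' \<Longrightarrow> f x = (\<Sum>i\<in>I. c i * g i x)" by blast
  define h where "h x = f x - (\<Sum>i\<in>I. c i * g i x)" for x
  have h_diff: "h (x - y) = h x - h y" if "x \<in> W" "y \<in> W" for x y
    using that by (simp add: h_def f g right_diff_distrib sum_subtractf)
  have h_sc: "h (sc a x) = a * h x" if "x \<in> W" for a x
    using that by (simp add: h_def f g right_diff_distrib sum_distrib_left mult.left_commute)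
  have h0: "h x = 0" if "x \<in> W" "g j x = 0" for x
    using c that by (simp add: h_def W'_def)
  have "\<exists>d. \<forall>x\<in>W. h x = d * g j x"
  proof (cases "\<exists>z\<in>W. g j z \<noteq> 0")
    case True
    then obtain z where z: "z \<in> W" "g j z \<noteq> 0" by blast
    have "h x = (h z / g j z) * g j x" if "x \<in> W" for x
    proof -
      have "g j (x - sc (g j x / g j z) z) = 0" using that z by (simp add: g W)
      then have "h (x - sc (g j x / g j z) z) = 0" using that z by (intro h0) (auto simp: W)
      then show ?thesis using that z by (simp add: h_diff h_sc W)
    qed
    then show ?thesis by blast
  next
    case False
    then show ?thesis using h0 by (intro exI[of _ 0]) auto
  qed
  then obtain d where d: "\<And>x. x \<in> W \<Longrightarrow> h x = d * g j x" by blast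
  have "f x = (\<Sum>i\<in>insert j I. (c(j := d)) i * g i x)" if "x \<in> W" for x
  proof -
    have "(\<Sum>i\<in>I. (c(j := d)) i * g i x) = (\<Sum>i\<in>I. c i * g i x)"
      using insert.hyps by (intro sum.cong) auto
    then show ?thesis using d[OF that] insert.hyps by (simp add: h_def diff_eq_eq)
  qed
  then show ?case by blast
qed

definition poly_linear :: "('a::field poly \<Rightarrow> 'a) \<Rightarrow> bool" where
  "poly_linear f \<longleftrightarrow> (\<forall>r s. f (r + s) = f r + f s) \<and> (\<forall>c r. f (Polynomial.smult c r) = c * f r)"

lemma poly_linearD:
  assumes "poly_linear f"
  shows "f (r + s) = f r + f s" "f (Polynomial.smult c r) = c * f r" "f 0 = 0" "f (- r) = - f r"
    "f (r - s) = f r - f s" "f (sum h S) = (\<Sum>i\<in>S. f (h i))"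
proof -
  show add: "f (r + s) = f r + f s" for r s using assms by (simp add: poly_linear_def)
  show sc: "f (Polynomial.smult c r) = c * f r" for c r using assms by (simp add: poly_linear_def)
  show zero: "f 0 = 0" using sc[of 0 0] by simp
  show minus: "f (- r) = - f r" for r using sc[of "-1" r] by simp
  show "f (r - s) = f r - f s" using add[of r "- s"] minus by simp
  show "f (sum h S) = (\<Sum>i\<in>S. f (h i))"
    by (induction S rule: infinite_finite_induct) (auto simp: zero add)
qed

lemma poly_linear_vanishes:
  assumes f: "poly_linear f" and "\<And>i. i \<le> n \<Longrightarrow> f (monom 1 i * r) = 0" and "degree s \<le> n"
  shows "f (s * r) = 0"
proof -
  have "s * r = (\<Sum>i\<le>n. monom (coeff s i) i) * r" using assms(3) by (simp add: poly_as_sum_of_monoms')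
  also have "\<dots> = (\<Sum>i\<le>n. Polynomial.smult (coeff s i) (monom 1 i * r))"
    unfolding sum_distrib_right
  proof (rule sum.cong[OF refl])
    fix i show "monom (coeff s i) i * r = Polynomial.smult (coeff s i) (monom 1 i * r)"
      by (metis mult.right_neutral mult_smult_left smult_monom)
  qed
  finally show ?thesis using assms(2) by (simp add: poly_linearD[OF f])
qed

text \<open>\<open>F[t]/(p^k)\<close> is a Frobenius algebra: the forms \<open>r \<mapsto> \<phi> (t^i * r)\<close>, where \<open>i\<close> is at most the
  degree of \<open>p^k\<close>, have common kernel \<open>(p^k)\<close> and thus span the dual.\<close>
lemma form_is_multiple:
  fixes p :: "'a::field poly"
  assumes "irreducible p" and "k \<ge> 1"
    and \<phi>: "poly_linear \<phi>" "\<And>r. \<phi> (p ^ k * r) = 0" and socle: "\<phi> (p ^ (k - 1) * r0) \<noteq> 0"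
    and \<psi>: "poly_linear \<psi>" "\<And>r. \<psi> (p ^ k * r) = 0"
  shows "\<exists>h. \<forall>r. \<psi> r = \<phi> (h * r)"
proof -
  define n where "n = degree (p ^ k)"
  have "p \<noteq> 0" using assms(1) by auto
  have ker: "p ^ k dvd r" if "\<forall>i\<in>{..n}. \<phi> (monom 1 i * r) = 0" for r
  proof (rule socle_form_faithful[of p k \<phi> r0])
    fix q
    have "\<phi> (r * q) = \<phi> (p ^ k * (r * (q div p ^ k)) + r * (q mod p ^ k))"
      by (metis distrib_left mult.left_commute div_mult_mod_eq mult.commute)
    also have "\<dots> = \<phi> (r * (q mod p ^ k))" using \<phi>(2) by (simp add: poly_linearD[OF \<phi>(1)])
    also have "\<phi> (r * (q mod p ^ k)) = 0"
    proof -
      have deg: "degree (q mod p ^ k) \<le> n"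
        using degree_mod_less[of "p ^ k" q] \<open>p \<noteq> 0\<close> unfolding n_def by fastforce
      have "\<phi> ((q mod p ^ k) * r) = 0"
        by (rule poly_linear_vanishes[OF \<phi>(1), where n = n]) (use that deg in auto)
      then show ?thesis by (simp only: mult.commute)
    qed
    finally show "\<phi> (r * q) = 0" .
  qed (use assms in \<open>auto simp: poly_linearD[OF \<phi>(1)]\<close>)
  have "\<exists>c. \<forall>x\<in>UNIV. \<psi> x = (\<Sum>i\<in>{..n}. c i * \<phi> (monom 1 i * x))"
  proof (rule form_in_span_of_forms[where sc = Polynomial.smult])
    fix x assume "\<forall>i\<in>{..n}. \<phi> (monom 1 i * x) = 0"
    then have "p ^ k dvd x" by (rule ker)
    then show "\<psi> x = 0" using \<psi>(2) by blast
  qed (use \<phi>(1) \<psi>(1) in \<open>auto simp: poly_linearD[OF \<phi>(1)] poly_linearD[OF \<psi>(1)] right_diff_distrib\<close>)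
  then obtain c where c: "\<And>r. \<psi> r = (\<Sum>i\<in>{..n}. c i * \<phi> (monom 1 i * r))" by auto
  have "\<psi> r = \<phi> ((\<Sum>i\<in>{..n}. Polynomial.smult (c i) (monom 1 i)) * r)" for r
    unfolding c by (simp add: sum_distrib_right poly_linearD[OF \<phi>(1)])
  then show ?thesis by blast
qed

text \<open>Two forms that agree on the socle differ by a factor \<open>h\<close> for which \<open>h - 1\<close> kills the socle.\<close>
lemma form_is_multiple_principal_unit:
  fixes p :: "'a::field poly"
  assumes "irreducible p" and "k \<ge> 1"
    and \<phi>: "poly_linear \<phi>" "\<And>r. \<phi> (p ^ k * r) = 0" and socle: "\<phi> (p ^ (k - 1) * r0) \<noteq> 0"
    and \<psi>: "poly_linear \<psi>" "\<And>r. \<psi> (p ^ k * r) = 0"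
    and agree: "\<And>r. \<psi> (p ^ (k - 1) * r) = \<phi> (p ^ (k - 1) * r)"
  shows "\<exists>h. p dvd h - 1 \<and> (\<forall>r. \<psi> r = \<phi> (h * r))"
proof -
  obtain h where h: "\<And>r. \<psi> r = \<phi> (h * r)" using form_is_multiple[OF assms(1-7)] by blast
  have "p ^ k dvd p ^ (k - 1) * (h - 1)"
  proof (rule socle_form_faithful[of p k \<phi> r0])
    fix q
    have "\<phi> (p ^ (k - 1) * (h - 1) * q) = \<phi> (h * (p ^ (k - 1) * q)) - \<phi> (p ^ (k - 1) * q)"
      by (simp add: algebra_simps flip: poly_linearD(5)[OF \<phi>(1)])
    then show "\<phi> (p ^ (k - 1) * (h - 1) * q) = 0" using h agree by simp
  qed (use assms in \<open>auto simp: poly_linearD[OF \<phi>(1)]\<close>)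
  moreover have "p ^ k = p ^ (k - 1) * p" using assms(2) power_minus_mult[of k p] by simp
  moreover have "p ^ (k - 1) \<noteq> 0" using assms(1) by auto
  ultimately have "p dvd h - 1" by (metis dvd_mult_cancel_left)
  with h show ?thesis by blast
qed

text \<open>Hensel's lemma for \<open>X^2 - h\<close>, in the form of Newton's iteration \<open>q \<mapsto> q + (h - q^2) / 2\<close>.\<close>
lemma sqrt_principal_unit:
  fixes p h :: "'a::field poly"
  assumes two: "(2::'a) \<noteq> 0" and h: "p dvd h - 1"
  shows "\<exists>q. p dvd q - 1 \<and> p ^ k dvd q * q - h"
proof (induction k)
  case 0
  show ?case by (rule exI[of _ 1]) simp
next
  case (Suc k)
  show ?case
  proof (cases k)
    case 0
    then show ?thesis using h by (intro exI[of _ 1]) (auto simp: dvd_diff_commute)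
  next
    case (Suc m)
    from Suc.IH obtain q where q: "p dvd q - 1" "p ^ k dvd q * q - h" by blast
    obtain d where d: "q * q - h = p ^ k * d" using q(2) by blast
    obtain e where e: "q - 1 = p * e" using q(1) by blast
    define w where "w = Polynomial.smult (1 / 2) (p ^ k * d)"
    have ww: "w + w = p ^ k * d" 
    proof -
      have "w + w = Polynomial.smult (1 / 2 + 1 / 2) (p ^ k * d)"
        unfolding w_def by (simp only: smult_add_left)
      also have "1 / 2 + 1 / 2 = (1::'a)" using two by (metis add_divide_distrib one_add_one divide_self)
      finally show ?thesis by simp
    qed
    have pw: "p ^ k dvd w" unfolding w_def by (intro dvd_smult dvd_triv_left)
    have "p dvd w" using pw Suc by (metis dvd_mult_left power_Suc)
    have "(q - w) * (q - w) - h = (w + w) - q * (w + w) + w * w"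
      using d ww by (simp add: algebra_simps)
    also have "\<dots> = w * w - (q - 1) * (p ^ k * d)" unfolding ww by (simp add: algebra_simps)
    finally have eq: "(q - w) * (q - w) - h = w * w - (q - 1) * (p ^ k * d)" .
    have "p ^ Suc k dvd w * w" using pw \<open>p dvd w\<close> by (simp add: mult_dvd_mono)
    moreover have "p ^ Suc k dvd (q - 1) * (p ^ k * d)" unfolding e by (simp add: mult_dvd_mono)
    ultimately have "p ^ Suc k dvd (q - w) * (q - w) - h" unfolding eq by (rule dvd_diff)
    moreover have "p dvd (q - w) - 1"
    proof -
      have eq: "(q - w) - 1 = (q - 1) - w" by simp
      show ?thesis unfolding eq by (rule dvd_diff[OF q(1) \<open>p dvd w\<close>])
    qed
    ultimately show ?thesis by blast
  qed
qed

section \<open>Monic irreducible polynomials\<close>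

lemma IrrD: "p \<in> Irr \<Longrightarrow> irreducible p" "p \<in> Irr \<Longrightarrow> lead_coeff p = 1" "p \<in> Irr \<Longrightarrow> p \<noteq> 0"
  by (auto simp: Irr_def)

lemma Irr_degree_pos: "p \<in> Irr \<Longrightarrow> degree p > 0"
  by (metis IrrD(1,3) irreducible_not_unit is_unit_iff_degree neq0_conv)

lemma Irr_dvd_imp_eq:
  assumes "p \<in> Irr" "q \<in> Irr" "p dvd q"
  shows "p = q"
proof -
  obtain c where c: "q = p * c" using assms(3) by blast
  have "is_unit c"
    using irreducibleD[OF IrrD(1)[OF assms(2)] c] irreducible_not_unit[OF IrrD(1)[OF assms(1)]] by blast
  moreover have "c \<noteq> 0" using c IrrD(3)[OF assms(2)] by auto
  ultimately obtain a where a: "c = [:a:]" by (metis is_unit_iff_degree degree_eq_zeroE)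
  have "lead_coeff q = lead_coeff p * lead_coeff c" unfolding c by (rule lead_coeff_mult)
  then have "a = 1" using IrrD(2)[OF assms(1)] IrrD(2)[OF assms(2)] a by simp
  then show ?thesis using c a by (simp flip: one_pCons)
qed

lemma exists_Irr_factor:
  fixes q :: "'a::field poly"
  assumes "q \<noteq> 0" "\<not> is_unit q"
  shows "\<exists>p\<in>Irr. p dvd q"
proof -
  let ?S = "\<lambda>d. d dvd q \<and> \<not> is_unit d"
  have ex: "?S q" using assms by simp
  define d where "d = arg_min degree ?S"
  have d: "?S d" unfolding d_def by (rule arg_min_natI[of ?S, OF ex])
  have d_min: "degree d \<le> degree e" if "?S e" for e
    unfolding d_def using that by (rule arg_min_nat_le)
  have "d \<noteq> 0" using d assms(1) by auto
  have irr: "irreducible d"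
  proof (rule irreducibleI)
    fix x y assume xy: "d = x * y"
    have nz: "x \<noteq> 0" "y \<noteq> 0" using \<open>d \<noteq> 0\<close> xy by auto
    show "is_unit x \<or> is_unit y"
    proof (rule disjCI)
      assume y: "\<not> is_unit y"
      have "degree d \<le> degree y" using d_min[of y] d y xy by (meson dvd_trans dvd_triv_right)
      then have "degree x = 0" using nz by (simp add: xy degree_mult_eq)
      then show "is_unit x" using nz by (simp add: is_unit_iff_degree)
    qed
  qed (use d \<open>d \<noteq> 0\<close> in auto)
  let ?c = "inverse (lead_coeff d)"
  have c: "?c \<noteq> 0" using \<open>d \<noteq> 0\<close> by simp
  have "irreducible (Polynomial.smult ?c d)"
  proof -
    have "Polynomial.smult ?c d = [:?c:] * d" by simp
    moreover have "is_unit [:?c:]" using c by (simp add: is_unit_const_poly_iff dvd_field_iff)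
    ultimately show ?thesis using irr by (metis irreducible_mult_unit_left)
  qed
  moreover have "lead_coeff (Polynomial.smult ?c d) = 1" using \<open>d \<noteq> 0\<close> by (simp add: lead_coeff_smult)
  moreover have "Polynomial.smult ?c d dvd q" using d c by (simp add: smult_dvd_iff)
  ultimately show ?thesis unfolding Irr_def by blast
qed

lemma exact_power_factor:
  fixes p m :: "'a::field poly"
  assumes "p \<noteq> 0" "\<not> is_unit p" "m \<noteq> 0"
  shows "\<exists>a m'. m = p ^ a * m' \<and> \<not> p dvd m'"
  using assms(3)
proof (induction "degree m" arbitrary: m rule: less_induct)
  case less
  show ?case
  proof (cases "p dvd m")
    case True
    then obtain c where c: "m = p * c" by blast
    have "degree p > 0" using assms(1,2) by (simp add: is_unit_iff_degree)
    then have "degree c < degree m" "c \<noteq> 0" using less.prems c assms(1) by (auto simp: degree_mult_eq)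
    from less.hyps[OF this] obtain a m' where "c = p ^ a * m'" "\<not> p dvd m'" by blast
    then show ?thesis using c by (intro exI[of _ "Suc a"] exI[of _ m']) (simp add: mult.assoc)
  next
    case False
    then show ?thesis by (intro exI[of _ 0] exI[of _ m]) simp
  qed
qed

lemma finite_Irr_divisors:
  fixes m :: "'a::field poly"
  assumes "m \<noteq> 0"
  shows "finite {q \<in> Irr. q dvd m}"
  using assms
proof (induction "degree m" arbitrary: m rule: less_induct)
  case less
  show ?case
  proof (cases "is_unit m")
    case True
    have "\<not> q dvd m" if "q \<in> Irr" for q
      using irreducible_not_unit[OF IrrD(1)[OF that]] True dvd_trans by blast
    then have "{q \<in> Irr. q dvd m} = {}" by blast
    then show ?thesis by (simp only: finite.emptyI)
  next
    case False
    then obtain p c where p: "p \<in> Irr" and c: "m = p * c" using exists_Irr_factor less.prems by blast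
    have "c \<noteq> 0" using c less.prems by auto
    then have "degree c < degree m" using Irr_degree_pos[OF p] IrrD(3)[OF p] by (simp add: c degree_mult_eq)
    then have "finite {q \<in> Irr. q dvd c}" using less.hyps \<open>c \<noteq> 0\<close> by blast
    moreover have "{q \<in> Irr. q dvd m} \<subseteq> insert p {q \<in> Irr. q dvd c}"
    proof
      fix q assume "q \<in> {q \<in> Irr. q dvd m}"
      then have q: "q \<in> Irr" "q dvd p * c" by (auto simp: c)
      show "q \<in> insert p {q \<in> Irr. q dvd c}"
      proof (cases "q dvd p")
        case True
        then show ?thesis using Irr_dvd_imp_eq[OF q(1) p] by blast
      next
        case False
        then show ?thesis using irreducible_dvd_mult[OF IrrD(1)[OF q(1)] q(2)] q(1) by blast
      qed
    qed
    ultimately show ?thesis using finite_subset by blast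
  qed
qed

section \<open>The substitution of -t for t\<close>

lemma subst_neg_simps [simp]:
  "subst_neg 0 = 0" "subst_neg 1 = 1" "subst_neg (r + s) = subst_neg r + subst_neg s"
  "subst_neg (- r) = - subst_neg r" "subst_neg (r - s) = subst_neg r - subst_neg s"
  "subst_neg (r * s) = subst_neg r * subst_neg s"
  "subst_neg (Polynomial.smult c r) = Polynomial.smult c (subst_neg r)"
  "subst_neg [:0, 1:] = - [:0, 1:]"
  by (simp_all add: subst_neg_def pcompose_add pcompose_uminus pcompose_diff pcompose_mult
      pcompose_smult pcompose_pCons pcompose_1)

lemma subst_neg_power [simp]: "subst_neg (r ^ n) = subst_neg r ^ n"
  by (induction n) simp_all

lemma subst_neg_subst_neg [simp]: "subst_neg (subst_neg r) = r"
  by (simp add: subst_neg_def pcompose_pCons flip: pcompose_assoc)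

lemma subst_neg_eq_iff: "subst_neg r = s \<longleftrightarrow> r = subst_neg s"
  by (metis subst_neg_subst_neg)

lemma degree_subst_neg [simp]: "degree (subst_neg r) = degree r"
  by (simp add: subst_neg_def degree_pcompose)

lemma coeff_0_subst_neg [simp]: "coeff (subst_neg r) 0 = coeff r 0"
  by (simp add: subst_neg_def coeff_pcompose_0 poly_0_coeff_0)

lemma coeff_subst_neg: "coeff (subst_neg r) n = (- 1) ^ n * coeff r n"
  unfolding subst_neg_def
  by (induction r arbitrary: n) (auto simp: pcompose_pCons coeff_pCons split: nat.split)

lemma subst_neg_dvd_iff: "subst_neg r dvd subst_neg s \<longleftrightarrow> r dvd s"
proof
  assume "subst_neg r dvd subst_neg s"
  then obtain c where "subst_neg s = subst_neg r * c" by blast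
  then have "s = r * subst_neg c" by (metis subst_neg_simps(6) subst_neg_subst_neg)
  then show "r dvd s" by simp
qed (auto simp: dvd_def)

lemma subst_neg_dvd_swap: "subst_neg r dvd s \<longleftrightarrow> r dvd subst_neg s"
  by (metis subst_neg_dvd_iff subst_neg_subst_neg)

lemma subst_neg_mod: "subst_neg (r mod s) = subst_neg r mod subst_neg s"
proof (cases "s = 0")
  case False
  have "subst_neg r = subst_neg (r div s * s + r mod s)" by simp
  then have "subst_neg r = subst_neg (r mod s) + subst_neg (r div s) * subst_neg s"
    by (simp only: subst_neg_simps add.commute)
  then have "subst_neg r mod subst_neg s = subst_neg (r mod s) mod subst_neg s" by (metis mod_mult_self1)
  moreover have "degree (subst_neg (r mod s)) < degree (subst_neg s) \<or> subst_neg (r mod s) = 0"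
    using degree_mod_less[OF False, of r] by (auto simp: subst_neg_eq_iff)
  ultimately show ?thesis by (auto simp: mod_poly_less)
qed simp

lemma op_poly_eq: "op_poly p = Polynomial.smult ((- 1) ^ degree p) (subst_neg p)"
  by (rule op_poly_def)

lemma op_poly_dvd_iff: "op_poly p ^ n dvd r \<longleftrightarrow> p ^ n dvd subst_neg r"
proof -
  have "op_poly p ^ n = Polynomial.smult (((- 1) ^ degree p) ^ n) (subst_neg (p ^ n))"
    by (simp add: op_poly_eq smult_power)
  then show ?thesis by (simp add: smult_dvd_iff subst_neg_dvd_swap del: subst_neg_power)
qed

lemma op_poly_dvd_iff1: "op_poly p dvd r \<longleftrightarrow> p dvd subst_neg r"
  using op_poly_dvd_iff[of p 1 r] by simp

lemma degree_op_poly [simp]: "degree (op_poly p) = degree p"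
  by (simp add: op_poly_eq)

lemma op_poly_op_poly [simp]: "op_poly (op_poly p) = p"
  by (simp add: op_poly_eq degree_smult_eq flip: power_mult_distrib)

lemma op_poly_Irr:
  assumes "p \<in> Irr" shows "op_poly p \<in> Irr"
proof -
  have "lead_coeff (op_poly p) = 1"
    using IrrD(2)[OF assms] by (simp add: op_poly_eq coeff_subst_neg flip: power_mult_distrib)
  moreover have "irreducible (op_poly p)"
  proof (rule irreducibleI)
    show "op_poly p \<noteq> 0" using calculation by auto
    show "\<not> is_unit (op_poly p)" using Irr_degree_pos[OF assms] \<open>op_poly p \<noteq> 0\<close>
      by (simp add: is_unit_iff_degree)
    fix x y assume "op_poly p = x * y"
    then have "subst_neg (op_poly p) = subst_neg x * subst_neg y" by simp
    then have "Polynomial.smult ((- 1) ^ degree p) p = subst_neg x * subst_neg y"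
      by (simp add: op_poly_eq)
    then have "Polynomial.smult ((- 1) ^ degree p) (Polynomial.smult ((- 1) ^ degree p) p)
        = Polynomial.smult ((- 1) ^ degree p) (subst_neg x) * subst_neg y" by simp
    then have "p = Polynomial.smult ((- 1) ^ degree p) (subst_neg x) * subst_neg y"
      by (simp flip: power_mult_distrib)
    from irreducibleD[OF IrrD(1)[OF assms] this]
    show "is_unit x \<or> is_unit y"
      using subst_neg_dvd_iff[of x 1] subst_neg_dvd_iff[of y 1] by (auto simp: is_unit_smult_iff)
  qed
  ultimately show ?thesis by (simp add: Irr_def)
qed

lemma Irr0_imp:
  assumes "p \<in> Irr0"
  shows "p \<in> Irr" "subst_neg p = p" "even (degree p)" "op_poly p = p"
proof -
  show "p \<in> Irr" using assms by (simp add: Irr0_def)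
  obtain q where q: "p = pcompose q (monom 1 2)" using assms by (auto simp: Irr0_def)
  show sp: "subst_neg p = p" unfolding q subst_neg_def
    by (simp add: monom_altdef pcompose_mult pcompose_pCons power2_eq_square flip: pcompose_assoc)
  show ev: "even (degree p)" unfolding q by (simp add: degree_pcompose degree_monom_eq)
  show "op_poly p = p" by (simp add: op_poly_eq sp ev)
qed

lemma X_Irr: "[:0, 1:] \<in> Irr"
  by (simp add: Irr_def irreducible_linear_field_poly)

text \<open>If \<open>p^op = p\<close>, then \<open>p(-t) = p(t)\<close> or \<open>p(-t) = -p(t)\<close>. In the first case the odd coefficients vanish;
  in the second one \<open>p(0) = 0\<close>, so \<open>t\<close> divides \<open>p\<close>.\<close>
lemma op_poly_fixed:
  fixes p :: "'a::field poly"
  assumes two: "(2::'a) \<noteq> 0" and p: "p \<in> Irr" and fixed: "op_poly p = p"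
  shows "p \<in> Irr0 \<or> p = [:0, 1:]"
proof (cases "even (degree p)")
  case True
  then have "subst_neg p = p" using fixed by (simp add: op_poly_eq)
  then have odd_0: "coeff p n = 0" if "odd n" for n
  proof -
    have "coeff p n = - coeff p n" using coeff_subst_neg[of p n] \<open>subst_neg p = p\<close> that by simp
    then have "2 * coeff p n = 0" by (metis add.right_inverse mult_2)
    then show ?thesis using two by simp
  qed
  define q where "q = (\<Sum>i\<le>degree p. monom (coeff p (2 * i)) i)"
  have "pcompose q (monom 1 2) = (\<Sum>i\<le>degree p. monom (coeff p (2 * i)) (2 * i))"
    unfolding q_def pcompose_sum
  proof (rule sum.cong[OF refl])
    fix i
    have "pcompose (monom c i) (monom 1 2) = monom c (2 * i)" for c :: 'a
      by (induction i) (simp_all add: monom_0 monom_Suc pcompose_pCons mult_monom)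
    then show "pcompose (monom (coeff p (2 * i)) i) (monom 1 2) = monom (coeff p (2 * i)) (2 * i)" .
  qed
  also have "\<dots> = p"
  proof (rule poly_eqI)
    fix n
    show "coeff (\<Sum>i\<le>degree p. monom (coeff p (2 * i)) (2 * i)) n = coeff p n"
    proof (cases "even n")
      case False
      then have "\<And>i. 2 * i \<noteq> n" by auto
      then show ?thesis using odd_0[OF False] by (simp add: coeff_sum)
    next
      case True
      then obtain m where m: "n = 2 * m" by blast
      have "coeff (\<Sum>i\<le>degree p. monom (coeff p (2 * i)) (2 * i)) n
          = (\<Sum>i\<le>degree p. if i = m then coeff p (2 * i) else 0)"
        by (simp add: coeff_sum m if_distrib cong: if_cong)
      also have "\<dots> = coeff p n" by (auto simp: m coeff_eq_0)
      finally show ?thesis .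
    qed
  qed
  finally show ?thesis using p unfolding Irr0_def by (metis (mono_tags, lifting) IntI mem_Collect_eq)
next
  case False
  then have "subst_neg p = - p" using fixed by (metis op_poly_eq minus_minus neg_one_odd_power smult_1_left smult_minus_left)
  then have "coeff p 0 = - coeff p 0" using coeff_0_subst_neg[of p] by simp
  then have "2 * coeff p 0 = 0" by (metis add.right_inverse mult_2)
  then have "coeff p 0 = 0" using two by simp
  then have "[:0, 1:] dvd p" by (metis dvd_iff_poly_eq_0 minus_zero poly_0_coeff_0)
  then show ?thesis using Irr_dvd_imp_eq[OF X_Irr p] by blast
qed

lemma X_not_Irr0: "[:0, 1:] \<notin> Irr0"
  using Irr0_imp(3) by fastforce

section \<open>The residue field as a record\<close>

definition cls :: "'a::field poly \<Rightarrow> 'a poly \<Rightarrow> 'a poly set" where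
  "cls p r = {q. p dvd q - r}"

lemma cls_eq_iff: "cls p r = cls p s \<longleftrightarrow> p dvd r - s"
proof
  assume "cls p r = cls p s"
  moreover have "r \<in> cls p r" by (simp add: cls_def)
  ultimately have "r \<in> cls p s" by simp
  then show "p dvd r - s" by (simp add: cls_def)
next
  assume rs: "p dvd r - s"
  have "p dvd q - r \<longleftrightarrow> p dvd q - s" for q
    using dvd_add[OF _ rs, of "q - r"] dvd_diff[OF _ rs, of "q - s"] by auto
  then show "cls p r = cls p s" by (simp add: cls_def)
qed

lemma PIdl_eq: "PIdl\<^bsub>poly_ring\<^esub> p = cls p 0"
  by (auto simp: cgenideal_def ring_of_type_algebra_def cls_def dvd_def mult.commute)

lemma poly_ring_coset: "PIdl\<^bsub>poly_ring\<^esub> p +>\<^bsub>poly_ring\<^esub> r = cls p r"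
proof (rule Set.set_eqI)
  fix q
  have "q \<in> PIdl\<^bsub>poly_ring\<^esub> p +>\<^bsub>poly_ring\<^esub> r \<longleftrightarrow> (\<exists>n\<in>cls p 0. q = n + r)"
    unfolding PIdl_eq a_r_coset_def' by (auto simp: ring_of_type_algebra_def)
  also have "\<dots> \<longleftrightarrow> q - r \<in> cls p 0" by (metis add_diff_cancel_right' diff_add_cancel)
  finally show "q \<in> PIdl\<^bsub>poly_ring\<^esub> p +>\<^bsub>poly_ring\<^esub> r \<longleftrightarrow> q \<in> cls p r" by (simp add: cls_def)
qed

lemma PIdl_ideal: "ideal (PIdl\<^bsub>poly_ring\<^esub> p) (poly_ring :: 'a::field poly ring)"
  by (rule cring.cgenideal_ideal) (auto simp: ring_of_type_algebra_def intro: cring_from_type_algebra[unfolded ring_of_type_algebra_def])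

lemma res_field_carrier: "carrier (res_field p) = range (cls p)"
  by (auto simp: res_field_def FactRing_def A_RCOSETS_def' poly_ring_coset)
    (auto simp: ring_of_type_algebra_def)

lemma cls_in_carrier [simp]: "cls p r \<in> carrier (res_field p)"
  by (simp add: res_field_carrier)

lemma res_field_cring: "cring (res_field (p::'a::field poly))"
  unfolding res_field_def by (rule ideal.quotient_is_cring[OF PIdl_ideal]) (rule cring_from_type_algebra)

lemma res_field_mult: "cls p r \<otimes>\<^bsub>res_field p\<^esub> cls p s = cls p (r * s)"
  using ideal.rcoset_mult_add[OF PIdl_ideal, of r s p]
  by (simp add: res_field_def FactRing_def poly_ring_coset) (simp add: ring_of_type_algebra_def)

lemma res_field_add: "cls p r \<oplus>\<^bsub>res_field p\<^esub> cls p s = cls p (r + s)"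
proof -
  interpret ideal "PIdl\<^bsub>poly_ring\<^esub> p" "poly_ring :: 'a poly ring" by (rule PIdl_ideal)
  show ?thesis
    using a_rcos_sum[of r s]
    by (simp add: res_field_def FactRing_def poly_ring_coset) (simp add: ring_of_type_algebra_def)
qed

lemma res_field_one: "\<one>\<^bsub>res_field p\<^esub> = cls p 1"
  by (simp add: res_field_def FactRing_def poly_ring_coset) (simp add: ring_of_type_algebra_def)

lemma res_field_zero: "\<zero>\<^bsub>res_field p\<^esub> = cls p 0"
  by (simp add: res_field_def FactRing_def PIdl_eq)

lemma res_field_uminus: "\<ominus>\<^bsub>res_field p\<^esub> cls p r = cls p (- r)"
proof -
  interpret cring "res_field p" by (rule res_field_cring)
  have "cls p r \<oplus>\<^bsub>res_field p\<^esub> cls p (- r) = \<zero>\<^bsub>res_field p\<^esub>"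
    by (simp add: res_field_add res_field_zero)
  then show ?thesis by (metis cls_in_carrier minus_equality a_comm)
qed

lemma res_field_minus: "cls p r \<ominus>\<^bsub>res_field p\<^esub> cls p s = cls p (r - s)"
  by (simp add: a_minus_def res_field_uminus res_field_add)

lemma res_field_power: "cls p r [^]\<^bsub>res_field p\<^esub> (n::nat) = cls p (r ^ n)"
proof -
  interpret cring "res_field p" by (rule res_field_cring)
  show ?thesis by (induction n) (simp_all add: res_field_one res_field_mult mult.commute)
qed

lemma res_field_field:
  assumes "p \<in> Irr"
  shows "field (res_field p)"
proof (rule cring.cring_fieldI2[OF res_field_cring])
  show "\<zero>\<^bsub>res_field p\<^esub> \<noteq> \<one>\<^bsub>res_field p\<^esub>"
    using irreducible_not_unit[OF IrrD(1)[OF assms]]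
    by (simp add: res_field_zero res_field_one cls_eq_iff)
  fix a assume a: "a \<in> carrier (res_field p)" "a \<noteq> \<zero>\<^bsub>res_field p\<^esub>"
  then obtain r where r: "a = cls p r" by (auto simp: res_field_carrier)
  then have r': "\<not> p dvd r" using a(2) by (simp add: res_field_zero cls_eq_iff)
  obtain \<alpha> \<beta> where ab: "\<alpha> * r + \<beta> * p = 1" using bezout_irreducible[OF IrrD(1)[OF assms] r'] .
  have "r * \<alpha> - 1 = - \<beta> * p" using ab by (simp add: algebra_simps flip: ab)
  then have "a \<otimes>\<^bsub>res_field p\<^esub> cls p \<alpha> = \<one>\<^bsub>res_field p\<^esub>"
    by (simp add: r res_field_mult res_field_one cls_eq_iff)
  then show "\<exists>b\<in>carrier (res_field p). a \<otimes>\<^bsub>res_field p\<^esub> b = \<one>\<^bsub>res_field p\<^esub>" by auto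
qed

lemma e_form_cls: "e_form p (cls p r) = coeff (r mod p) 0"
proof -
  have *: "q mod p = r mod p" if "q \<in> cls p r" for q
    using that unfolding cls_def mem_Collect_eq mod_eq_dvd_iff .
  have r: "r \<in> cls p r" by (simp add: cls_def)
  show ?thesis unfolding e_form_def
  proof (rule the_equality)
    show "\<forall>q\<in>cls p r. coeff (q mod p) 0 = coeff (r mod p) 0" by (simp add: *)
    show "c = coeff (r mod p) 0" if "\<forall>q\<in>cls p r. coeff (q mod p) 0 = c" for c
      using bspec[OF that r] by simp
  qed
qed

lemma res_refl_cls: "res_refl (cls (op_poly p) r) = cls p (subst_neg r)"
proof (rule Set.set_eqI)
  fix q
  have "q \<in> res_refl (cls (op_poly p) r) \<longleftrightarrow> subst_neg q \<in> cls (op_poly p) r"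
    unfolding res_refl_def by (metis image_iff subst_neg_subst_neg)
  also have "\<dots> \<longleftrightarrow> q \<in> cls p (subst_neg r)" by (simp add: cls_def op_poly_dvd_iff1)
  finally show "q \<in> res_refl (cls (op_poly p) r) \<longleftrightarrow> q \<in> cls p (subst_neg r)" .
qed

lemma res_refl_cls': "res_refl (cls p r) = cls (op_poly p) (subst_neg r)"
  using res_refl_cls[of "op_poly p" r] by simp

lemma poly_linear_e: "poly_linear (\<lambda>r. coeff (r mod p) 0)"
  by (simp add: poly_linear_def poly_mod_add_left mod_smult_left)

text \<open>The form \<open>e_p\<close> does not vanish on \<open>F[t]/(p)\<close>, which is its own socle.\<close>
lemma e_form_representation:
  assumes p: "p \<in> Irr" and f: "poly_linear f" "\<And>r. f (p * r) = 0"
  shows "\<exists>c. \<forall>r. f r = coeff ((r * c) mod p) 0"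
proof -
  have "coeff (1 mod p) 0 \<noteq> (0::'a)"
    using Irr_degree_pos[OF p] by (simp add: mod_poly_less)
  then have "\<exists>h. \<forall>r. f r = coeff ((h * r) mod p) 0"
    by (intro form_is_multiple[OF IrrD(1)[OF p] order_refl poly_linear_e _ _ f(1), where ?r0.0 = 1])
      (simp_all add: f(2))
  then show ?thesis by (simp add: mult.commute)
qed

lemma e_form_nondegenerate:
  assumes p: "p \<in> Irr" and "\<And>r. coeff ((r * c) mod p) 0 = 0"
  shows "p dvd c"
proof (rule ccontr)
  assume "\<not> p dvd c"
  then obtain \<alpha> \<beta> where ab: "\<alpha> * c + \<beta> * p = 1"
    using bezout_irreducible[OF IrrD(1)[OF p]] by blast
  have "(\<alpha> * c) mod p = 1 mod p" using ab by (metis mod_mult_self1)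
  then show False using assms(2)[of \<alpha>] Irr_degree_pos[OF p] by (simp add: mod_poly_less)
qed

section \<open>A selfadjoint endomorphism and the polynomials in it\<close>

locale selfadjoint_space = finite_dimensional_vector_space scale Basis
  for scale :: "'a::field \<Rightarrow> 'v::ab_group_add \<Rightarrow> 'v" and Basis :: "'v set" +
  fixes b :: "'v \<Rightarrow> 'v \<Rightarrow> 'a" and u :: "'v \<Rightarrow> 'v"
  assumes sym_bilinear: "sym_bilinear_form scale b"
    and nondegenerate: "nondegenerate_form b"
    and selfadjoint: "selfadjoint_endo scale b u"
begin

abbreviation P :: "'a poly \<Rightarrow> 'v \<Rightarrow> 'v" where "P \<equiv> poly_endo scale u"
abbreviation K :: "'a poly \<Rightarrow> nat \<Rightarrow> 'v set" where "K \<equiv> ker_pow scale u"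
abbreviation N :: "'a poly \<Rightarrow> nat \<Rightarrow> 'v set" where "N \<equiv> inv_denominator scale u"
abbreviation W :: "'a poly \<Rightarrow> nat \<Rightarrow> ('a poly set, 'v set) module" where "W \<equiv> inv_space scale u"
abbreviation C :: "'a poly \<Rightarrow> nat \<Rightarrow> 'v set \<Rightarrow> 'v set \<Rightarrow> 'a poly set" where
  "C \<equiv> quad_invariant scale b u"

lemma b_commute: "b x y = b y x"
  using sym_bilinear by (simp add: sym_bilinear_form_def)

lemma b_right:
  "b x (y + z) = b x y + b x z" "b x (scale c y) = c * b x y" "b x 0 = 0"
  "b x (- y) = - b x y" "b x (y - z) = b x y - b x z" "b x (sum f S) = (\<Sum>i\<in>S. b x (f i))"
proof -
  have "Vector_Spaces.linear scale (*) (b x)"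
    using sym_bilinear by (simp add: sym_bilinear_form_def)
  then interpret l: Vector_Spaces.linear scale "(*)" "b x" .
  show "b x (y + z) = b x y + b x z" "b x (scale c y) = c * b x y" "b x 0 = 0"
    "b x (- y) = - b x y" "b x (y - z) = b x y - b x z" "b x (sum f S) = (\<Sum>i\<in>S. b x (f i))"
    by (fact l.add l.scale l.zero l.neg l.diff l.sum)+
qed

lemma b_left:
  "b (x + y) z = b x z + b y z" "b (scale c x) z = c * b x z" "b 0 z = 0"
  "b (- x) z = - b x z" "b (x - y) z = b x z - b y z" "b (sum f S) z = (\<Sum>i\<in>S. b (f i) z)"
  by (simp_all add: b_commute[of _ z] b_right)

lemma b_nondegenerate: "(\<And>y. b x y = 0) \<Longrightarrow> x = 0"
  using nondegenerate by (auto simp: nondegenerate_form_def)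

lemma u_selfadjoint: "b (u x) y = b x (u y)"
  using selfadjoint by (simp add: selfadjoint_endo_def)

lemma u_linear: "u (x + y) = u x + u y" "u (scale c x) = scale c (u x)" "u 0 = 0"
  "u (- x) = - u x" "u (x - y) = u x - u y" "u (sum f S) = (\<Sum>i\<in>S. u (f i))"
proof -
  have "Vector_Spaces.linear scale scale u"
    using selfadjoint by (simp add: selfadjoint_endo_def)
  then interpret l: Vector_Spaces.linear scale scale u .
  show "u (x + y) = u x + u y" "u (scale c x) = scale c (u x)" "u 0 = 0"
    "u (- x) = - u x" "u (x - y) = u x - u y" "u (sum f S) = (\<Sum>i\<in>S. u (f i))"
    by (fact l.add l.scale l.zero l.neg l.diff l.sum)+
qed

lemma P_eq_sum_atMost:
  assumes "degree q \<le> n"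
  shows "P q x = (\<Sum>i\<le>n. scale (coeff q i) ((u ^^ i) x))"
  unfolding poly_endo_def
  by (rule sum.mono_neutral_left) (use assms in \<open>auto simp: coeff_eq_0\<close>)

lemma P_pCons: "P (pCons c q) x = scale c x + u (P q x)"
proof -
  have "P (pCons c q) x = (\<Sum>i\<le>Suc (degree q). scale (coeff (pCons c q) i) ((u ^^ i) x))"
    by (rule P_eq_sum_atMost) (rule degree_pCons_le)
  also have "\<dots> = scale c x + (\<Sum>i\<le>degree q. scale (coeff q i) ((u ^^ Suc i) x))"
    by (subst sum.atMost_Suc_shift) simp
  also have "\<dots> = scale c x + u (P q x)"
    by (simp add: poly_endo_def u_linear)
  finally show ?thesis .
qed

lemma P_add: "P (q + r) x = P q x + P r x"
proof -
  define n where "n = max (degree q) (degree r)"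
  have "degree (q + r) \<le> n" unfolding n_def by (rule degree_add_le_max)
  then show ?thesis
    by (simp add: P_eq_sum_atMost[of _ n] n_def scale_left_distrib sum.distrib)
qed

lemma P_smult: "P (Polynomial.smult c q) x = scale c (P q x)"
  by (simp add: P_eq_sum_atMost[of _ "degree q"] degree_smult_le scale_sum_right)

lemma P_0 [simp]: "P 0 x = 0" by (simp add: poly_endo_def)

lemma P_1 [simp]: "P 1 x = x" by (simp add: poly_endo_def)

lemma P_uminus: "P (- q) x = - P q x" using P_smult[of "-1" q x] by simp

lemma P_diff: "P (q - r) x = P q x - P r x" using P_add[of q "- r" x] by (simp add: P_uminus)

lemma P_right: "P q (x + y) = P q x + P q y" "P q (scale c x) = scale c (P q x)" "P q 0 = 0"
  "P q (- x) = - P q x" "P q (x - y) = P q x - P q y" "P q (sum f S) = (\<Sum>i\<in>S. P q (f i))"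
proof -
  show add: "P q (x + y) = P q x + P q y" for x y
    by (induction q) (simp_all add: P_pCons u_linear scale_right_distrib algebra_simps)
  show sc: "P q (scale c x) = scale c (P q x)" for c x
    by (induction q) (simp_all add: P_pCons u_linear scale_right_distrib mult.commute)
  show zero: "P q 0 = 0" using sc[of 0 0] by simp
  show minus: "P q (- x) = - P q x" for x using sc[of "-1" x] by simp
  show "P q (x - y) = P q x - P q y" using add[of x "- y"] minus by simp
  show "P q (sum f S) = (\<Sum>i\<in>S. P q (f i))"
    by (induction S rule: infinite_finite_induct) (simp_all add: zero add)
qed

lemma u_P: "u (P q x) = P q (u x)"
  by (induction q) (simp_all add: P_pCons u_linear)

lemma P_mult: "P (q * r) x = P q (P r x)"
  by (induction q) (simp_all add: P_pCons P_add P_smult u_linear)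

lemma P_commute: "P q (P r x) = P r (P q x)"
  by (metis P_mult mult.commute)

lemma P_X [simp]: "P [:0, 1:] x = u x" by (simp add: P_pCons u_linear)

lemma P_selfadjoint: "b (P q x) y = b x (P q y)"
  by (induction q arbitrary: y) (simp_all add: P_pCons b_left b_right u_selfadjoint flip: u_P)

lemma P_funpow: "(P p ^^ k) x = P (p ^ k) x"
  by (induction k) (simp_all add: P_mult)

lemma poly_linear_cyclic: "poly_linear (\<lambda>r. b x (P r y))"
  by (simp add: poly_linear_def P_add P_smult b_right)

lemma exists_annihilator: "\<exists>m. m \<noteq> 0 \<and> (\<forall>x. P m x = 0)"
proof -
  have single: "\<exists>m. m \<noteq> 0 \<and> P m x = 0" for x
  proof (cases "inj_on (\<lambda>i. (u ^^ i) x) {..dimension}")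
    case False
    then obtain i j where ij: "i \<noteq> j" "(u ^^ i) x = (u ^^ j) x" unfolding inj_on_def by blast
    have mon: "P (monom 1 n) x = (u ^^ n) x" for n
      by (simp add: poly_endo_def degree_monom_eq if_distrib[of "\<lambda>c. scale c _"] cong: if_cong)
    have "monom 1 i - monom 1 j \<noteq> (0::'a poly)" using ij(1) by (simp add: monom_eq_iff')
    moreover have "P (monom 1 i - monom 1 j) x = 0" by (simp add: P_diff mon ij(2))
    ultimately show ?thesis by blast
  next
    case True
    define S where "S = (\<lambda>i. (u ^^ i) x) ` {..dimension}"
    have "card S = Suc dimension" unfolding S_def using True by (simp add: card_image)
    then have "dependent S" using independent_card_le_dim[of S UNIV] by (auto simp: dimension_def)
    then obtain f v where f: "(\<Sum>w\<in>S. scale (f w) w) = 0" "v \<in> S" "f v \<noteq> 0"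
      using dependent_finite[of S] unfolding S_def by auto
    then obtain i where i: "i \<le> dimension" "v = (u ^^ i) x" unfolding S_def by auto
    define m where "m = (\<Sum>j\<le>dimension. monom (f ((u ^^ j) x)) j)"
    have cm: "coeff m j = (if j \<le> dimension then f ((u ^^ j) x) else 0)" for j
      unfolding m_def by (simp add: coeff_sum if_distrib)
    have "degree m \<le> dimension" by (rule degree_le) (simp add: cm)
    then have "P m x = (\<Sum>j\<le>dimension. scale (f ((u ^^ j) x)) ((u ^^ j) x))"
      by (subst P_eq_sum_atMost) (auto simp: cm)
    also have "\<dots> = 0" using f(1) unfolding S_def by (simp add: sum.reindex[OF True])
    finally have "P m x = 0" .
    moreover have "coeff m i \<noteq> 0" using f(3) i by (simp add: cm)
    ultimately show ?thesis by (intro exI[of _ m]) auto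
  qed
  then obtain M where M: "\<And>x. M x \<noteq> 0" "\<And>x. P (M x) x = 0" by metis
  define m where "m = prod M Basis"
  have "m \<noteq> 0" unfolding m_def using M(1) finite_Basis by simp
  have mB: "P m x = 0" if "x \<in> Basis" for x
  proof -
    have "m = prod M (Basis - {x}) * M x" unfolding m_def
      using finite_Basis that by (simp add: prod.remove mult.commute)
    then show ?thesis by (simp add: P_mult M(2) P_right)
  qed
  have "P m x = 0" for x
  proof -
    have "x \<in> span Basis" using span_Basis by simp
    then show ?thesis
      by (induction rule: span_induct_alt) (auto simp: P_right mB)
  qed
  with \<open>m \<noteq> 0\<close> show ?thesis by blast
qed

text \<open>The inclusion of \<open>(Ker f)\<^sup>\<bottom>\<close> in \<open>Im f\<close> for \<open>f = q(u)\<close>: the kernel is cut out by the forms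
  \<open>z \<mapsto> b e (f z)\<close> for \<open>e\<close> in a basis.\<close>
lemma orthogonal_to_kernel:
  assumes "\<And>z. P q z = 0 \<Longrightarrow> b y z = 0"
  shows "y \<in> range (P q)"
proof -
  have "\<exists>c. \<forall>z\<in>UNIV. b y z = (\<Sum>e\<in>Basis. c e * b e (P q z))"
  proof (rule form_in_span_of_forms[where sc = scale])
    fix z assume z: "\<forall>e\<in>Basis. b e (P q z) = 0"
    have "b x (P q z) = 0" for x
    proof -
      have "x \<in> span Basis" using span_Basis by simp
      then show ?thesis by (induction rule: span_induct_alt) (auto simp: b_left z)
    qed
    then have "P q z = 0" by (intro b_nondegenerate) (simp add: b_commute)
    then show "b y z = 0" by (rule assms)
  qed (auto simp: b_right P_right finite_Basis algebra_simps)
  then obtain c where c: "\<And>z. b y z = (\<Sum>e\<in>Basis. c e * b e (P q z))" by auto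
  have "y - P q (\<Sum>e\<in>Basis. scale (c e) e) = 0"
    by (rule b_nondegenerate) (simp add: b_left P_selfadjoint c)
  then show ?thesis by auto
qed

section \<open>Residual forms\<close>

lemma K_iff: "x \<in> K p k \<longleftrightarrow> P (p ^ k) x = 0"
  by (simp add: ker_pow_def P_funpow)

lemma K_0 [simp]: "0 \<in> K p k" by (simp add: K_iff P_right)
lemma K_add: "x \<in> K p k \<Longrightarrow> y \<in> K p k \<Longrightarrow> x + y \<in> K p k" by (simp add: K_iff P_right)
lemma K_diff: "x \<in> K p k \<Longrightarrow> y \<in> K p k \<Longrightarrow> x - y \<in> K p k" by (simp add: K_iff P_right)
lemma K_uminus: "x \<in> K p k \<Longrightarrow> - x \<in> K p k" by (simp add: K_iff P_right)
lemma K_P: "x \<in> K p k \<Longrightarrow> P r x \<in> K p k" by (simp add: K_iff P_commute[of _ r] P_right)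
lemma K_sum: "(\<And>i. i \<in> S \<Longrightarrow> f i \<in> K p k) \<Longrightarrow> sum f S \<in> K p k"
  by (induction S rule: infinite_finite_induct) (auto intro: K_add)

lemma K_mono:
  assumes "x \<in> K p k" "k \<le> l" shows "x \<in> K p l"
proof -
  have "p ^ l = p ^ (l - k) * p ^ k" using assms(2) by (simp flip: power_add)
  then show ?thesis using assms(1) by (simp add: K_iff P_mult P_right)
qed

lemma N_iff: "n \<in> N p k \<longleftrightarrow> (\<exists>x w. n = x + P p w \<and> x \<in> K p (k - 1) \<and> P p w \<in> K p k)"
  unfolding inv_denominator_def by blast

lemma N_subset_K: "n \<in> N p k \<Longrightarrow> n \<in> K p k"
  unfolding N_iff using K_mono[of _ p "k - 1" k] by (auto intro: K_add)

lemma N_of_lower_kernel: "x \<in> K p (k - 1) \<Longrightarrow> x \<in> N p k"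
  unfolding N_iff by (intro exI[of _ x] exI[of _ 0]) (simp add: P_right)

lemma N_of_image: "P p w \<in> K p k \<Longrightarrow> P p w \<in> N p k"
  unfolding N_iff by (intro exI[of _ 0] exI[of _ w]) simp

lemma N_0 [simp]: "0 \<in> N p k" by (rule N_of_lower_kernel) simp

lemma N_add: "m \<in> N p k \<Longrightarrow> n \<in> N p k \<Longrightarrow> m + n \<in> N p k"
proof -
  assume "m \<in> N p k" "n \<in> N p k"
  then obtain x w x' w' where "m = x + P p w" "x \<in> K p (k - 1)" "P p w \<in> K p k"
    "n = x' + P p w'" "x' \<in> K p (k - 1)" "P p w' \<in> K p k"
    unfolding N_iff by blast
  then show ?thesis unfolding N_iff
    by (intro exI[of _ "x + x'"] exI[of _ "w + w'"]) (simp add: P_right K_add algebra_simps)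
qed

lemma N_P: "n \<in> N p k \<Longrightarrow> P r n \<in> N p k"
proof -
  assume "n \<in> N p k"
  then obtain x w where "n = x + P p w" "x \<in> K p (k - 1)" "P p w \<in> K p k" unfolding N_iff by blast
  then show ?thesis unfolding N_iff
    by (intro exI[of _ "P r x"] exI[of _ "P r w"]) (auto simp: P_right K_P P_commute[of p r])
qed

lemma N_uminus: "n \<in> N p k \<Longrightarrow> - n \<in> N p k" using N_P[of n p k "-1"] by (simp add: P_uminus)
lemma N_diff: "m \<in> N p k \<Longrightarrow> n \<in> N p k \<Longrightarrow> m - n \<in> N p k" using N_add[of m p k "- n"] N_uminus by simp
lemma N_sum: "(\<And>i. i \<in> S \<Longrightarrow> f i \<in> N p k) \<Longrightarrow> sum f S \<in> N p k"
  by (induction S rule: infinite_finite_induct) (auto intro: N_add)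

lemma N_of_dvd: "p dvd r \<Longrightarrow> x \<in> K p k \<Longrightarrow> P r x \<in> N p k"
proof -
  assume "p dvd r" "x \<in> K p k"
  then obtain c where "r = p * c" by blast
  then have "P r x = P p (P c x)" by (simp add: P_mult)
  then show ?thesis using N_of_image K_P[OF \<open>x \<in> K p k\<close>, of r] by metis
qed

text \<open>\<open>N p k\<close> lies in the radical of the form \<open>(x, y) \<mapsto> b x (p(u)^(k-1) y)\<close> on \<open>Ker p(u)^k\<close>: the exponent
  \<open>k - 1\<close> kills its first summand, and on its second one the missing factor \<open>p\<close> moves to \<open>y\<close>.\<close>
lemma N_form_left:
  assumes k: "k \<ge> 1" and n: "n \<in> N p k" and y: "y \<in> K p k" and s: "p ^ (k - 1) dvd s"
  shows "b n (P s y) = 0"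
proof -
  obtain x w where xw: "n = x + P p w" "x \<in> K p (k - 1)" using n unfolding N_iff by blast
  obtain r where r: "s = p ^ (k - 1) * r" using s by blast
  have ps: "p * s = r * p ^ k" unfolding r using k by (simp add: power_eq_if)
  have "b x (P s y) = b (P (r * p ^ (k - 1)) x) y" unfolding r by (simp add: P_selfadjoint mult.commute)
  also have "\<dots> = 0" using xw(2) by (simp add: K_iff P_mult P_right b_left)
  finally have "b x (P s y) = 0" .
  moreover have "b (P p w) (P s y) = b w (P (p * s) y)" by (simp add: P_selfadjoint P_mult)
  then have "b (P p w) (P s y) = 0" using y unfolding ps by (simp add: K_iff P_mult P_right b_right)
  ultimately show ?thesis unfolding xw(1) by (simp add: b_left)
qed

lemma b_P_swap: "b x (P s y) = b y (P s x)"
  by (metis b_commute P_selfadjoint)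

lemma residual_form_cong:
  assumes k: "k \<ge> 1" and s: "p ^ (k - 1) dvd s"
    and "x \<in> K p k" "y \<in> K p k" "x' - x \<in> N p k" "y' - y \<in> N p k"
  shows "b x' (P s y') = b x (P s y)"
proof -
  have x': "x' \<in> K p k" using K_add[OF N_subset_K[OF assms(5)] assms(3)] by simp
  have "b (x' - x) (P s y) = 0" by (rule N_form_left) (use assms in auto)
  moreover have "b (y' - y) (P s x') = 0" by (rule N_form_left) (use assms x' in auto)
  ultimately show ?thesis by (simp add: b_left b_P_swap[of x'])
qed

text \<open>The radical is not larger than \<open>N p k\<close>: if \<open>p^(k-1) y\<close> is orthogonal to \<open>Ker p^k\<close>, it equals
  some \<open>p^k w\<close>, and then \<open>y - p w\<close> lies in \<open>Ker p^(k-1)\<close>.\<close>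
lemma residual_nondegenerate:
  assumes k: "k \<ge> 1" and y: "y \<in> K p k"
    and orth: "\<And>z. z \<in> K p k \<Longrightarrow> b y (P (p ^ (k - 1)) z) = 0"
  shows "y \<in> N p k"
proof -
  have pk: "p ^ k = p ^ (k - 1) * p" "p ^ k = p * p ^ (k - 1)"
    using k by (simp_all add: power_eq_if mult.commute)
  have "P (p ^ (k - 1)) y \<in> range (P (p ^ k))"
    by (rule orthogonal_to_kernel) (simp add: P_selfadjoint orth K_iff del: One_nat_def)
  then obtain w where w: "P (p ^ (k - 1)) y = P (p ^ k) w" by blast
  have "P (p ^ (k - 1)) (y - P p w) = P (p ^ (k - 1)) y - P (p ^ k) w"
    unfolding pk(1) by (simp only: P_right P_mult)
  then have "y - P p w \<in> K p (k - 1)" unfolding K_iff w by simp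
  moreover have "P (p ^ k) (P p w) = P p (P (p ^ (k - 1)) y)" unfolding w by (rule P_commute)
  then have "P p w \<in> K p k" using y by (simp add: K_iff pk(2) P_mult)
  ultimately show ?thesis unfolding N_iff by (intro exI[of _ "y - P p w"] exI[of _ w]) simp
qed

text \<open>Orthogonality of the submodules \<open>F[u] x\<close> and \<open>F[u] y\<close>; since \<open>u\<close> is selfadjoint, the polynomial
  acting on \<open>x\<close> can be moved to \<open>y\<close>.\<close>
definition cyc_orth :: "'v \<Rightarrow> 'v \<Rightarrow> bool" where
  "cyc_orth x y \<longleftrightarrow> (\<forall>r. b x (P r y) = 0)"

lemma cyc_orth_commute: "cyc_orth x y \<longleftrightarrow> cyc_orth y x"
  by (simp add: cyc_orth_def b_P_swap[of x])

lemma cyc_orth_P: "cyc_orth x y \<Longrightarrow> cyc_orth x (P r y)"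
  by (simp add: cyc_orth_def flip: P_mult)

lemma cyc_orth_diff: "cyc_orth x y \<Longrightarrow> cyc_orth x z \<Longrightarrow> cyc_orth x (y - z)"
  by (simp add: cyc_orth_def P_right b_right)

lemma coprime_cyc_orth:
  assumes p: "p \<in> Irr" and q: "q \<in> Irr" "p \<noteq> q" and x: "x \<in> K p k" and y: "y \<in> K q l"
  shows "cyc_orth x y"
proof -
  have "\<not> p dvd q ^ l"
    using prime_elem_dvd_power[OF field_poly_irreducible_imp_prime[OF IrrD(1)[OF p]]]
      Irr_dvd_imp_eq[OF p q(1)] q(2) by blast
  then obtain \<alpha> \<beta> where ab: "\<alpha> * q ^ l + \<beta> * p ^ k = 1"
    using bezout_prime_power[OF IrrD(1)[OF p], of "q ^ l" k thesis] by blast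
  have "b x (P r y) = 0" for r
  proof -
    have "b x (P r y) = b x (P (r * (\<alpha> * q ^ l + \<beta> * p ^ k)) y)" using ab by simp
    also have "\<dots> = b x (P (r * \<alpha> * q ^ l) y) + b x (P (p ^ k * (r * \<beta>)) y)"
      by (simp add: distrib_left P_add b_right mult_ac)
    also have "b x (P (p ^ k * (r * \<beta>)) y) = b (P (p ^ k) x) (P (r * \<beta>) y)"
      by (simp add: P_mult P_selfadjoint)
    also have "\<dots> = 0" using x by (simp add: K_iff b_left)
    also have "P (r * \<alpha> * q ^ l) y = 0" using y by (simp add: K_iff P_mult P_right)
    finally show ?thesis by (simp add: b_right)
  qed
  then show ?thesis by (simp add: cyc_orth_def)
qed

text \<open>The last condition makes \<open>F[u] x\<close> isomorphic to \<open>F[t]/(p^k)\<close> and \<open>b\<close> nondegenerate on it, since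
  the form \<open>r \<mapsto> b x (r(u) x)\<close> does not vanish on the socle.\<close>
definition regular_gen :: "'a poly \<Rightarrow> nat \<Rightarrow> 'v \<Rightarrow> bool" where
  "regular_gen p k x \<longleftrightarrow> p \<in> Irr \<and> k \<ge> 1 \<and> x \<in> K p k \<and> (\<exists>r. b x (P (p ^ (k - 1) * r) x) \<noteq> 0)"

lemma cyclic_form_vanishes: "x \<in> K p k \<Longrightarrow> b x (P (p ^ k * r) x) = 0" "x \<in> K p k \<Longrightarrow> b y (P (p ^ k * r) x) = 0"
  by (simp_all add: mult.commute[of "p ^ k"] K_iff P_mult P_right b_right)

lemma cyclic_faithful:
  assumes "regular_gen p k x" and "cyc_orth (P h x) x"
  shows "p ^ k dvd h"
proof -
  obtain r0 where r0: "b x (P (p ^ (k - 1) * r0) x) \<noteq> 0" and x: "x \<in> K p k" and k: "k \<ge> 1" and p: "p \<in> Irr"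
    using assms(1) unfolding regular_gen_def by blast
  show ?thesis
  proof (rule socle_form_faithful[where \<phi> = "\<lambda>r. b x (P r x)" and p = p and k = k and ?r0.0 = r0])
    show "b x (P (h * q) x) = 0" for q
      using assms(2) by (simp add: cyc_orth_def P_selfadjoint P_mult)
  qed (use IrrD(1)[OF p] k x r0 in \<open>simp_all add: P_add b_right cyclic_form_vanishes\<close>)
qed

text \<open>The form \<open>r \<mapsto> b y (r(u) x)\<close> is a multiple of \<open>r \<mapsto> b x (r(u) x)\<close>, and the factor \<open>h\<close> gives the
  orthogonal projection \<open>h(u) x\<close> of \<open>y\<close>.\<close>
lemma cyclic_projection:
  assumes "regular_gen p k x"
  shows "\<exists>h. cyc_orth (y - P h x) x"
proof -
  obtain r0 where r0: "b x (P (p ^ (k - 1) * r0) x) \<noteq> 0" and x: "x \<in> K p k" and k: "k \<ge> 1" and p: "p \<in> Irr"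
    using assms(1) unfolding regular_gen_def by blast
  have "\<exists>h. \<forall>r. b y (P r x) = b x (P (h * r) x)"
    by (rule form_is_multiple[OF IrrD(1)[OF p] k poly_linear_cyclic _ r0 poly_linear_cyclic])
      (simp_all add: cyclic_form_vanishes[OF x])
  then obtain h where "\<And>r. b y (P r x) = b x (P (h * r) x)" by blast
  then show ?thesis
    by (intro exI[of _ h]) (simp add: cyc_orth_def b_left P_selfadjoint P_mult)
qed

text \<open>Orthogonal projection onto a regular cyclic submodule does not change residue classes, provided
  that residual orthogonality holds where both classes live in the same space.\<close>
lemma cyclic_projection_in_N:
  assumes x: "regular_gen p k x" and y: "y \<in> K p l" and l: "l \<ge> 1"
    and orth: "cyc_orth (y - P h x) x"
    and res: "l = k \<Longrightarrow> (\<And>s. p ^ (k - 1) dvd s \<Longrightarrow> b y (P s x) = 0)"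
  shows "P h x \<in> N p l"
proof -
  have p: "p \<in> Irr" and k: "k \<ge> 1" and xK: "x \<in> K p k" using x unfolding regular_gen_def by auto
  have "p \<noteq> 0" using IrrD(3)[OF p] .
  have eq: "b (P h x) (P r x) = b y (P r x)" for r using orth by (simp add: cyc_orth_def b_left)
  have PhK: "P h x \<in> K p k" using xK by (rule K_P)
  consider "k < l" | "l = k" | "l < k" by linarith
  then show ?thesis
  proof cases
    case 1
    then show ?thesis using K_mono[OF PhK, of "l - 1"] by (intro N_of_lower_kernel) simp
  next
    case 2
    have "b (P (p ^ (k - 1) * h) x) (P r x) = 0" for r
    proof -
      have "b (P (p ^ (k - 1) * h) x) (P r x) = b (P h x) (P (p ^ (k - 1) * r) x)"
        by (simp add: P_mult P_selfadjoint)
      also have "\<dots> = 0" unfolding eq by (rule res) (use 2 in auto)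
      finally show ?thesis .
    qed
    then have "p ^ k dvd p ^ (k - 1) * h" using cyclic_faithful[OF x] by (simp add: cyc_orth_def)
    moreover have "p ^ k = p ^ (k - 1) * p" using k by (simp add: power_eq_if mult.commute)
    ultimately have "p dvd h" using \<open>p \<noteq> 0\<close> by simp
    then show ?thesis using N_of_dvd[of p h x k] xK 2 by simp
  next
    case 3
    have "b (P (p ^ l * h) x) (P r x) = 0" for r
    proof -
      have "b (P (p ^ l * h) x) (P r x) = b (P h x) (P (p ^ l * r) x)"
        by (simp add: P_mult P_selfadjoint)
      also have "\<dots> = b (P (p ^ l) y) (P r x)" unfolding eq by (simp add: P_mult P_selfadjoint)
      also have "\<dots> = 0" using y by (simp add: K_iff b_left)
      finally show ?thesis .
    qed
    then have *: "p ^ k dvd p ^ l * h" using cyclic_faithful[OF x] by (simp add: cyc_orth_def)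
    have "p ^ Suc l dvd p ^ l * h" using dvd_trans[OF le_imp_power_dvd *] 3 by (metis Suc_leI)
    then have "p dvd h" using \<open>p \<noteq> 0\<close> by simp
    then obtain h' where h': "h = p * h'" by blast
    obtain c where c: "p ^ l * h = p ^ k * c" using * by blast
    have "P h x \<in> K p l" unfolding K_iff
      using xK by (simp add: c K_iff mult.commute[of _ c] P_mult P_right flip: P_mult[of "p ^ l"])
    then show ?thesis using N_of_image[of p "P h' x" l] by (simp add: h' P_mult)
  qed
qed

section \<open>Families of cyclic generators\<close>

text \<open>For \<open>x\<close> and \<open>y\<close> in \<open>Ker p(u)^k\<close> this is the vanishing of \<open>(b,u)_{p,k}\<close> on their classes.\<close>
definition res_orth :: "'a poly \<Rightarrow> nat \<Rightarrow> 'v \<Rightarrow> 'v \<Rightarrow> bool" where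
  "res_orth p k x y \<longleftrightarrow> (\<forall>s. p ^ (k - 1) dvd s \<longrightarrow> b x (P s y) = 0)"

definition residual_family :: "'i set \<Rightarrow> ('i \<Rightarrow> 'a poly) \<Rightarrow> ('i \<Rightarrow> nat) \<Rightarrow> ('i \<Rightarrow> 'v) \<Rightarrow> bool" where
  "residual_family I p k G \<longleftrightarrow> finite I \<and> (\<forall>i\<in>I. regular_gen (p i) (k i) (G i)) \<and>
     (\<forall>i\<in>I. \<forall>j\<in>I. i \<noteq> j \<and> p i = p j \<and> k i = k j \<longrightarrow> res_orth (p i) (k i) (G i) (G j))"

lemma regular_gen_cong:
  assumes "regular_gen p k x" "x' - x \<in> N p k"
  shows "regular_gen p k x'"
proof -
  have "x' \<in> K p k" using K_add[OF N_subset_K[OF assms(2)], of x] assms(1) by (simp add: regular_gen_def)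
  then show ?thesis using assms unfolding regular_gen_def
    by (metis residual_form_cong dvd_triv_left)
qed

lemma residual_family_cong:
  assumes "residual_family I p k G" and "\<And>i. i \<in> I \<Longrightarrow> Y i - G i \<in> N (p i) (k i)"
  shows "residual_family I p k Y"
  unfolding residual_family_def
proof (intro conjI ballI impI allI)
  show "finite I" using assms(1) by (simp add: residual_family_def)
  show "regular_gen (p i) (k i) (Y i)" if "i \<in> I" for i
    using assms that by (auto simp: residual_family_def intro: regular_gen_cong)
  fix i j assume ij: "i \<in> I" "j \<in> I" "i \<noteq> j \<and> p i = p j \<and> k i = k j"
  show "res_orth (p i) (k i) (Y i) (Y j)"
    unfolding res_orth_def
  proof (intro allI impI)
    fix s assume s: "p i ^ (k i - 1) dvd s"
    have "b (Y i) (P s (Y j)) = b (G i) (P s (G j))"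
    proof (rule residual_form_cong[of "k i" "p i"])
      show "Y j - G j \<in> N (p i) (k i)" using assms(2)[of j] ij by simp
    qed (use assms(1) assms(2)[OF ij(1)] ij s in \<open>auto simp: residual_family_def regular_gen_def\<close>)
    then show "b (Y i) (P s (Y j)) = 0" using assms(1) ij s by (auto simp: residual_family_def res_orth_def)
  qed
qed

text \<open>A Gram-Schmidt process for cyclic submodules. A member that is already orthogonal to the current
  one is left unchanged, so orthogonality to the members treated before persists.\<close>
lemma orthogonalise_family:
  assumes G: "residual_family I p k G"
  shows "\<exists>Y. (\<forall>i\<in>I. Y i - G i \<in> N (p i) (k i)) \<and> (\<forall>i\<in>I. \<forall>j\<in>I. i \<noteq> j \<longrightarrow> cyc_orth (Y i) (Y j))"
proof -
  have "finite I" using G by (simp add: residual_family_def)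
  have "\<exists>Y. (\<forall>i\<in>I. Y i - G i \<in> N (p i) (k i)) \<and> (\<forall>i\<in>J. \<forall>j\<in>I. i \<noteq> j \<longrightarrow> cyc_orth (Y i) (Y j))"
    if "J \<subseteq> I" for J
    using finite_subset[OF that \<open>finite I\<close>] that
  proof (induction J rule: finite_induct)
    case empty
    show ?case by (intro exI[of _ G]) simp
  next
    case (insert i J)
    from insert.prems have i: "i \<in> I" and J: "J \<subseteq> I" by auto
    from insert.IH[OF J] obtain Y where YX: "\<And>j. j \<in> I \<Longrightarrow> Y j - G j \<in> N (p j) (k j)"
      and YJ: "\<And>a j. a \<in> J \<Longrightarrow> j \<in> I \<Longrightarrow> a \<noteq> j \<Longrightarrow> cyc_orth (Y a) (Y j)" by blast
    have Y: "residual_family I p k Y" using residual_family_cong[OF G] YX by blast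
    have gen: "regular_gen (p j) (k j) (Y j)" if "j \<in> I" for j
      using Y that by (simp add: residual_family_def)
    have "\<exists>h. cyc_orth (Y j - P h (Y i)) (Y i) \<and> P h (Y i) \<in> N (p j) (k j)
        \<and> (cyc_orth (Y j) (Y i) \<longrightarrow> P h (Y i) = 0)" if j: "j \<in> I" "j \<noteq> i" for j
    proof (cases "cyc_orth (Y j) (Y i)")
      case True
      then show ?thesis by (intro exI[of _ 0]) simp
    next
      case False
      have pj: "p j = p i"
        using coprime_cyc_orth[of "p j" "p i" "Y j" "k j" "Y i" "k i"] False gen[OF j(1)] gen[OF i]
        by (auto simp: regular_gen_def)
      obtain h where h: "cyc_orth (Y j - P h (Y i)) (Y i)" using cyclic_projection[OF gen[OF i]] by blast
      have "P h (Y i) \<in> N (p i) (k j)"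
      proof (rule cyclic_projection_in_N[OF gen[OF i] _ _ h])
        show "Y j \<in> K (p i) (k j)" "1 \<le> k j" using gen[OF j(1)] pj by (auto simp: regular_gen_def)
        show "b (Y j) (P s (Y i)) = 0" if "k j = k i" "p i ^ (k i - 1) dvd s" for s
          using Y that i j pj by (auto simp: residual_family_def res_orth_def)
      qed
      then show ?thesis using h pj False by auto
    qed
    then obtain h where h: "\<And>j. j \<in> I \<Longrightarrow> j \<noteq> i \<Longrightarrow> cyc_orth (Y j - P (h j) (Y i)) (Y i)"
      and hN: "\<And>j. j \<in> I \<Longrightarrow> j \<noteq> i \<Longrightarrow> P (h j) (Y i) \<in> N (p j) (k j)"
      and h0: "\<And>j. j \<in> I \<Longrightarrow> j \<noteq> i \<Longrightarrow> cyc_orth (Y j) (Y i) \<Longrightarrow> P (h j) (Y i) = 0" by metis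
    define Z where "Z j = (if j = i then Y i else Y j - P (h j) (Y i))" for j
    have "Z j - G j \<in> N (p j) (k j)" if "j \<in> I" for j
    proof (cases "j = i")
      case False
      have eq: "(Y j - G j) - P (h j) (Y i) = Z j - G j" using False by (simp add: Z_def)
      show ?thesis using N_diff[OF YX[OF that] hN[OF that False]] unfolding eq .
    qed (use YX that in \<open>simp add: Z_def\<close>)
    moreover have "cyc_orth (Z a) (Z j)" if a: "a \<in> insert i J" and j: "j \<in> I" "a \<noteq> j" for a j
    proof (cases "a = i")
      case True
      then show ?thesis using h[OF j(1)] j by (simp add: Z_def cyc_orth_commute)
    next
      case False
      then have a: "a \<in> J" "a \<in> I" using a J by auto
      have ai: "cyc_orth (Y a) (Y i)" using YJ[OF a(1) i] False by simp
      have "Z a = Y a" using h0[OF a(2) False ai] False by (simp add: Z_def)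
      then show ?thesis using ai YJ[OF a(1) j(1)] j(2)
        by (auto simp: Z_def intro!: cyc_orth_diff cyc_orth_P)
    qed
    ultimately show ?case by blast
  qed
  then show ?thesis by blast
qed

text \<open>Replacing \<open>x\<close> by \<open>q(u) x\<close> multiplies the form \<open>r \<mapsto> b x (r(u) x)\<close> by \<open>q^2\<close>. Each form with the same
  restriction to the socle is a multiple by a factor \<open>h\<close> with \<open>h - 1\<close> divisible by \<open>p\<close>, and such a
  factor is a square modulo \<open>p^k\<close>.\<close>
lemma normalise_generator:
  assumes two: "(2::'a) \<noteq> 0" and x: "regular_gen p k x"
    and \<psi>: "poly_linear \<psi>" "\<And>r. \<psi> (p ^ k * r) = 0"
    and agree: "\<And>r. \<psi> (p ^ (k - 1) * r) = b x (P (p ^ (k - 1) * r) x)"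
  shows "\<exists>q. p dvd q - 1 \<and> (\<forall>r. b (P q x) (P r (P q x)) = \<psi> r)"
proof -
  obtain r0 where r0: "b x (P (p ^ (k - 1) * r0) x) \<noteq> 0" and xK: "x \<in> K p k" and k: "k \<ge> 1" and p: "p \<in> Irr"
    using x unfolding regular_gen_def by blast
  have "\<exists>h. p dvd h - 1 \<and> (\<forall>r. \<psi> r = b x (P (h * r) x))"
    by (rule form_is_multiple_principal_unit[OF IrrD(1)[OF p] k poly_linear_cyclic _ r0 \<psi>(1)])
      (simp_all add: cyclic_form_vanishes[OF xK] \<psi>(2) agree del: One_nat_def)
  then obtain h where h: "p dvd h - 1" "\<And>r. \<psi> r = b x (P (h * r) x)" by blast
  obtain q where q: "p dvd q - 1" "p ^ k dvd q * q - h" using sqrt_principal_unit[OF two h(1)] by blast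
  obtain c where c: "q * q = p ^ k * c + h" using q(2) by (metis dvdE diff_add_cancel)
  have "b (P q x) (P r (P q x)) = \<psi> r" for r
  proof -
    have "b (P q x) (P r (P q x)) = b x (P (q * q * r) x)"
      by (simp add: P_selfadjoint P_mult P_commute[of r])
    also have "\<dots> = b x (P (p ^ k * (c * r)) x) + b x (P (h * r) x)"
      unfolding c by (simp add: distrib_right P_add b_right mult.assoc)
    finally show ?thesis by (simp add: cyclic_form_vanishes[OF xK] h(2))
  qed
  with q(1) show ?thesis by blast
qed

section \<open>Spanning by an orthogonal family\<close>

lemma torsion_bounded:
  assumes p: "p \<in> Irr" and m: "m = p ^ a * m'" "\<not> p dvd m'" and x: "P m x = 0" "x \<in> K p n"
  shows "x \<in> K p a"
proof -
  obtain \<alpha> \<beta> where ab: "\<alpha> * m' + \<beta> * p ^ n = 1" using bezout_prime_power[OF IrrD(1)[OF p] m(2)] .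
  have "P (p ^ a) x = P (p ^ a * (\<alpha> * m' + \<beta> * p ^ n)) x" using ab by simp
  also have "\<dots> = P (\<alpha> * m + p ^ a * \<beta> * p ^ n) x" unfolding m(1) by (simp add: algebra_simps)
  also have "\<dots> = 0" using x by (simp add: P_add P_mult K_iff P_right)
  finally show ?thesis by (simp add: K_iff)
qed

text \<open>If some \<open>y \<noteq> 0\<close> is orthogonal to the family, then some primary part of the orthogonal \<open>U\<close> of the
  family is nonzero. A vector of maximal exponent \<open>l\<close> in it pairs nontrivially, through
  \<open>q^(l-1)\<close>, with another one, although the latter is spanned by the family modulo \<open>N q l\<close>, hence
  modulo the radical of this pairing.\<close>
lemma orthogonal_family_spans:
  assumes "finite I" and gen: "\<And>i. i \<in> I \<Longrightarrow> regular_gen (p i) (k i) (Y i)"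
    and orth: "\<And>i j. i \<in> I \<Longrightarrow> j \<in> I \<Longrightarrow> i \<noteq> j \<Longrightarrow> cyc_orth (Y i) (Y j)"
    and span: "\<And>q l z. q \<in> Irr \<Longrightarrow> l \<ge> 1 \<Longrightarrow> z \<in> K q l \<Longrightarrow> \<exists>r. z - (\<Sum>i\<in>I. P (r i) (Y i)) \<in> N q l"
  shows "\<exists>r. v = (\<Sum>i\<in>I. P (r i) (Y i))"
proof -
  define U where "U = {y. \<forall>i\<in>I. cyc_orth y (Y i)}"
  have U_P: "P r y \<in> U" if "y \<in> U" for r y
    using that by (auto simp: U_def cyc_orth_commute[of _ "Y _"] intro: cyc_orth_P)
  have proj: "\<exists>r. w - (\<Sum>i\<in>I. P (r i) (Y i)) \<in> U" for w
  proof -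
    have "\<forall>i\<in>I. \<exists>h. cyc_orth (w - P h (Y i)) (Y i)" using cyclic_projection[OF gen] by blast
    then obtain h where h: "\<And>i. i \<in> I \<Longrightarrow> cyc_orth (w - P (h i) (Y i)) (Y i)" by metis
    have "cyc_orth (w - (\<Sum>i\<in>I. P (h i) (Y i))) (Y j)" if j: "j \<in> I" for j
    proof -
      have "b (\<Sum>i\<in>I - {j}. P (h i) (Y i)) (P r (Y j)) = 0" for r
        unfolding b_left
      proof (rule sum.neutral, rule ballI)
        fix i assume "i \<in> I - {j}"
        then have "cyc_orth (Y i) (P (h i) (Y j))" using orth j by (intro cyc_orth_P) auto
        then show "b (P (h i) (Y i)) (P r (Y j)) = 0"
          by (simp add: cyc_orth_def P_selfadjoint P_commute[of "h i"])
      qed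
      moreover have "(\<Sum>i\<in>I. P (h i) (Y i)) = P (h j) (Y j) + (\<Sum>i\<in>I - {j}. P (h i) (Y i))"
        using \<open>finite I\<close> j by (rule sum.remove)
      ultimately show ?thesis using h[OF j] by (simp add: cyc_orth_def b_left)
    qed
    then show ?thesis unfolding U_def by blast
  qed
  have U_0: "y = 0" if y: "y \<in> U" for y
  proof (rule ccontr)
    assume "y \<noteq> 0"
    obtain m where m: "m \<noteq> 0" "\<And>x. P m x = 0" using exists_annihilator by blast
    have "\<exists>q y. y \<in> U \<and> y \<noteq> 0 \<and> q \<in> Irr \<and> P q y = 0"
    proof -
      let ?S = "\<lambda>q. q \<noteq> 0 \<and> P q y = 0"
      define q where "q = arg_min degree ?S"
      have q: "?S q" unfolding q_def by (rule arg_min_natI[of ?S m]) (use m in simp)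
      have q_min: "degree q \<le> degree q'" if "?S q'" for q'
        unfolding q_def using that by (rule arg_min_nat_le)
      have "\<not> is_unit q"
      proof
        assume "is_unit q"
        then obtain c where "1 = c * q" by (metis dvdE mult.commute)
        then have "y = P c (P q y)" by (metis P_1 P_mult)
        then show False using q \<open>y \<noteq> 0\<close> by (simp add: P_right)
      qed
      then obtain p where p: "p \<in> Irr" "p dvd q" using exists_Irr_factor q by blast
      then obtain c where c: "q = p * c" by blast
      have "c \<noteq> 0" using q c by auto
      have "degree c < degree q" using q c Irr_degree_pos[OF p(1)] by (auto simp: degree_mult_eq)
      then have "P c y \<noteq> 0" using q_min[of c] \<open>c \<noteq> 0\<close> by fastforce
      moreover have "P p (P c y) = 0" using q c by (simp add: P_mult)
      ultimately show ?thesis using U_P[OF y] p(1) by blast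
    qed
    then obtain q y0 where q: "q \<in> Irr" and y0: "y0 \<in> U" "y0 \<noteq> 0" "P q y0 = 0" by blast
    have "\<exists>a m'. m = q ^ a * m' \<and> \<not> q dvd m'"
      by (rule exact_power_factor[OF IrrD(3)[OF q] irreducible_not_unit[OF IrrD(1)[OF q]] m(1)])
    then obtain a m' where a: "m = q ^ a * m'" "\<not> q dvd m'" by blast
    have bound: "x \<in> K q a" if "x \<in> K q n" for x n
      using torsion_bounded[OF q a m(2) that] .
    let ?T = "\<lambda>l. \<exists>y\<in>U. y \<in> K q l \<and> y \<notin> K q (l - 1)"
    have T1: "?T 1" using y0 by (intro bexI[of _ y0]) (simp_all add: K_iff)
    have T_bound: "l \<le> a" if "?T l" for l
    proof (rule ccontr)
      assume "\<not> l \<le> a"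
      then have "a \<le> l - 1" by simp
      then show False using that bound K_mono by blast
    qed
    define l where "l = (GREATEST l. ?T l)"
    have Tl: "?T l" unfolding l_def by (rule GreatestI_nat[of ?T, OF T1]) (use T_bound in blast)
    have l_max: "n \<le> l" if "?T n" for n
      unfolding l_def by (rule Greatest_le_nat[of ?T, OF that]) (use T_bound in blast)
    have l1: "l \<ge> 1" using l_max[OF T1] .
    have exponent: "x \<in> K q l" if "x \<in> U" "x \<in> K q n" for x n
    proof -
      have "x \<in> K q (l + d) \<Longrightarrow> x \<in> K q l" for d
      proof (induction d)
        case (Suc d)
        have "x \<in> K q (l + d)"
        proof (rule ccontr)
          assume "x \<notin> K q (l + d)"
          then have "?T (Suc (l + d))" using Suc.prems that(1) by auto
          then show False using l_max by fastforce
        qed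
        then show ?case by (rule Suc.IH)
      qed simp
      moreover have "x \<in> K q (l + n)" using that(2) by (rule K_mono) simp
      ultimately show ?thesis by blast
    qed
    \<comment> \<open>The partner of \<open>y1\<close> is cut down to \<open>U\<close> and then to its \<open>q\<close>-primary part \<open>w\<close>.\<close>
    obtain y1 where y1: "y1 \<in> U" "y1 \<in> K q l" "P (q ^ (l - 1)) y1 \<noteq> 0"
      using Tl by (auto simp: K_iff)
    then obtain z where z: "b (P (q ^ (l - 1)) y1) z \<noteq> 0" using b_nondegenerate by blast
    obtain r where r: "z - (\<Sum>i\<in>I. P (r i) (Y i)) \<in> U" using proj by blast
    define z' where "z' = z - (\<Sum>i\<in>I. P (r i) (Y i))"
    have y1_orth: "b (P s y1) (\<Sum>i\<in>I. P (r i) (Y i)) = 0" for s r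
      unfolding b_right
    proof (rule sum.neutral, rule ballI)
      fix i assume "i \<in> I"
      then show "b (P s y1) (P (r i) (Y i)) = 0"
        using U_P[OF y1(1), of s] by (auto simp: U_def cyc_orth_def)
    qed
    have z': "b (P (q ^ (l - 1)) y1) z' \<noteq> 0" "z' \<in> U"
      using z r y1_orth by (simp_all add: z'_def b_right)
    obtain \<alpha> \<beta> where ab: "\<alpha> * m' + \<beta> * q ^ (a + 1) = 1"
      using bezout_prime_power[OF IrrD(1)[OF q] a(2)] .
    define w where "w = P (\<alpha> * m') z'"
    have w: "w \<in> U" unfolding w_def using z'(2) by (rule U_P)
    have "q ^ a * (\<alpha> * m') = \<alpha> * m" unfolding a(1) by simp
    then have "w \<in> K q a" unfolding w_def K_iff
      using m(2) by (metis P_mult P_right(3))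
    then have wK: "w \<in> K q l" using exponent w by blast
    have "l \<le> a" using T_bound[OF Tl] .
    have "z' = P (\<alpha> * m' + \<beta> * q ^ (a + 1)) z'" using ab by simp
    also have "\<dots> = w + P (\<beta> * q ^ (a + 1)) z'" by (simp add: P_add w_def)
    finally have zw: "z' = w + P (q ^ (a + 1)) (P \<beta> z')" by (simp only: P_mult P_commute)
    have "b (P (q ^ (l - 1)) y1) (P (q ^ (a + 1)) (P \<beta> z')) = b (P (q ^ (l - 1)) (P (q ^ (a + 1)) y1)) (P \<beta> z')"
      by (simp only: P_selfadjoint P_commute)
    moreover have "y1 \<in> K q (a + 1)" using K_mono[OF y1(2)] \<open>l \<le> a\<close> by simp
    ultimately have "b (P (q ^ (l - 1)) y1) (P (q ^ (a + 1)) (P \<beta> z')) = 0"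
      by (simp only: K_iff P_right b_left)
    then have nz: "b (P (q ^ (l - 1)) y1) w \<noteq> 0" using z'(1) zw by (metis add.right_neutral b_right(1))
    obtain r' where r': "w - (\<Sum>i\<in>I. P (r' i) (Y i)) \<in> N q l"
      using span[OF q l1 wK] by blast
    have "b (w - (\<Sum>i\<in>I. P (r' i) (Y i))) (P (q ^ (l - 1)) y1) = 0"
      by (rule N_form_left[OF l1 r' y1(2)]) simp
    then have "b (P (q ^ (l - 1)) y1) (w - (\<Sum>i\<in>I. P (r' i) (Y i))) = 0" by (simp only: b_commute)
    then have "b (P (q ^ (l - 1)) y1) w = 0" by (simp only: b_right(5) y1_orth diff_zero)
    then show False using nz by contradiction
  qed
  show ?thesis using proj[of v] U_0 by fastforce
qed

section \<open>Splitting by a pair of totally isotropic subspaces\<close>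

definition square_zero_sum :: bool where
  "square_zero_sum \<longleftrightarrow> (\<exists>a1 a2. selfadjoint_endo scale b a1 \<and> selfadjoint_endo scale b a2 \<and>
     (\<forall>x. a1 (a1 x) = 0) \<and> (\<forall>x. a2 (a2 x) = 0) \<and> (\<forall>x. u x = a1 x + a2 x))"

text \<open>The summands are \<open>u\<close> composed with the projection onto \<open>L2\<close>, and \<open>u\<close> composed with the
  projection onto \<open>L1\<close>.\<close>
lemma square_zero_sum_of_isotropic_pair:
  assumes L1: "subspace L1" "\<And>x y. x \<in> L1 \<Longrightarrow> y \<in> L1 \<Longrightarrow> b x y = 0" "\<And>x. x \<in> L1 \<Longrightarrow> u x \<in> L2"
    and L2: "subspace L2" "\<And>x y. x \<in> L2 \<Longrightarrow> y \<in> L2 \<Longrightarrow> b x y = 0" "\<And>x. x \<in> L2 \<Longrightarrow> u x \<in> L1"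
    and sum: "\<And>v. \<exists>x\<in>L1. \<exists>y\<in>L2. v = x + y"
  shows square_zero_sum
proof -
  have disj: "x = 0" if "x \<in> L1" "x \<in> L2" for x
  proof (rule b_nondegenerate)
    fix y
    obtain y1 y2 where "y1 \<in> L1" "y2 \<in> L2" "y = y1 + y2" using sum by blast
    then show "b x y = 0" using that L1(2) L2(2) by (simp add: b_right)
  qed
  obtain f where f: "\<And>v. f v \<in> L1" "\<And>v. v - f v \<in> L2"
    using sum by (metis add_diff_cancel_left')
  have f_unique: "f v = x" if "x \<in> L1" "v - x \<in> L2" for v x
  proof -
    have "f v - x \<in> L1" using f(1) that(1) L1(1) by (simp add: subspace_diff)
    moreover have "f v - x = (v - x) - (v - f v)" by simp
    then have "f v - x \<in> L2" using f(2) that(2) L2(1) by (metis subspace_diff)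
    ultimately show ?thesis using disj by fastforce
  qed
  have f_add: "f (x + y) = f x + f y" for x y
  proof (rule f_unique)
    show "f x + f y \<in> L1" using f(1) L1(1) by (simp add: subspace_add)
    have eq: "x + y - (f x + f y) = (x - f x) + (y - f y)" by simp
    show "x + y - (f x + f y) \<in> L2" unfolding eq using f(2) L2(1) by (intro subspace_add)
  qed
  have f_scale: "f (scale c x) = scale c (f x)" for c x
  proof (rule f_unique)
    show "scale c (f x) \<in> L1" using f(1) L1(1) by (simp add: subspace_scale)
    show "scale c x - scale c (f x) \<in> L2" using f(2) L2(1)
      by (simp add: subspace_scale flip: scale_right_diff_distrib)
  qed
  have f_L1: "f x = x" if "x \<in> L1" for x using that L2(1) by (intro f_unique) (auto simp: subspace_0)
  have f_L2: "f x = 0" if "x \<in> L2" for x using that L1(1) by (intro f_unique) (auto simp: subspace_0)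
  define a1 where "a1 x = u (x - f x)" for x
  define a2 where "a2 x = u (f x)" for x
  have "Vector_Spaces.linear scale scale a1" "Vector_Spaces.linear scale scale a2"
    by (auto simp: Vector_Spaces.linear_iff a1_def a2_def f_add f_scale u_linear
        scale_right_diff_distrib vector_space_axioms)
  moreover have "b (a2 x) y = b x (a2 y)" for x y
  proof -
    have "b (a2 x) y = b (u (f x)) (f y)"
      using L2(2)[OF L1(3)[OF f(1)] f(2), of x y] by (simp add: a2_def b_right)
    also have "\<dots> = b (f x) (u (f y))" by (rule u_selfadjoint)
    also have "\<dots> = b x (a2 y)"
      using L2(2)[OF f(2) L1(3)[OF f(1)], of x y] by (simp add: a2_def b_left)
    finally show ?thesis .
  qed
  moreover have "b (a1 x) y = b x (a1 y)" for x y
  proof -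
    have "b (a1 x) y = b (u (x - f x)) (y - f y)"
      using L1(2)[OF L2(3)[OF f(2)] f(1), of x y] unfolding a1_def by (simp add: b_right)
    also have "\<dots> = b (x - f x) (u (y - f y))" by (rule u_selfadjoint)
    also have "\<dots> = b x (a1 y)"
      using L1(2)[OF f(1) L2(3)[OF f(2)], of x y] unfolding a1_def by (simp add: b_left)
    finally show ?thesis .
  qed
  moreover have "a1 (a1 x) = 0" for x
    using f_L1[OF L2(3)[OF f(2)]] by (simp add: a1_def u_linear)
  moreover have "a2 (a2 x) = 0" for x
    using f_L2[OF L1(3)[OF f(1)]] by (simp add: a2_def u_linear)
  moreover have "u x = a1 x + a2 x" for x by (simp add: a1_def a2_def u_linear)
  ultimately show ?thesis unfolding square_zero_sum_def selfadjoint_endo_def by blast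
qed

text \<open>The two isotropic subspaces are the eigenspaces of the involution
  \<open>\<Sum> r\<^sub>i(u) y\<^sub>i \<mapsto> \<Sum> r\<^sub>i(-u) y\<^bsub>\<tau> i\<^esub>\<close>: their elements have coefficient families with
  \<open>r\<^bsub>\<tau> i\<^esub>(t) = r\<^sub>i(-t)\<close> or \<open>r\<^bsub>\<tau> i\<^esub>(t) = - r\<^sub>i(-t)\<close>.\<close>
lemma square_zero_sum_of_matched_family:
  assumes two: "(2::'a) \<noteq> 0" and "finite I"
    and \<tau>: "\<And>i. i \<in> I \<Longrightarrow> \<tau> i \<in> I" "\<And>i. i \<in> I \<Longrightarrow> \<tau> (\<tau> i) = i"
    and orth: "\<And>i j. i \<in> I \<Longrightarrow> j \<in> I \<Longrightarrow> i \<noteq> j \<Longrightarrow> cyc_orth (Y i) (Y j)"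
    and span: "\<And>v. \<exists>r. v = (\<Sum>i\<in>I. P (r i) (Y i))"
    and matched: "\<And>i r. i \<in> I \<Longrightarrow> b (Y (\<tau> i)) (P (subst_neg r) (Y (\<tau> i))) = - b (Y i) (P r (Y i))"
  shows square_zero_sum
proof -
  define \<Sigma> where "\<Sigma> r = (\<Sum>i\<in>I. P (r i) (Y i))" for r
  define L where "L c = {\<Sigma> r | r. \<forall>i\<in>I. r (\<tau> i) = Polynomial.smult c (subst_neg (r i))}" for c :: 'a
  have subsp: "subspace (L c)" for c
    unfolding subspace_def
  proof (intro conjI ballI allI)
    show "0 \<in> L c" unfolding L_def \<Sigma>_def by (intro CollectI exI[of _ "\<lambda>_. 0"]) simp
  next
    fix x y assume "x \<in> L c" "y \<in> L c"
    then obtain r s where "x = \<Sigma> r" "\<forall>i\<in>I. r (\<tau> i) = Polynomial.smult c (subst_neg (r i))"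
      "y = \<Sigma> s" "\<forall>i\<in>I. s (\<tau> i) = Polynomial.smult c (subst_neg (s i))" unfolding L_def by blast
    then show "x + y \<in> L c" unfolding L_def
      by (intro CollectI exI[of _ "\<lambda>i. r i + s i"]) (simp add: \<Sigma>_def P_add sum.distrib smult_add_right)
  next
    fix a x assume "x \<in> L c"
    then obtain r where "x = \<Sigma> r" "\<forall>i\<in>I. r (\<tau> i) = Polynomial.smult c (subst_neg (r i))"
      unfolding L_def by blast
    then show "scale a x \<in> L c" unfolding L_def
      by (intro CollectI exI[of _ "\<lambda>i. Polynomial.smult a (r i)"])
        (simp add: \<Sigma>_def P_smult scale_sum_right mult.commute)
  qed
  have iso: "b x y = 0" if xy: "x \<in> L c" "y \<in> L c" and c: "c * c = 1" for x y c
  proof -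
    obtain r s where r: "x = \<Sigma> r" "\<And>i. i \<in> I \<Longrightarrow> r (\<tau> i) = Polynomial.smult c (subst_neg (r i))"
      and s: "y = \<Sigma> s" "\<And>i. i \<in> I \<Longrightarrow> s (\<tau> i) = Polynomial.smult c (subst_neg (s i))"
      using xy unfolding L_def by blast
    have bxy: "b x y = (\<Sum>i\<in>I. b (Y i) (P (r i * s i) (Y i)))"
    proof -
      have "b (P (r i) (Y i)) y = b (Y i) (P (r i * s i) (Y i))" if i: "i \<in> I" for i
      proof -
        have "b (P (r i) (Y i)) y = (\<Sum>j\<in>I. b (Y i) (P (r i * s j) (Y j)))"
          by (simp add: s(1) \<Sigma>_def b_right P_selfadjoint P_mult)
        also have "\<dots> = b (Y i) (P (r i * s i) (Y i)) + (\<Sum>j\<in>I - {i}. b (Y i) (P (r i * s j) (Y j)))"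
          using \<open>finite I\<close> i by (rule sum.remove)
        also have "(\<Sum>j\<in>I - {i}. b (Y i) (P (r i * s j) (Y j))) = 0"
          using orth[OF i] by (intro sum.neutral) (auto simp: cyc_orth_def)
        finally show ?thesis by simp
      qed
      then show ?thesis unfolding r(1) by (simp add: \<Sigma>_def b_left)
    qed
    have "bij_betw \<tau> I I"
      by (rule bij_betwI[where g = \<tau>]) (use \<tau> in auto)
    then have "b x y = (\<Sum>i\<in>I. b (Y (\<tau> i)) (P (r (\<tau> i) * s (\<tau> i)) (Y (\<tau> i))))"
      unfolding bxy by (rule sum.reindex_bij_betw[symmetric])
    also have "\<dots> = (\<Sum>i\<in>I. - b (Y i) (P (r i * s i) (Y i)))"
    proof (rule sum.cong[OF refl])
      fix i assume i: "i \<in> I"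
      have "r (\<tau> i) * s (\<tau> i) = subst_neg (r i * s i)" using r(2)[OF i] s(2)[OF i] c by simp
      then show "b (Y (\<tau> i)) (P (r (\<tau> i) * s (\<tau> i)) (Y (\<tau> i))) = - b (Y i) (P (r i * s i) (Y i))"
        using matched[OF i] by (simp del: subst_neg_simps(6))
    qed
    also have "\<dots> = - b x y" unfolding bxy by (simp add: sum_negf)
    finally have "2 * b x y = 0" by (simp add: eq_neg_iff_add_eq_0)
    then show ?thesis using two by simp
  qed
  have swap: "u x \<in> L (- c)" if "x \<in> L c" for x c
  proof -
    obtain r where r: "x = \<Sigma> r" "\<forall>i\<in>I. r (\<tau> i) = Polynomial.smult c (subst_neg (r i))"
      using \<open>x \<in> L c\<close> unfolding L_def by blast
    have "u x = \<Sigma> (\<lambda>i. [:0, 1:] * r i)" unfolding r(1) \<Sigma>_def u_linear P_mult by simp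
    moreover have "\<forall>i\<in>I. [:0, 1:] * r (\<tau> i) = Polynomial.smult (- c) (subst_neg ([:0, 1:] * r i))"
      using r(2) by (simp only: subst_neg_simps) simp
    ultimately show ?thesis unfolding L_def by blast
  qed
  have sum: "\<exists>x\<in>L 1. \<exists>y\<in>L (- 1). v = x + y" for v
  proof -
    obtain r where r: "v = \<Sigma> r" using span unfolding \<Sigma>_def by blast
    define h where "h c i = Polynomial.smult (1 / 2) (r i + Polynomial.smult c (subst_neg (r (\<tau> i))))" for c i
    have "\<Sigma> (h 1) \<in> L 1" "\<Sigma> (h (- 1)) \<in> L (- 1)"
      unfolding L_def by (auto intro!: exI[of _ "h _"] simp: h_def \<tau> smult_add_right smult_diff_right)
    moreover have "h 1 i + h (- 1) i = r i" for i
    proof -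
      have "h 1 i + h (- 1) i = Polynomial.smult (1 / 2) (r i) + Polynomial.smult (1 / 2) (r i)"
        unfolding h_def by (simp add: smult_add_right smult_diff_right)
      also have "\<dots> = Polynomial.smult (1 / 2 + 1 / 2) (r i)" by (simp only: smult_add_left)
      also have "1 / 2 + 1 / 2 = (1::'a)" using two by (metis add_divide_distrib one_add_one divide_self)
      finally show ?thesis by simp
    qed
    then have "v = \<Sigma> (h 1) + \<Sigma> (h (- 1))"
      unfolding r \<Sigma>_def by (simp flip: sum.distrib P_add)
    ultimately show ?thesis by blast
  qed
  show ?thesis
    by (rule square_zero_sum_of_isotropic_pair[OF subsp iso _ subsp iso _ sum])
      (use swap[of _ 1] swap[of _ "-1"] in auto)
qed

text \<open>Only the members with exactly the invariants \<open>q\<close> and \<open>l\<close> may contribute to \<open>Ker q(u)^l\<close>; this is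
  what makes the notion invariant under changing each member \<open>i\<close> by an element of \<open>N (p i) (k i)\<close>.\<close>
definition residually_spanning :: "'i set \<Rightarrow> ('i \<Rightarrow> 'a poly) \<Rightarrow> ('i \<Rightarrow> nat) \<Rightarrow> ('i \<Rightarrow> 'v) \<Rightarrow> bool" where
  "residually_spanning I p k G \<longleftrightarrow>
     (\<forall>q\<in>Irr. \<forall>l\<ge>1. \<forall>z\<in>K q l. \<exists>r. z - (\<Sum>i\<in>{i\<in>I. p i = q \<and> k i = l}. P (r i) (G i)) \<in> N q l)"

lemma residually_spanning_cong:
  assumes "residually_spanning I p k G" and "\<And>i. i \<in> I \<Longrightarrow> Y i - G i \<in> N (p i) (k i)"
  shows "residually_spanning I p k Y"
  unfolding residually_spanning_def
proof (intro ballI allI impI)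
  fix q :: "'a poly" and l :: nat and z assume "q \<in> Irr" "1 \<le> l" "z \<in> K q l"
  then obtain r where r: "z - (\<Sum>i\<in>{i\<in>I. p i = q \<and> k i = l}. P (r i) (G i)) \<in> N q l"
    using assms(1) unfolding residually_spanning_def by blast
  have "(\<Sum>i\<in>{i\<in>I. p i = q \<and> k i = l}. P (r i) (Y i - G i)) \<in> N q l"
    by (rule N_sum) (use assms(2) in \<open>auto intro: N_P\<close>)
  from N_diff[OF r this]
  have "z - (\<Sum>i\<in>{i\<in>I. p i = q \<and> k i = l}. P (r i) (Y i)) \<in> N q l"
    by (simp add: P_right sum_subtractf)
  then show "\<exists>r. z - (\<Sum>i\<in>{i\<in>I. p i = q \<and> k i = l}. P (r i) (Y i)) \<in> N q l" by blast
qed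

text \<open>Orthogonalisation preserves the matching of residual forms. The matching of the full forms is
  reached by normalising all generators at once: half the difference of the form of \<open>i\<close> and of the
  reflected form of \<open>\<tau> i\<close> is a target that satisfies the matching relation by construction, and it
  has the same restriction to the socle as the form of \<open>i\<close>.\<close>
lemma square_zero_sum_of_matched_residual_family:
  assumes two: "(2::'a) \<noteq> 0"
    and fam: "residual_family I p k G" and span: "residually_spanning I p k G"
    and \<tau>: "\<And>i. i \<in> I \<Longrightarrow> \<tau> i \<in> I" "\<And>i. i \<in> I \<Longrightarrow> \<tau> (\<tau> i) = i"
      "\<And>i. i \<in> I \<Longrightarrow> p (\<tau> i) = op_poly (p i)" "\<And>i. i \<in> I \<Longrightarrow> k (\<tau> i) = k i"
    and matched: "\<And>i s. i \<in> I \<Longrightarrow> p i ^ (k i - 1) dvd s \<Longrightarrow>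
      b (G (\<tau> i)) (P (subst_neg s) (G (\<tau> i))) = - b (G i) (P s (G i))"
  shows square_zero_sum
proof -
  have "finite I" using fam by (simp add: residual_family_def)
  obtain Y where YG: "\<And>i. i \<in> I \<Longrightarrow> Y i - G i \<in> N (p i) (k i)"
    and Y_orth: "\<And>i j. i \<in> I \<Longrightarrow> j \<in> I \<Longrightarrow> i \<noteq> j \<Longrightarrow> cyc_orth (Y i) (Y j)"
    using orthogonalise_family[OF fam] by blast
  have Y_gen: "regular_gen (p i) (k i) (Y i)" and G_gen: "regular_gen (p i) (k i) (G i)" if "i \<in> I" for i
    using residual_family_cong[OF fam YG] fam that by (simp_all add: residual_family_def)
  have same: "b (Y i) (P s (Y i)) = b (G i) (P s (G i))" if "i \<in> I" "p i ^ (k i - 1) dvd s" for i s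
    by (rule residual_form_cong[of "k i" "p i"])
      (use that YG[OF that(1)] G_gen[OF that(1)] in \<open>auto simp: regular_gen_def\<close>)
  have Y_matched: "b (Y (\<tau> i)) (P (subst_neg s) (Y (\<tau> i))) = - b (Y i) (P s (Y i))"
    if i: "i \<in> I" and s: "p i ^ (k i - 1) dvd s" for i s
  proof -
    have "p (\<tau> i) ^ (k (\<tau> i) - 1) dvd subst_neg s" using s \<tau>[OF i] by (simp add: op_poly_dvd_iff)
    then show ?thesis using matched[OF i s] same[OF i s] same[OF \<tau>(1)[OF i]] by simp
  qed
  define \<psi> where "\<psi> i r = (b (Y i) (P r (Y i)) - b (Y (\<tau> i)) (P (subst_neg r) (Y (\<tau> i)))) / 2" for i r
  have "\<exists>q. p i dvd q - 1 \<and> (\<forall>r. b (P q (Y i)) (P r (P q (Y i))) = \<psi> i r)" if i: "i \<in> I" for i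
  proof (rule normalise_generator[OF two Y_gen[OF i]])
    show "poly_linear (\<psi> i)"
      by (simp add: poly_linear_def \<psi>_def P_add P_smult b_right algebra_simps add_divide_distrib diff_divide_distrib)
    have Ki: "Y i \<in> K (p i) (k i)" "Y (\<tau> i) \<in> K (p (\<tau> i)) (k (\<tau> i))"
      using Y_gen[OF i] Y_gen[OF \<tau>(1)[OF i]] by (auto simp: regular_gen_def)
    show "\<psi> i (p i ^ k i * r) = 0" for r
    proof -
      have "p (\<tau> i) ^ k (\<tau> i) dvd subst_neg (p i ^ k i * r)"
        using \<tau>[OF i] by (simp add: op_poly_dvd_iff del: subst_neg_simps(6) subst_neg_power)
      then show ?thesis using Ki by (auto simp: \<psi>_def cyclic_form_vanishes elim!: dvdE)
    qed
    show "\<psi> i (p i ^ (k i - 1) * r) = b (Y i) (P (p i ^ (k i - 1) * r) (Y i))" for r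
    proof -
      have "b (Y (\<tau> i)) (P (subst_neg (p i ^ (k i - 1) * r)) (Y (\<tau> i))) = - b (Y i) (P (p i ^ (k i - 1) * r) (Y i))"
        by (rule Y_matched[OF i]) simp
      then show ?thesis using two unfolding \<psi>_def by (simp only:) (simp add: field_simps)
    qed
  qed
  then obtain q where q1: "\<And>i. i \<in> I \<Longrightarrow> p i dvd q i - 1"
    and q: "\<And>i r. i \<in> I \<Longrightarrow> b (P (q i) (Y i)) (P r (P (q i) (Y i))) = \<psi> i r" by metis
  define Z where "Z i = P (q i) (Y i)" for i
  have ZY: "Z i - Y i \<in> N (p i) (k i)" if "i \<in> I" for i
  proof -
    have "P (q i - 1) (Y i) \<in> N (p i) (k i)"
      by (rule N_of_dvd) (use q1 Y_gen that in \<open>auto simp: regular_gen_def\<close>)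
    then show ?thesis by (simp add: Z_def P_diff)
  qed
  have "residually_spanning I p k Z"
    by (rule residually_spanning_cong[OF residually_spanning_cong[OF span YG] ZY])
  have Z_gen: "regular_gen (p i) (k i) (Z i)" if "i \<in> I" for i
    using regular_gen_cong[OF Y_gen ZY] that by blast
  have Z_orth: "cyc_orth (Z i) (Z j)" if "i \<in> I" "j \<in> I" "i \<noteq> j" for i j
    unfolding Z_def using Y_orth[OF that]
    by (metis cyc_orth_P cyc_orth_commute)
  have Z_span: "\<exists>r. v = (\<Sum>i\<in>I. P (r i) (Z i))" for v
  proof (rule orthogonal_family_spans[OF \<open>finite I\<close> Z_gen Z_orth])
    fix q' :: "'a poly" and l :: nat and z assume "q' \<in> Irr" "l \<ge> 1" "z \<in> K q' l"
    then obtain r where r: "z - (\<Sum>i\<in>{i\<in>I. p i = q' \<and> k i = l}. P (r i) (Z i)) \<in> N q' l"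
      using \<open>residually_spanning I p k Z\<close> unfolding residually_spanning_def by blast
    have eq: "(\<Sum>i\<in>{i\<in>I. p i = q' \<and> k i = l}. P (r i) (Z i))
        = (\<Sum>i\<in>I. P (if p i = q' \<and> k i = l then r i else 0) (Z i))"
      by (rule sum.mono_neutral_cong_left) (use \<open>finite I\<close> in auto)
    show "\<exists>r. z - (\<Sum>i\<in>I. P (r i) (Z i)) \<in> N q' l" using r unfolding eq
      by (rule exI[of _ "\<lambda>i. if p i = q' \<and> k i = l then r i else 0"])
  qed
  show ?thesis
  proof (rule square_zero_sum_of_matched_family[OF two \<open>finite I\<close> \<tau>(1,2) Z_orth Z_span])
    fix i r assume i: "i \<in> I"
    have "\<psi> (\<tau> i) (subst_neg r) = - \<psi> i r"
      using i two by (simp add: \<psi>_def \<tau> field_simps)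
    then show "b (Z (\<tau> i)) (P (subst_neg r) (Z (\<tau> i))) = - b (Z i) (P r (Z i))"
      using q[OF i] q[OF \<tau>(1)[OF i]] by (simp add: Z_def)
  qed
qed

section \<open>Residual orthogonal bases\<close>

lemma res_orth_commute: "res_orth p k x y \<longleftrightarrow> res_orth p k y x"
  by (simp add: res_orth_def b_P_swap[of x])

lemma res_orth_P: "res_orth p k x y \<Longrightarrow> res_orth p k x (P r y)"
  by (simp add: res_orth_def flip: P_mult)

lemma res_orth_add: "res_orth p k x y \<Longrightarrow> res_orth p k x z \<Longrightarrow> res_orth p k x (y + z)"
  by (simp add: res_orth_def P_right b_right)

lemma res_orth_diff: "res_orth p k x y \<Longrightarrow> res_orth p k x z \<Longrightarrow> res_orth p k x (y - z)"
  by (simp add: res_orth_def P_right b_right)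

lemma res_orth_sum: "(\<And>i. i \<in> S \<Longrightarrow> res_orth p k x (f i)) \<Longrightarrow> res_orth p k x (sum f S)"
  by (simp add: res_orth_def P_right b_right)

lemma regular_genI:
  assumes "p \<in> Irr" "k \<ge> 1" "x \<in> K p k" "p ^ (k - 1) dvd s" "b x (P s x) \<noteq> 0"
  shows "regular_gen p k x"
  using assms unfolding regular_gen_def by (auto elim!: dvdE)

definition res_orth_set :: "'a poly \<Rightarrow> nat \<Rightarrow> 'v set \<Rightarrow> bool" where
  "res_orth_set p k S \<longleftrightarrow> finite S \<and> (\<forall>x\<in>S. regular_gen p k x) \<and>
     (\<forall>x\<in>S. \<forall>y\<in>S. x \<noteq> y \<longrightarrow> res_orth p k x y)"

lemma regular_gen_not_self_orth: "regular_gen p k x \<Longrightarrow> \<not> res_orth p k x x"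
  unfolding regular_gen_def res_orth_def by (meson dvd_triv_left)

lemma res_orth_set_projection:
  assumes S: "res_orth_set p k S"
  shows "\<exists>h. \<forall>x\<in>S. res_orth p k x (y - (\<Sum>z\<in>S. P (h z) z))"
proof -
  have "\<forall>x\<in>S. \<exists>h. cyc_orth (y - P h x) x" using S cyclic_projection by (auto simp: res_orth_set_def)
  then obtain h where h: "\<And>x. x \<in> S \<Longrightarrow> cyc_orth (y - P (h x) x) x" by metis
  have "res_orth p k x (y - (\<Sum>z\<in>S. P (h z) z))" if x: "x \<in> S" for x
  proof -
    have "finite S" using S by (simp add: res_orth_set_def)
    have "(\<Sum>z\<in>S. P (h z) z) = P (h x) x + (\<Sum>z\<in>S - {x}. P (h z) z)"
      using \<open>finite S\<close> x by (rule sum.remove)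
    then have eq: "y - (\<Sum>z\<in>S. P (h z) z) = (y - P (h x) x) - (\<Sum>z\<in>S - {x}. P (h z) z)" by simp
    have "res_orth p k x (y - P (h x) x)"
      using h[OF x] by (simp add: res_orth_def cyc_orth_commute[of _ x]) (simp add: cyc_orth_def)
    moreover have "res_orth p k x (\<Sum>z\<in>S - {x}. P (h z) z)"
      using S x by (intro res_orth_sum res_orth_P) (auto simp: res_orth_set_def)
    ultimately show ?thesis unfolding eq by (rule res_orth_diff)
  qed
  then show ?thesis by blast
qed

text \<open>Gives the bound on the size of such sets which lets a maximal one exist.\<close>
lemma res_orth_set_independent:
  assumes S: "res_orth_set p k S"
  shows "independent S"
proof -
  have "finite S" using S by (simp add: res_orth_set_def)
  have "f v = 0" if sum: "(\<Sum>x\<in>S. scale (f x) x) = 0" and v: "v \<in> S" for f v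
  proof -
    obtain r where r: "b v (P (p ^ (k - 1) * r) v) \<noteq> 0"
      using S v by (auto simp: res_orth_set_def regular_gen_def)
    have "0 = b v (P (p ^ (k - 1) * r) (\<Sum>x\<in>S. scale (f x) x))" by (simp add: sum P_right b_right)
    also have "\<dots> = (\<Sum>x\<in>S. f x * b v (P (p ^ (k - 1) * r) x))" by (simp add: P_right b_right)
    also have "\<dots> = f v * b v (P (p ^ (k - 1) * r) v) + (\<Sum>x\<in>S - {v}. f x * b v (P (p ^ (k - 1) * r) x))"
      using \<open>finite S\<close> v by (rule sum.remove)
    also have "(\<Sum>x\<in>S - {v}. f x * b v (P (p ^ (k - 1) * r) x)) = 0"
      using S v by (intro sum.neutral) (auto simp: res_orth_set_def res_orth_def)
    finally show ?thesis using r by simp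
  qed
  then show ?thesis using \<open>finite S\<close> by (auto simp: dependent_finite)
qed

lemma residual_pairing:
  assumes p: "p \<in> Irr" and k: "k \<ge> 1" and S: "res_orth_set p k S"
    and y: "y \<in> K p k" "y \<notin> N p k" "\<And>x. x \<in> S \<Longrightarrow> res_orth p k x y"
  shows "\<exists>z\<in>K p k. (\<forall>x\<in>S. res_orth p k x z) \<and> b y (P (p ^ (k - 1)) z) \<noteq> 0"
proof -
  obtain z where z: "z \<in> K p k" "b y (P (p ^ (k - 1)) z) \<noteq> 0"
    using residual_nondegenerate[OF k y(1)] y(2) by blast
  obtain h where h: "\<And>x. x \<in> S \<Longrightarrow> res_orth p k x (z - (\<Sum>x\<in>S. P (h x) x))"
    using res_orth_set_projection[OF S] by blast
  have "res_orth p k y (\<Sum>x\<in>S. P (h x) x)"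
    using y(3) by (intro res_orth_sum res_orth_P) (simp add: res_orth_commute)
  then have "b y (P (p ^ (k - 1)) (z - (\<Sum>x\<in>S. P (h x) x))) \<noteq> 0"
    using z(2) by (simp add: res_orth_def P_right(5) b_right(5))
  moreover have "z - (\<Sum>x\<in>S. P (h x) x) \<in> K p k"
    using z(1) S by (intro K_diff K_sum K_P) (auto simp: res_orth_set_def regular_gen_def)
  ultimately show ?thesis using h by blast
qed

lemma polarise:
  assumes two: "(2::'a) \<noteq> 0"
    and "b x (P s x) = 0" "b y (P s y) = 0" "b (x + y) (P s (x + y)) = 0"
  shows "b x (P s y) = 0"
proof -
  have "2 * b x (P s y) = 0" using assms(2-4) b_P_swap[of y s x] by (simp add: b_left b_right P_right)
  then show ?thesis using two by simp
qed

text \<open>A maximal residually orthogonal set of regular vectors in \<open>D\<close> is a residual basis, as soon as the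
  residual orthogonal of such a set contains a regular vector of \<open>D\<close> unless it lies in \<open>N p k\<close>.\<close>
lemma exists_residual_basis:
  assumes p: "p \<in> Irr" and k: "k \<ge> 1"
    and D: "\<And>S y. S \<subseteq> D \<Longrightarrow> res_orth_set p k S \<Longrightarrow> y \<in> K p k \<Longrightarrow> y \<notin> N p k \<Longrightarrow>
      (\<And>x. x \<in> S \<Longrightarrow> res_orth p k x y) \<Longrightarrow>
      \<exists>w\<in>D. regular_gen p k w \<and> (\<forall>x\<in>S. res_orth p k x w)"
  shows "\<exists>S\<subseteq>D. res_orth_set p k S \<and> (\<forall>z\<in>K p k. \<exists>r. z - (\<Sum>x\<in>S. P (r x) x) \<in> N p k)"
proof -
  let ?good = "\<lambda>S. S \<subseteq> D \<and> res_orth_set p k S"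
  have bound: "card S \<le> dimension" if "?good S" for S
    using independent_card_le_dim[OF subset_UNIV res_orth_set_independent[of p k S]] that
    by (simp add: dimension_def)
  have "\<exists>S. ?good S \<and> (\<forall>S'. ?good S' \<longrightarrow> card S' \<le> card S)"
  proof (rule ex_has_greatest_nat)
    show "?good {}" by (simp add: res_orth_set_def)
    show "\<forall>S. ?good S \<longrightarrow> card S < Suc dimension" using bound by (simp add: less_Suc_eq_le)
  qed
  then obtain S where S: "?good S" and S_max: "\<And>S'. ?good S' \<Longrightarrow> card S' \<le> card S" by blast
  have "\<exists>r. z - (\<Sum>x\<in>S. P (r x) x) \<in> N p k" if z: "z \<in> K p k" for z
  proof (rule ccontr)
    assume not: "\<not> ?thesis"
    obtain h where h: "\<And>x. x \<in> S \<Longrightarrow> res_orth p k x (z - (\<Sum>x\<in>S. P (h x) x))"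
      using res_orth_set_projection S by blast
    have "z - (\<Sum>x\<in>S. P (h x) x) \<in> K p k"
      using z S by (intro K_diff K_sum K_P) (auto simp: res_orth_set_def regular_gen_def)
    moreover have "z - (\<Sum>x\<in>S. P (h x) x) \<notin> N p k" using not by blast
    ultimately have "\<exists>w\<in>D. regular_gen p k w \<and> (\<forall>x\<in>S. res_orth p k x w)"
      using S h by (intro D) auto
    then obtain w where w: "w \<in> D" "regular_gen p k w" "\<And>x. x \<in> S \<Longrightarrow> res_orth p k x w" by blast
    have "w \<notin> S" using w(2,3) regular_gen_not_self_orth by blast
    moreover have "?good (insert w S)"
      using S w res_orth_commute by (auto simp: res_orth_set_def)
    moreover have "finite S" using S by (simp add: res_orth_set_def)
    ultimately show False using S_max[of "insert w S"] by simp
  qed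
  with S show ?thesis by blast
qed

text \<open>If two vectors pair nontrivially, one of them or their sum pairs nontrivially with itself.\<close>
lemma exists_orthogonal_residual_basis:
  assumes two: "(2::'a) \<noteq> 0" and p: "p \<in> Irr" and k: "k \<ge> 1"
  shows "\<exists>S. res_orth_set p k S \<and> (\<forall>z\<in>K p k. \<exists>r. z - (\<Sum>x\<in>S. P (r x) x) \<in> N p k)"
proof -
  have "\<exists>S\<subseteq>UNIV. res_orth_set p k S \<and> (\<forall>z\<in>K p k. \<exists>r. z - (\<Sum>x\<in>S. P (r x) x) \<in> N p k)"
  proof (rule exists_residual_basis[OF p k])
    fix S y assume S: "res_orth_set p k S" and y: "y \<in> K p k" "y \<notin> N p k" "\<And>x. x \<in> S \<Longrightarrow> res_orth p k x y"
    obtain z where z: "z \<in> K p k" "\<And>x. x \<in> S \<Longrightarrow> res_orth p k x z" "b y (P (p ^ (k - 1)) z) \<noteq> 0"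
      using residual_pairing[OF p k S y] by blast
    have "\<exists>w\<in>{y, z, y + z}. b w (P (p ^ (k - 1)) w) \<noteq> 0"
      using polarise[OF two, of y "p ^ (k - 1)" z] z(3) by auto
    then obtain w where w: "w \<in> {y, z, y + z}" "b w (P (p ^ (k - 1)) w) \<noteq> 0" by blast
    have "w \<in> K p k" using w(1) y(1) z(1) by (auto intro: K_add)
    then have "regular_gen p k w" using regular_genI[OF p k _ dvd_refl w(2)] by blast
    moreover have "\<forall>x\<in>S. res_orth p k x w" using w(1) y(3) z(2) by (auto intro: res_orth_add)
    ultimately show "\<exists>w\<in>UNIV. regular_gen p k w \<and> (\<forall>x\<in>S. res_orth p k x w)" by blast
  qed
  then show ?thesis by blast
qed

section \<open>The involution of a square-zero decomposition\<close>

text \<open>An isomorphism from \<open>(V, b, u)\<close> to \<open>(V, -b, -u)\<close> that is an involution.\<close>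
definition skew_involution :: "('v \<Rightarrow> 'v) \<Rightarrow> bool" where
  "skew_involution s \<longleftrightarrow> Vector_Spaces.linear scale scale s \<and> (\<forall>x. s (s x) = x) \<and>
     (\<forall>x. s (u x) = - u (s x)) \<and> (\<forall>x y. b (s x) (s y) = - b x y)"

text \<open>With \<open>d = a1 - a2\<close> one has \<open>d\<^sup>2 = -u\<^sup>2\<close> and \<open>d u = - u d\<close>, so \<open>d u\<^sup>-\<^sup>1\<close> is such an involution; it is
  the identity on \<open>Ker a1\<close> and the opposite of the identity on \<open>Ker a2\<close>.\<close>
lemma skew_involution_of_square_zero_sum:
  assumes "bij u" and square_zero_sum
  shows "\<exists>s. skew_involution s"
proof -
  obtain a1 a2 where a1: "selfadjoint_endo scale b a1" "\<And>x. a1 (a1 x) = 0"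
    and a2: "selfadjoint_endo scale b a2" "\<And>x. a2 (a2 x) = 0"
    and u: "\<And>x. u x = a1 x + a2 x"
    using assms(2) unfolding square_zero_sum_def by blast
  interpret l1: Vector_Spaces.linear scale scale a1 using a1(1) by (simp add: selfadjoint_endo_def)
  interpret l2: Vector_Spaces.linear scale scale a2 using a2(1) by (simp add: selfadjoint_endo_def)
  have sa: "b (a1 x) y = b x (a1 y)" "b (a2 x) y = b x (a2 y)" for x y
    using a1(1) a2(1) by (simp_all add: selfadjoint_endo_def)
  define d where "d x = a1 x - a2 x" for x
  define v where "v = inv_into UNIV u"
  have uv: "u (v x) = x" and vu: "v (u x) = x" for x
    using \<open>bij u\<close> by (simp_all add: v_def bij_is_surj bij_is_inj surj_f_inv_f)
  have v_lin: "v (x + y) = v x + v y" "v (scale c x) = scale c (v x)" for x y c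
    by (metis u_linear(1) uv vu, metis u_linear(2) uv vu)
  have d_lin: "d (x + y) = d x + d y" "d (scale c x) = scale c (d x)" "d (- x) = - d x" for x y c
    by (simp_all add: d_def l1.add l2.add l1.scale l2.scale l1.neg l2.neg scale_right_diff_distrib)
  have du: "d (u x) = - u (d x)" for x
    by (simp add: d_def u l1.add l2.add l1.diff l2.diff a1 a2)
  have dd: "d (d x) = - u (u x)" for x
    by (simp add: d_def u l1.add l2.add l1.diff l2.diff a1 a2)
  have d_sa: "b (d x) y = b x (d y)" for x y by (simp add: d_def b_left b_right sa)
  have vd: "v (d x) = - d (v x)" for x
    by (metis du uv vu u_linear(4))
  have "Vector_Spaces.linear scale scale (\<lambda>x. d (v x))"
    by (simp add: Vector_Spaces.linear_iff vector_space_axioms v_lin d_lin)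
  moreover have "d (v (d (v x))) = x" for x by (simp add: vd d_lin dd uv)
  moreover have "d (v (u x)) = - u (d (v x))" for x by (simp add: vu uv flip: du)
  moreover have "b (d (v x)) (d (v y)) = - b x y" for x y
  proof -
    have "b (d (v x)) (d (v y)) = b (v x) (d (d (v y)))" by (rule d_sa)
    also have "\<dots> = - b (u (v x)) (u (v y))" by (simp add: dd b_right u_selfadjoint)
    finally show ?thesis by (simp add: uv)
  qed
  ultimately show ?thesis unfolding skew_involution_def by blast
qed

lemma skew_involutionD:
  assumes "skew_involution s"
  shows "s (x + y) = s x + s y" "s (x - y) = s x - s y" "s (- x) = - s x" "s 0 = 0" "s (s x) = x"
    "s (P q x) = P (subst_neg q) (s x)" "b (s x) (s y) = - b x y"
proof -
  interpret l: Vector_Spaces.linear scale scale s using assms by (simp add: skew_involution_def)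
  show "s (x + y) = s x + s y" "s (x - y) = s x - s y" "s (- x) = - s x" "s 0 = 0"
    by (fact l.add l.diff l.neg l.zero)+
  show "s (s x) = x" "b (s x) (s y) = - b x y" using assms by (simp_all add: skew_involution_def)
  have su: "s (u x) = - u (s x)" for x using assms by (simp add: skew_involution_def)
  show "s (P q x) = P (subst_neg q) (s x)"
  proof (induction q)
    case (pCons c q)
    have "subst_neg (pCons c q) = [:c:] - [:0, 1:] * subst_neg q"
      by (simp add: subst_neg_def pcompose_pCons)
    then have "P (subst_neg (pCons c q)) (s x) = P [:c:] (s x) - u (P (subst_neg q) (s x))"
      by (simp only: P_diff P_mult P_X)
    then show ?case by (simp add: P_pCons l.add l.scale su pCons.IH u_linear)
  qed (simp add: l.zero)
qed

lemma skew_involution_K: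
  assumes "skew_involution s" shows "s x \<in> K (op_poly p) k \<longleftrightarrow> x \<in> K p k"
proof -
  have "P (op_poly p ^ k) (s x) = scale (((- 1) ^ degree p) ^ k) (P (subst_neg (p ^ k)) (s x))"
    by (simp add: op_poly_eq smult_power P_smult)
  also have "P (subst_neg (p ^ k)) (s x) = s (P (p ^ k) x)"
    using skew_involutionD(6)[OF assms] by metis
  finally show ?thesis using skew_involutionD(4,5)[OF assms]
    by (simp add: K_iff) metis
qed

lemma skew_involution_N:
  assumes s: "skew_involution s" and x: "x \<in> N p k" shows "s x \<in> N (op_poly p) k"
proof -
  obtain y w where yw: "x = y + P p w" "y \<in> K p (k - 1)" "P p w \<in> K p k" using x unfolding N_iff by blast
  have "s (P p w) = P (op_poly p) (scale ((- 1) ^ degree p) (s w))"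
    by (simp add: skew_involutionD(6)[OF s] op_poly_eq P_smult P_right flip: power_mult_distrib)
  then obtain w' where w': "s (P p w) = P (op_poly p) w'" by blast
  have "s y \<in> N (op_poly p) k" by (rule N_of_lower_kernel) (use yw(2) skew_involution_K[OF s] in simp)
  moreover have "s (P p w) \<in> N (op_poly p) k"
    unfolding w' by (rule N_of_image) (use yw(3) skew_involution_K[OF s] in \<open>simp flip: w'\<close>)
  ultimately show ?thesis by (simp add: yw(1) skew_involutionD(1)[OF s] N_add)
qed

text \<open>For \<open>p \<in> Irr0\<close> a residual basis can be found among the vectors \<open>x\<close> with \<open>s x = x\<close> or
  \<open>s x = - x\<close>. Multiplication by \<open>u\<close> exchanges both eigenspaces, which allows polarisation
  between them.\<close>
lemma exists_eigen_residual_basis: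
  assumes two: "(2::'a) \<noteq> 0" and s: "skew_involution s" and p0: "p \<in> Irr0" and k: "k \<ge> 1"
  shows "\<exists>S\<subseteq>{x. s x = x \<or> s x = - x}.
    res_orth_set p k S \<and> (\<forall>z\<in>K p k. \<exists>r. z - (\<Sum>x\<in>S. P (r x) x) \<in> N p k)"
proof (rule exists_residual_basis[OF Irr0_imp(1)[OF p0] k])
  note sD = skew_involutionD[OF s]
  have p: "p \<in> Irr" and op: "op_poly p = p" using Irr0_imp[OF p0] by auto
  fix S y
  assume SD: "S \<subseteq> {x. s x = x \<or> s x = - x}" and S: "res_orth_set p k S"
    and y: "y \<in> K p k" "y \<notin> N p k" "\<And>x. x \<in> S \<Longrightarrow> res_orth p k x y"
  obtain z where z: "z \<in> K p k" "\<And>x. x \<in> S \<Longrightarrow> res_orth p k x z" "b y (P (p ^ (k - 1)) z) \<noteq> 0"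
    using residual_pairing[OF p k S y] by blast
  define U where "U = {w \<in> K p k. \<forall>x\<in>S. res_orth p k x w}"
  have U_add: "v + w \<in> U" if "v \<in> U" "w \<in> U" for v w
    using that by (auto simp: U_def intro: K_add res_orth_add)
  have U_diff: "v - w \<in> U" if "v \<in> U" "w \<in> U" for v w
    using that by (auto simp: U_def intro: K_diff res_orth_diff)
  have U_P: "P r w \<in> U" if "w \<in> U" for r w
    using that by (auto simp: U_def intro: K_P res_orth_P)
  have U_s: "s w \<in> U" if w: "w \<in> U" for w
  proof -
    have "s w \<in> K p k" using skew_involution_K[OF s, of w p k] w op by (simp add: U_def)
    moreover have "res_orth p k x (s w)" if x: "x \<in> S" for x
      unfolding res_orth_def
    proof (intro allI impI)
      fix t assume t: "p ^ (k - 1) dvd t"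
      have "p ^ (k - 1) dvd subst_neg t" using t op op_poly_dvd_iff[of p "k - 1" t] by simp
      then have "b x (P (subst_neg t) w) = 0" using w x by (auto simp: U_def res_orth_def)
      then have "b (s x) (P t (s w)) = 0" using sD(6)[of "subst_neg t" w] sD(7)[of x "P (subst_neg t) w"] by simp
      then show "b x (P t (s w)) = 0" using SD x by (auto simp: b_left)
    qed
    ultimately show ?thesis by (simp add: U_def)
  qed
  show "\<exists>w\<in>{x. s x = x \<or> s x = - x}. regular_gen p k w \<and> (\<forall>x\<in>S. res_orth p k x w)"
  proof (rule ccontr)
    assume "\<not> ?thesis"
    then have iso: "b w (P t w) = 0" if "w \<in> U" "s w = w \<or> s w = - w" "p ^ (k - 1) dvd t" for w t
      using that regular_genI[OF p k, of w t] by (auto simp: U_def)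
    have same: "b v (P t w) = 0"
      if "v \<in> U" "w \<in> U" "s v = scale c v" "s w = scale c w" "c = 1 \<or> c = - 1" "p ^ (k - 1) dvd t" for v w c t
    proof (rule polarise[OF two])
      show "b v (P t v) = 0" "b w (P t w) = 0" "b (v + w) (P t (v + w)) = 0"
        using that U_add by (auto intro!: iso simp: sD(1))
    qed
    have "\<not> p dvd [:0, 1:]"
      using Irr_dvd_imp_eq[OF p X_Irr] X_not_Irr0 p0 by blast
    then obtain \<alpha> \<beta> where ab: "\<alpha> * [:0, 1:] + \<beta> * p = 1"
      using bezout_irreducible[OF IrrD(1)[OF p]] by blast
    \<comment> \<open>\<open>t\<close> is invertible modulo \<open>p\<close>, so a vanishing pairing with \<open>u w\<close> gives one with \<open>w\<close>.\<close>
    have mixed: "b v (P (p ^ (k - 1)) w) = 0"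
      if v: "v \<in> U" "s v = scale c v" and w: "w \<in> U" "s w = scale (- c) w" and c: "c = 1 \<or> c = - 1" for v w c
    proof -
      have "s (u w) = - u (s w)" using s by (simp add: skew_involution_def)
      then have "s (u w) = scale c (u w)" using w(2) c by (auto simp: u_linear)
      moreover have "u w \<in> U" using U_P[OF w(1), of "[:0, 1:]"] by simp
      ultimately have "b v (P (p ^ (k - 1) * \<alpha>) (u w)) = 0" using v c by (intro same) auto
      then have 1: "b v (P (p ^ (k - 1) * \<alpha> * [:0, 1:]) w) = 0" by (simp only: P_mult P_X)
      have "p ^ (k - 1) = p ^ (k - 1) * (\<alpha> * [:0, 1:] + \<beta> * p)" by (simp only: ab mult_1_right)
      also have "\<dots> = p ^ (k - 1) * \<alpha> * [:0, 1:] + p ^ (k - 1) * p * \<beta>" by (simp only: algebra_simps)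
      also have "p ^ (k - 1) * p = p ^ k" using k by (simp add: power_eq_if mult.commute)
      finally have eq: "p ^ (k - 1) = p ^ (k - 1) * \<alpha> * [:0, 1:] + p ^ k * \<beta>" .
      have "b v (P (p ^ k * \<beta>) w) = 0" using w by (intro cyclic_form_vanishes) (simp add: U_def)
      then show ?thesis by (subst eq) (simp only: P_add b_right 1 add_0)
    qed
    have yU: "y \<in> U" and zU: "z \<in> U" using y z by (simp_all add: U_def)
    define e where "e w c = w + scale c (s w)" for w c
    have eU: "e w 1 \<in> U" "e w (- 1) \<in> U" if "w \<in> U" for w
      using that U_s[OF that] U_add[of w "s w"] U_diff[of w "s w"] by (simp_all add: e_def)
    have se: "s (e w 1) = scale 1 (e w 1)" "s (e w (- 1)) = scale (- 1) (e w (- 1))" for w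
      by (simp_all add: e_def sD)
    have "e w 1 + e w (- 1) = scale 2 w" for w
      using scale_left_distrib[of 1 1 w] by (simp add: e_def)
    then have "2 * 2 * b y (P (p ^ (k - 1)) z)
        = b (e y 1 + e y (- 1)) (P (p ^ (k - 1)) (e z 1 + e z (- 1)))"
      by (simp add: P_right b_right b_left)
    also have "\<dots> = 0"
      using same[OF eU(1)[OF yU] eU(1)[OF zU] se(1) se(1), of "p ^ (k - 1)"]
        same[OF eU(2)[OF yU] eU(2)[OF zU] se(2) se(2), of "p ^ (k - 1)"]
        mixed[OF eU(1)[OF yU] se(1) eU(2)[OF zU]] mixed[OF eU(2)[OF yU] se(2) eU(1)[OF zU]] se
      by (simp add: P_right b_right b_left)
    finally have "2 = (0::'a) \<or> b y (P (p ^ (k - 1)) z) = 0" by (simp only: mult_eq_0_iff) blast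
    then show False using two z(3) by blast
  qed
qed

section \<open>The quotient spaces as records\<close>

definition ker_cls :: "'a poly \<Rightarrow> nat \<Rightarrow> 'v \<Rightarrow> 'v set" where
  "ker_cls p k x = {y. y - x \<in> N p k}"

lemma ker_cls_eq_iff: "ker_cls p k x = ker_cls p k y \<longleftrightarrow> x - y \<in> N p k"
proof
  assume "ker_cls p k x = ker_cls p k y"
  moreover have "x \<in> ker_cls p k x" by (simp add: ker_cls_def)
  ultimately have "x \<in> ker_cls p k y" by simp
  then show "x - y \<in> N p k" by (simp add: ker_cls_def)
next
  assume xy: "x - y \<in> N p k"
  have "z - x \<in> N p k \<longleftrightarrow> z - y \<in> N p k" for z
    using N_add[OF _ xy, of "z - x"] N_diff[OF _ xy, of "z - y"] by auto
  then show "ker_cls p k x = ker_cls p k y" by (simp add: ker_cls_def)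
qed

lemma mem_ker_cls_self: "x \<in> ker_cls p k x"
  by (simp add: ker_cls_def)

lemma ker_module_coset: "N p k +>\<^bsub>ker_module scale u p k\<^esub> x = ker_cls p k x"
proof (rule Set.set_eqI)
  fix y
  have "y \<in> N p k +>\<^bsub>ker_module scale u p k\<^esub> x \<longleftrightarrow> (\<exists>n\<in>N p k. y = n + x)"
    unfolding a_r_coset_def' by (auto simp: ker_module_def)
  also have "\<dots> \<longleftrightarrow> y - x \<in> N p k" by (metis add_diff_cancel_right' diff_add_cancel)
  finally show "y \<in> N p k +>\<^bsub>ker_module scale u p k\<^esub> x \<longleftrightarrow> y \<in> ker_cls p k x" by (simp add: ker_cls_def)
qed

lemma inv_space_carrier: "carrier (W p k) = ker_cls p k ` K p k"
  unfolding inv_space_def quot_module_def A_RCOSETS_def' ker_module_coset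
  by (auto simp: ker_module_def)

lemma ker_cls_in_carrier [simp]: "x \<in> K p k \<Longrightarrow> ker_cls p k x \<in> carrier (W p k)"
  by (simp add: inv_space_carrier)

lemma inv_space_zero: "\<zero>\<^bsub>W p k\<^esub> = ker_cls p k 0"
  by (simp add: inv_space_def quot_module_def ker_cls_def)

lemma inv_space_add: "ker_cls p k x \<oplus>\<^bsub>W p k\<^esub> ker_cls p k y = ker_cls p k (x + y)"
proof (rule Set.set_eqI)
  fix z
  have "z \<in> ker_cls p k x \<oplus>\<^bsub>W p k\<^esub> ker_cls p k y \<longleftrightarrow> (\<exists>v\<in>ker_cls p k x. \<exists>w\<in>ker_cls p k y. z = v + w)"
    unfolding inv_space_def quot_module_def by (auto simp: set_add_def' ker_module_def)
  also have "\<dots> \<longleftrightarrow> z \<in> ker_cls p k (x + y)"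
  proof
    assume "\<exists>v\<in>ker_cls p k x. \<exists>w\<in>ker_cls p k y. z = v + w"
    then obtain v w where "v - x \<in> N p k" "w - y \<in> N p k" "z = v + w" by (auto simp: ker_cls_def)
    then show "z \<in> ker_cls p k (x + y)" using N_add[of "v - x" p k "w - y"] by (simp add: ker_cls_def algebra_simps)
  next
    assume z: "z \<in> ker_cls p k (x + y)"
    then have "z - y \<in> ker_cls p k x" by (simp add: ker_cls_def algebra_simps)
    then show "\<exists>v\<in>ker_cls p k x. \<exists>w\<in>ker_cls p k y. z = v + w"
      by (intro bexI[of _ "z - y"] bexI[of _ y]) (simp_all add: mem_ker_cls_self)
  qed
  finally show "z \<in> ker_cls p k x \<oplus>\<^bsub>W p k\<^esub> ker_cls p k y \<longleftrightarrow> z \<in> ker_cls p k (x + y)" .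
qed

lemma inv_space_smult:
  assumes x: "x \<in> K p k"
  shows "cls p r \<odot>\<^bsub>W p k\<^esub> ker_cls p k x = ker_cls p k (P r x)"
proof -
  have "ker_cls p k (P r' x') = ker_cls p k (P r x)" if r': "r' \<in> cls p r" and x': "x' \<in> ker_cls p k x" for r' x'
  proof -
    have d: "x' - x \<in> N p k" using x' by (simp add: ker_cls_def)
    then have "x' \<in> K p k" using K_add[OF N_subset_K[OF d] x] by simp
    then have "P (r' - r) x' \<in> N p k" using r' by (intro N_of_dvd) (simp_all add: cls_def)
    from N_add[OF this N_P[OF d, of r]] show ?thesis by (simp add: ker_cls_eq_iff P_diff P_right)
  qed
  moreover have "r \<in> cls p r" "x \<in> ker_cls p k x" by (simp_all add: cls_def mem_ker_cls_self)
  ultimately have "(\<Union>r'\<in>cls p r. \<Union>x'\<in>ker_cls p k x. ker_cls p k (P r' x')) = ker_cls p k (P r x)" by blast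
  then show ?thesis unfolding inv_space_def quot_module_def ker_module_coset
    by (simp add: ker_module_def)
qed

lemma inv_space_abelian_group: "abelian_group (W p k)"
proof (rule abelian_groupI)
  fix A assume "A \<in> carrier (W p k)"
  then obtain x where x: "x \<in> K p k" "A = ker_cls p k x" by (auto simp: inv_space_carrier)
  then show "\<exists>B\<in>carrier (W p k). B \<oplus>\<^bsub>W p k\<^esub> A = \<zero>\<^bsub>W p k\<^esub>"
    by (intro bexI[of _ "ker_cls p k (- x)"]) (simp_all add: inv_space_add inv_space_zero K_uminus)
qed (auto simp: inv_space_carrier inv_space_add inv_space_zero K_add add_ac image_iff)

lemma inv_space_vectorspace:
  assumes p: "p \<in> Irr"
  shows "vectorspace (res_field p) (W p k)"
proof -
  have "Module.module (res_field p) (W p k)"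
  proof (rule Module.moduleI)
    show "cring (res_field p)" by (rule res_field_cring)
    show "abelian_group (W p k)" by (rule inv_space_abelian_group)
  qed (auto simp: res_field_carrier inv_space_carrier inv_space_smult inv_space_add res_field_add
      res_field_mult res_field_one K_P K_add P_add P_mult P_right)
  then show ?thesis using res_field_field[OF p] by (simp add: vectorspace_def)
qed

lemma inv_space_finsum:
  assumes "finite S" and "\<And>i. i \<in> S \<Longrightarrow> f i \<in> K p k"
  shows "finsum (W p k) (\<lambda>i. ker_cls p k (f i)) S = ker_cls p k (sum f S)"
  using assms
proof (induction S rule: finite_induct)
  case empty
  interpret abelian_group "W p k" by (rule inv_space_abelian_group)
  show ?case by (simp add: inv_space_zero)
next
  case (insert i S)
  interpret abelian_group "W p k" by (rule inv_space_abelian_group)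
  show ?case using insert by (subst finsum_insert) (auto simp: inv_space_add)
qed

section \<open>The quadratic invariants on representatives\<close>

lemma induced_form_ker_cls:
  assumes k: "k \<ge> 1" and "x \<in> K p k" "y \<in> K p k"
  shows "induced_form scale b u p k (ker_cls p k x) (ker_cls p k y) = b x (P (p ^ (k - 1)) y)"
  unfolding induced_form_def P_funpow
proof (rule the_equality)
  show "\<forall>x'\<in>ker_cls p k x. \<forall>y'\<in>ker_cls p k y. b x' (P (p ^ (k - 1)) y') = b x (P (p ^ (k - 1)) y)"
  proof (intro ballI)
    fix x' y' assume "x' \<in> ker_cls p k x" "y' \<in> ker_cls p k y"
    then have "x' - x \<in> N p k" "y' - y \<in> N p k" by (simp_all add: ker_cls_def)
    then show "b x' (P (p ^ (k - 1)) y') = b x (P (p ^ (k - 1)) y)"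
      by (rule residual_form_cong[OF k dvd_refl assms(2,3)])
  qed
  show "c = b x (P (p ^ (k - 1)) y)"
    if c: "\<forall>x'\<in>ker_cls p k x. \<forall>y'\<in>ker_cls p k y. b x' (P (p ^ (k - 1)) y') = c" for c
    by (rule c[rule_format, OF mem_ker_cls_self mem_ker_cls_self, symmetric])
qed

lemma quad_invariant_ker_cls:
  assumes p: "p \<in> Irr" and k: "k \<ge> 1" and x: "x \<in> K p k" and y: "y \<in> K p k"
  shows "\<exists>c. C p k (ker_cls p k x) (ker_cls p k y) = cls p c \<and>
    (\<forall>r. b x (P (p ^ (k - 1) * r) y) = coeff ((r * c) mod p) 0)"
proof -
  have "poly_linear (\<lambda>r. b x (P (p ^ (k - 1) * r) y))"
    by (simp add: poly_linear_def distrib_left P_add P_smult b_right)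
  moreover have "b x (P (p ^ (k - 1) * (p * r)) y) = 0" for r
  proof -
    have "p ^ (k - 1) * (p * r) = p ^ k * r" using k by (simp add: power_eq_if mult_ac)
    then show ?thesis by (simp only: cyclic_form_vanishes(2)[OF y])
  qed
  ultimately obtain c where c: "\<And>r. b x (P (p ^ (k - 1) * r) y) = coeff ((r * c) mod p) 0"
    using e_form_representation[OF p, of "\<lambda>r. b x (P (p ^ (k - 1) * r) y)"] by blast
  have form: "induced_form scale b u p k (ker_cls p k x) (cls p r \<odot>\<^bsub>W p k\<^esub> ker_cls p k y)
      = coeff ((r * c) mod p) 0" for r
    using x y by (simp add: inv_space_smult induced_form_ker_cls[OF k] K_P flip: P_mult c)
  have "C p k (ker_cls p k x) (ker_cls p k y) = cls p c"
    unfolding quad_invariant_def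
  proof (rule the_equality)
    show "cls p c \<in> carrier (res_field p) \<and> (\<forall>\<Lambda>\<in>carrier (res_field p).
        induced_form scale b u p k (ker_cls p k x) (\<Lambda> \<odot>\<^bsub>W p k\<^esub> ker_cls p k y)
          = e_form p (\<Lambda> \<otimes>\<^bsub>res_field p\<^esub> cls p c))"
      by (auto simp: res_field_carrier form res_field_mult e_form_cls)
  next
    fix z assume z: "z \<in> carrier (res_field p) \<and> (\<forall>\<Lambda>\<in>carrier (res_field p).
        induced_form scale b u p k (ker_cls p k x) (\<Lambda> \<odot>\<^bsub>W p k\<^esub> ker_cls p k y)
          = e_form p (\<Lambda> \<otimes>\<^bsub>res_field p\<^esub> z))"
    then obtain c' where c': "z = cls p c'" by (auto simp: res_field_carrier)
    have "coeff ((r * c) mod p) 0 = coeff ((r * c') mod p) 0" for r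
      using z form[of r] by (simp add: c' res_field_mult e_form_cls)
    then have "coeff ((r * (c' - c)) mod p) 0 = 0" for r
      by (simp add: right_diff_distrib poly_mod_diff_left)
    then show "z = cls p c" unfolding c' cls_eq_iff by (rule e_form_nondegenerate[OF p])
  qed
  with c show ?thesis by blast
qed

lemma quad_invariant_eq_cls_iff:
  assumes p: "p \<in> Irr" and k: "k \<ge> 1" and x: "x \<in> K p k" and y: "y \<in> K p k"
  shows "C p k (ker_cls p k x) (ker_cls p k y) = cls p c \<longleftrightarrow>
    (\<forall>r. b x (P (p ^ (k - 1) * r) y) = coeff ((r * c) mod p) 0)"
proof -
  obtain c0 where c0: "C p k (ker_cls p k x) (ker_cls p k y) = cls p c0"
    "\<And>r. b x (P (p ^ (k - 1) * r) y) = coeff ((r * c0) mod p) 0"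
    using quad_invariant_ker_cls[OF assms] by blast
  show ?thesis
  proof
    assume "C p k (ker_cls p k x) (ker_cls p k y) = cls p c"
    then have dvd: "p dvd c0 - c" using c0(1) cls_eq_iff by metis
    have "(r * c0) mod p = (r * c) mod p" for r
      unfolding mod_eq_dvd_iff using dvd by (simp flip: right_diff_distrib)
    then show "\<forall>r. b x (P (p ^ (k - 1) * r) y) = coeff ((r * c) mod p) 0" using c0(2) by simp
  next
    assume "\<forall>r. b x (P (p ^ (k - 1) * r) y) = coeff ((r * c) mod p) 0"
    then have "coeff ((r * (c0 - c)) mod p) 0 = 0" for r
      using c0(2)[of r] by (simp add: right_diff_distrib poly_mod_diff_left)
    then have "p dvd c0 - c" by (rule e_form_nondegenerate[OF p])
    then show "C p k (ker_cls p k x) (ker_cls p k y) = cls p c"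
      using c0(1) cls_eq_iff by metis
  qed
qed

text \<open>Comparing invariants of \<open>p\<close> and \<open>p^op\<close>: with the sign that the reflection produces on
  \<open>p^(k-1)\<close>, the comparison becomes sign-free on representatives.\<close>
lemma quad_invariant_opposite_iff:
  assumes p: "p \<in> Irr" and k: "k \<ge> 1" and x: "x \<in> K p k" and y: "y \<in> K p k"
    and x': "x' \<in> K (op_poly p) k" and y': "y' \<in> K (op_poly p) k"
  shows "((\<ominus>\<^bsub>res_field p\<^esub> \<one>\<^bsub>res_field p\<^esub>) [^]\<^bsub>res_field p\<^esub> (1 + (k - 1) * degree p))
      \<otimes>\<^bsub>res_field p\<^esub> res_refl (C (op_poly p) k (ker_cls (op_poly p) k x') (ker_cls (op_poly p) k y'))
      = C p k (ker_cls p k x) (ker_cls p k y)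
    \<longleftrightarrow> (\<forall>s. p ^ (k - 1) dvd s \<longrightarrow> b x' (P (subst_neg s) y') = - b x (P s y))"
proof -
  let ?\<epsilon> = "((- 1) ^ degree p) ^ (k - 1) :: 'a"
  have \<epsilon>\<epsilon>: "?\<epsilon> * ?\<epsilon> = 1" by (simp flip: power_mult_distrib)
  obtain c' where c': "C (op_poly p) k (ker_cls (op_poly p) k x') (ker_cls (op_poly p) k y') = cls (op_poly p) c'"
    "\<And>r. b x' (P (op_poly p ^ (k - 1) * r) y') = coeff ((r * c') mod op_poly p) 0"
    using quad_invariant_ker_cls[OF op_poly_Irr[OF p] k x' y'] by blast
  have pow: "(- 1) ^ (1 + (k - 1) * degree p) = [:- ?\<epsilon>:]"
  proof -
    have "- 1 = [:- 1 :: 'a:]" by (simp only: one_pCons minus_pCons minus_zero)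
    then have "(- 1) ^ n = [:(- 1) ^ n :: 'a:]" for n by (simp only: poly_const_pow)
    then have "(- 1) ^ (1 + (k - 1) * degree p) = [:(- 1) ^ (1 + (k - 1) * degree p) :: 'a:]" .
    also have "(- 1) ^ (1 + (k - 1) * degree p) = - ?\<epsilon>"
      by (simp only: power_add power_one_right mult.commute[of "k - 1"] power_mult mult_minus1)
    finally show ?thesis .
  qed
  have lhs: "((\<ominus>\<^bsub>res_field p\<^esub> \<one>\<^bsub>res_field p\<^esub>) [^]\<^bsub>res_field p\<^esub> (1 + (k - 1) * degree p))
      \<otimes>\<^bsub>res_field p\<^esub> res_refl (cls (op_poly p) c')
      = cls p (Polynomial.smult (- ?\<epsilon>) (subst_neg c'))"
    unfolding res_field_one res_field_uminus res_field_power pow res_refl_cls res_field_mult by simp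
  have refl_form: "b x' (P (subst_neg (p ^ (k - 1) * r)) y') = ?\<epsilon> * coeff ((r * subst_neg c') mod p) 0" for r
  proof -
    have "subst_neg (p ^ (k - 1)) = Polynomial.smult ?\<epsilon> (op_poly p ^ (k - 1))"
      by (simp add: op_poly_eq smult_power flip: power_mult_distrib)
    then have "b x' (P (subst_neg (p ^ (k - 1) * r)) y') = ?\<epsilon> * b x' (P (op_poly p ^ (k - 1) * subst_neg r) y')"
      by (simp add: P_smult b_right)
    also have "\<dots> = ?\<epsilon> * coeff ((subst_neg r * c') mod op_poly p) 0" by (simp only: c'(2))
    also have "coeff ((subst_neg r * c') mod op_poly p) 0 = coeff (subst_neg ((subst_neg r * c') mod op_poly p)) 0"
      by simp
    also have "subst_neg ((subst_neg r * c') mod op_poly p) = (r * subst_neg c') mod subst_neg (op_poly p)"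
      by (simp add: subst_neg_mod)
    also have "subst_neg (op_poly p) = Polynomial.smult ((- 1) ^ degree p) p" by (simp add: op_poly_eq)
    also have "(r * subst_neg c') mod Polynomial.smult ((- 1) ^ degree p) p = (r * subst_neg c') mod p"
      by (simp add: mod_smult_right)
    finally show ?thesis .
  qed
  have "C p k (ker_cls p k x) (ker_cls p k y) = cls p (Polynomial.smult (- ?\<epsilon>) (subst_neg c'))
      \<longleftrightarrow> (\<forall>r. b x (P (p ^ (k - 1) * r) y) = - (?\<epsilon> * coeff ((r * subst_neg c') mod p) 0))"
    unfolding quad_invariant_eq_cls_iff[OF p k x y] by (simp add: mod_smult_left del: One_nat_def)
  also have "\<dots> \<longleftrightarrow> (\<forall>r. b x' (P (subst_neg (p ^ (k - 1) * r)) y') = - b x (P (p ^ (k - 1) * r) y))"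
    unfolding refl_form by (metis minus_minus)
  also have "\<dots> \<longleftrightarrow> (\<forall>s. p ^ (k - 1) dvd s \<longrightarrow> b x' (P (subst_neg s) y') = - b x (P s y))"
    by (metis dvdE dvd_triv_left)
  finally show ?thesis unfolding c'(1) lhs by (simp only: eq_commute)
qed

section \<open>Residual bases and the quotient spaces\<close>

lemma skew_value_iff:
  assumes p0: "p \<in> Irr0" and k: "k \<ge> 1" and x: "x \<in> K p k"
  shows "res_refl (C p k (ker_cls p k x) (ker_cls p k x))
      = \<ominus>\<^bsub>res_field p\<^esub> C p k (ker_cls p k x) (ker_cls p k x)
    \<longleftrightarrow> (\<forall>s. p ^ (k - 1) dvd s \<longrightarrow> b x (P (subst_neg s) x) = - b x (P s x))"
proof -
  have p: "p \<in> Irr" and op: "op_poly p = p" and ev: "even (degree p)" using Irr0_imp[OF p0] by auto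
  obtain c where c: "C p k (ker_cls p k x) (ker_cls p k x) = cls p c"
    using quad_invariant_ker_cls[OF p k x x] by blast
  have "(- 1) ^ (1 + (k - 1) * degree p) = (- 1 :: 'a poly)" using ev by simp
  then have "((\<ominus>\<^bsub>res_field p\<^esub> \<one>\<^bsub>res_field p\<^esub>) [^]\<^bsub>res_field p\<^esub> (1 + (k - 1) * degree p))
      \<otimes>\<^bsub>res_field p\<^esub> res_refl (cls p c) = cls p (- subst_neg c)"
    unfolding res_field_one res_field_uminus res_field_power
    by (simp add: res_refl_cls' op res_field_mult)
  moreover have "res_refl (cls p c) = \<ominus>\<^bsub>res_field p\<^esub> cls p c \<longleftrightarrow> cls p (- subst_neg c) = cls p c"
    by (simp add: res_refl_cls' op res_field_uminus cls_eq_iff)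
      (metis add.commute add_uminus_conv_diff dvd_minus_iff minus_add_distrib minus_minus)
  ultimately show ?thesis
    using quad_invariant_opposite_iff[OF p k x x, of x x] x unfolding op c by simp
qed

lemma polar_zero_iff:
  assumes two: "(2::'a) \<noteq> 0" and p: "p \<in> Irr" and k: "k \<ge> 1" and x: "x \<in> K p k" and y: "y \<in> K p k"
  shows "attached_quadratic_form (C p k) (ker_cls p k x \<oplus>\<^bsub>W p k\<^esub> ker_cls p k y)
      \<ominus>\<^bsub>res_field p\<^esub> attached_quadratic_form (C p k) (ker_cls p k x)
      \<ominus>\<^bsub>res_field p\<^esub> attached_quadratic_form (C p k) (ker_cls p k y) = \<zero>\<^bsub>res_field p\<^esub>
    \<longleftrightarrow> res_orth p k x y"
proof -
  let ?Q = "\<lambda>z. C p k (ker_cls p k z) (ker_cls p k z)"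
  obtain cx where cx: "?Q x = cls p cx" "\<And>r. b x (P (p ^ (k - 1) * r) x) = coeff ((r * cx) mod p) 0"
    using quad_invariant_ker_cls[OF p k x x] by blast
  obtain cy where cy: "?Q y = cls p cy" "\<And>r. b y (P (p ^ (k - 1) * r) y) = coeff ((r * cy) mod p) 0"
    using quad_invariant_ker_cls[OF p k y y] by blast
  have xy: "x + y \<in> K p k" using x y by (rule K_add)
  obtain c where c: "?Q (x + y) = cls p c" using quad_invariant_ker_cls[OF p k xy xy] by blast
  have "?Q (x + y) = cls p (cx + cy)
      \<longleftrightarrow> (\<forall>r. b (x + y) (P (p ^ (k - 1) * r) (x + y)) = coeff ((r * (cx + cy)) mod p) 0)"
    by (rule quad_invariant_eq_cls_iff[OF p k xy xy])
  also have "\<dots> \<longleftrightarrow> (\<forall>r. 2 * b x (P (p ^ (k - 1) * r) y) = 0)"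
  proof (intro all_cong1)
    fix r
    have "b (x + y) (P (p ^ (k - 1) * r) (x + y))
        = coeff ((r * (cx + cy)) mod p) 0 + 2 * b x (P (p ^ (k - 1) * r) y)"
      using b_P_swap[of y "p ^ (k - 1) * r" x]
      by (simp only: b_left b_right P_right cx(2) cy(2) distrib_left poly_mod_add_left coeff_add) simp
    then show "(b (x + y) (P (p ^ (k - 1) * r) (x + y)) = coeff ((r * (cx + cy)) mod p) 0)
        = (2 * b x (P (p ^ (k - 1) * r) y) = 0)" by simp
  qed
  also have "\<dots> \<longleftrightarrow> (\<forall>r. b x (P (p ^ (k - 1) * r) y) = 0)" using two by simp
  also have "\<dots> \<longleftrightarrow> res_orth p k x y" unfolding res_orth_def by (metis dvdE dvd_triv_left)
  finally have "cls p c = cls p (cx + cy) \<longleftrightarrow> res_orth p k x y" using c by simp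
  then show ?thesis
    by (simp add: attached_quadratic_form_def inv_space_add c cx(1) cy(1) res_field_minus res_field_zero
        cls_eq_iff diff_diff_eq)
qed

lemma lincomb_ker_cls:
  assumes p: "p \<in> Irr" and "finite S" and S: "\<And>x. x \<in> S \<Longrightarrow> x \<in> K p k" and inj: "inj_on (ker_cls p k) S"
    and a: "\<And>x. x \<in> S \<Longrightarrow> a (ker_cls p k x) = cls p (r x)"
  shows "LinearCombinations.module.lincomb (W p k) a (ker_cls p k ` S)
    = ker_cls p k (\<Sum>x\<in>S. P (r x) x)"
proof -
  interpret V: vectorspace "res_field p" "W p k" by (rule inv_space_vectorspace[OF p])
  have "V.lincomb a (ker_cls p k ` S)
      = finsum (W p k) (\<lambda>x. a (ker_cls p k x) \<odot>\<^bsub>W p k\<^esub> ker_cls p k x) S"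
    unfolding V.lincomb_def
    by (rule V.finsum_reindex) (use S a inj in \<open>auto simp: inv_space_smult K_P\<close>)
  also have "\<dots> = finsum (W p k) (\<lambda>x. ker_cls p k (P (r x) x)) S"
    by (rule V.finsum_cong') (use S a in \<open>auto simp: inv_space_smult K_P\<close>)
  also have "\<dots> = ker_cls p k (\<Sum>x\<in>S. P (r x) x)"
    by (rule inv_space_finsum[OF \<open>finite S\<close>]) (use S in \<open>auto intro: K_P\<close>)
  finally show ?thesis .
qed

text \<open>Representatives of an orthogonal basis are regular: a representative orthogonal to itself would
  be in the radical, so its class would be zero.\<close>
lemma skew_residual_basis_of_skew_representable:
  assumes two: "(2::'a) \<noteq> 0" and p0: "p \<in> Irr0" and k: "k \<ge> 1"
    and rep: "skew_representable (res_field p) res_refl (W p k)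
            (attached_quadratic_form (C p k))"
  shows "\<exists>S. res_orth_set p k S \<and> (\<forall>z\<in>K p k. \<exists>r. z - (\<Sum>x\<in>S. P (r x) x) \<in> N p k) \<and>
    (\<forall>x\<in>S. \<forall>s. p ^ (k - 1) dvd s \<longrightarrow> b x (P (subst_neg s) x) = - b x (P s x))"
proof -
  have p: "p \<in> Irr" using Irr0_imp[OF p0] by simp
  interpret V: vectorspace "res_field p" "W p k" by (rule inv_space_vectorspace[OF p])
  obtain E where E: "finite E" "V.basis E"
    and polar: "\<forall>A\<in>E. \<forall>B\<in>E. A \<noteq> B \<longrightarrow>
      attached_quadratic_form (C p k) (A \<oplus>\<^bsub>W p k\<^esub> B)
      \<ominus>\<^bsub>res_field p\<^esub> attached_quadratic_form (C p k) A
      \<ominus>\<^bsub>res_field p\<^esub> attached_quadratic_form (C p k) B = \<zero>\<^bsub>res_field p\<^esub>"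
    and skew: "\<forall>A\<in>E. res_refl (attached_quadratic_form (C p k) A)
      = \<ominus>\<^bsub>res_field p\<^esub> attached_quadratic_form (C p k) A"
    using rep unfolding skew_representable_def by (elim exE conjE) (rule that)
  have EV: "E \<subseteq> carrier (W p k)" and indep: "V.lin_indpt E"
    and gen: "V.span E = carrier (W p k)"
    using E(2) by (auto simp: V.basis_def)
  have "\<forall>A\<in>E. \<exists>x. x \<in> K p k \<and> A = ker_cls p k x" using EV by (auto simp: inv_space_carrier)
  then obtain x where x: "\<And>A. A \<in> E \<Longrightarrow> x A \<in> K p k" "\<And>A. A \<in> E \<Longrightarrow> A = ker_cls p k (x A)" by metis
  define S where "S = x ` E"
  have ES: "E = ker_cls p k ` S" unfolding S_def image_image using x(2) by (auto simp: image_iff)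
  have inj: "inj_on (ker_cls p k) S" unfolding S_def by (rule inj_onI) (use x(2) in force)
  have SK: "y \<in> K p k" if "y \<in> S" for y using that x(1) unfolding S_def by blast
  have SE: "ker_cls p k y \<in> E" if "y \<in> S" for y unfolding ES using that by (rule imageI)
  have finS: "finite S" unfolding S_def using E(1) by simp
  have orth: "res_orth p k y z" if "y \<in> S" "z \<in> S" "y \<noteq> z" for y z
  proof -
    have "ker_cls p k y \<noteq> ker_cls p k z" using inj that by (meson inj_onD)
    then show ?thesis
      using polar_zero_iff[OF two p k SK SK, OF that(1,2)] polar[rule_format, OF SE SE, OF that(1,2)] by blast
  qed
  have span: "\<exists>r. z - (\<Sum>y\<in>S. P (r y) y) \<in> N p k" if z: "z \<in> K p k" for z
  proof -
    have "ker_cls p k z \<in> V.span E" unfolding gen using z by simp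
    then obtain a where a: "a \<in> E \<rightarrow> carrier (res_field p)" "ker_cls p k z = V.lincomb a E"
      using V.finite_span[OF E(1) EV] by blast
    have "\<exists>r. a (ker_cls p k y) = cls p r" if "y \<in> S" for y
      using funcset_mem[OF a(1) SE[OF that]] by (auto simp: res_field_carrier)
    then obtain r where r: "\<And>y. y \<in> S \<Longrightarrow> a (ker_cls p k y) = cls p (r y)" by metis
    have "ker_cls p k z = ker_cls p k (\<Sum>y\<in>S. P (r y) y)"
      unfolding a(2) ES by (rule lincomb_ker_cls[where a = a and r = r, OF p finS SK inj r])
    then show ?thesis by (auto simp: ker_cls_eq_iff)
  qed
  have regular: "regular_gen p k y" if y: "y \<in> S" for y
  proof (rule ccontr)
    assume not: "\<not> regular_gen p k y"
    have self: "res_orth p k y y"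
      unfolding res_orth_def using regular_genI[OF p k SK[OF y]] not by blast
    have "y \<in> N p k"
    proof (rule residual_nondegenerate[OF k SK[OF y]])
      fix z assume z: "z \<in> K p k"
      obtain r where r: "z - (\<Sum>y\<in>S. P (r y) y) \<in> N p k" using span[OF z] by blast
      have "res_orth p k y (\<Sum>y\<in>S. P (r y) y)"
        using self orth y by (intro res_orth_sum res_orth_P) metis
      then have "b y (P (p ^ (k - 1)) (\<Sum>y\<in>S. P (r y) y)) = 0" by (simp add: res_orth_def)
      moreover have "b (z - (\<Sum>y\<in>S. P (r y) y)) (P (p ^ (k - 1)) y) = 0"
        by (rule N_form_left[OF k r SK[OF y] dvd_refl])
      ultimately show "b y (P (p ^ (k - 1)) z) = 0"
        by (simp only: b_left P_selfadjoint b_P_swap[of y]) simp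
    qed
    then have "ker_cls p k y = \<zero>\<^bsub>W p k\<^esub>" by (simp add: inv_space_zero ker_cls_eq_iff)
    then show False using V.vs_zero_lin_dep[OF EV indep] SE[OF y] by simp
  qed
  have "b y (P (subst_neg s) y) = - b y (P s y)" if "y \<in> S" "p ^ (k - 1) dvd s" for y s
    using skew_value_iff[OF p0 k SK[OF that(1)]] skew[rule_format, OF SE[OF that(1)]] that(2)
    by (simp add: attached_quadratic_form_def)
  then show ?thesis using finS orth regular span by (intro exI[of _ S]) (auto simp: res_orth_set_def)
qed

lemma ker_cls_inj_on_res_orth_set:
  assumes k: "k \<ge> 1" and S: "res_orth_set p k S"
  shows "inj_on (ker_cls p k) S"
proof (rule inj_onI, rule ccontr)
  fix x y assume xy: "x \<in> S" "y \<in> S" "ker_cls p k x = ker_cls p k y" "x \<noteq> y"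
  have x: "regular_gen p k x" and "res_orth p k x y" using S xy by (auto simp: res_orth_set_def)
  have "x - y \<in> N p k" using xy(3) by (simp add: ker_cls_eq_iff)
  moreover have xK: "x \<in> K p k" using x by (simp add: regular_gen_def)
  ultimately have "b (x - y) (P s x) = 0" if "p ^ (k - 1) dvd s" for s
    using N_form_left[OF k] that by blast
  then have "res_orth p k x x" using \<open>res_orth p k x y\<close>
    by (simp add: res_orth_def b_left b_P_swap[of y])
  then show False using regular_gen_not_self_orth[OF x] by contradiction
qed

text \<open>In a linear relation, pairing with one member isolates its coefficient \<open>r\<close>, and regularity of the
  member then gives \<open>p dvd r\<close>.\<close>
lemma res_orth_set_basis:
  assumes p: "p \<in> Irr" and k: "k \<ge> 1" and S: "res_orth_set p k S"
    and span: "\<And>z. z \<in> K p k \<Longrightarrow> \<exists>r. z - (\<Sum>x\<in>S. P (r x) x) \<in> N p k"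
  shows "vectorspace.basis (res_field p) (W p k) (ker_cls p k ` S)"
proof -
  interpret V: vectorspace "res_field p" "W p k" by (rule inv_space_vectorspace[OF p])
  have finS: "finite S" and reg: "\<And>x. x \<in> S \<Longrightarrow> regular_gen p k x" using S by (auto simp: res_orth_set_def)
  have SK: "x \<in> K p k" if "x \<in> S" for x using reg[OF that] by (simp add: regular_gen_def)
  have inj: "inj_on (ker_cls p k) S" by (rule ker_cls_inj_on_res_orth_set[OF k S])
  have sub: "ker_cls p k ` S \<subseteq> carrier (W p k)" using SK by auto
  have "V.span (ker_cls p k ` S) = carrier (W p k)"
  proof
    show "V.span (ker_cls p k ` S) \<subseteq> carrier (W p k)" using V.span_is_subset2[OF sub] .
    show "carrier (W p k) \<subseteq> V.span (ker_cls p k ` S)"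
    proof
      fix A assume "A \<in> carrier (W p k)"
      then obtain z where z: "z \<in> K p k" "A = ker_cls p k z" by (auto simp: inv_space_carrier)
      obtain r where r: "z - (\<Sum>x\<in>S. P (r x) x) \<in> N p k" using span[OF z(1)] by blast
      define a where "a B = cls p (r (inv_into S (ker_cls p k) B))" for B
      have "V.lincomb a (ker_cls p k ` S) = ker_cls p k (\<Sum>x\<in>S. P (r x) x)"
        by (rule lincomb_ker_cls[where a = a and r = r, OF p finS SK inj]) (simp_all add: a_def inv_into_f_f[OF inj])
      also have "\<dots> = A" using r z(2) by (metis ker_cls_eq_iff)
      finally have "A = V.lincomb a (ker_cls p k ` S)" by simp
      moreover have "a \<in> ker_cls p k ` S \<rightarrow> carrier (res_field p)" by (simp add: a_def)
      ultimately show "A \<in> V.span (ker_cls p k ` S)" unfolding V.span_def using finS by blast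
    qed
  qed
  moreover have "V.lin_indpt (ker_cls p k ` S)"
  proof
    assume "V.lin_dep (ker_cls p k ` S)"
    then obtain A a v where A: "finite A" "A \<subseteq> ker_cls p k ` S" "a \<in> A \<rightarrow> carrier (res_field p)"
      "V.lincomb a A = \<zero>\<^bsub>W p k\<^esub>" "v \<in> A" "a v \<noteq> \<zero>\<^bsub>res_field p\<^esub>"
      unfolding V.lin_dep_def by blast
    define S' where "S' = {x \<in> S. ker_cls p k x \<in> A}"
    have AS': "A = ker_cls p k ` S'" using A(2) by (auto simp: S'_def)
    have S'S: "S' \<subseteq> S" by (auto simp: S'_def)
    have finS': "finite S'" using finS S'S finite_subset by blast
    have "\<exists>r. a (ker_cls p k x) = cls p r" if "x \<in> S'" for x
      using funcset_mem[OF A(3), of "ker_cls p k x"] that by (auto simp: AS' res_field_carrier)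
    then obtain r where r: "\<And>x. x \<in> S' \<Longrightarrow> a (ker_cls p k x) = cls p (r x)" by metis
    have "V.lincomb a A = ker_cls p k (\<Sum>x\<in>S'. P (r x) x)"
      unfolding AS'
      by (rule lincomb_ker_cls[where a = a and r = r, OF p finS' _ _ r]) (use S'S SK inj inj_on_subset in blast)+
    then have "ker_cls p k (\<Sum>x\<in>S'. P (r x) x) = ker_cls p k 0" using A(4) by (simp add: inv_space_zero)
    then have inN: "(\<Sum>x\<in>S'. P (r x) x) \<in> N p k" unfolding ker_cls_eq_iff by simp
    obtain y where y: "y \<in> S'" "v = ker_cls p k y" using A(5) AS' by blast
    then have yS: "y \<in> S" using S'S by blast
    have "b y (P (p ^ (k - 1) * (r y * t)) y) = 0" for t
    proof -
      have "0 = b (\<Sum>x\<in>S'. P (r x) x) (P (p ^ (k - 1) * t) y)"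
        using N_form_left[OF k inN SK[OF yS], of "p ^ (k - 1) * t"] by simp
      also have "\<dots> = (\<Sum>x\<in>S'. b x (P (p ^ (k - 1) * (r x * t)) y))"
        by (simp add: b_left P_selfadjoint mult.left_commute flip: P_mult)
      also have "\<dots> = b y (P (p ^ (k - 1) * (r y * t)) y) + (\<Sum>x\<in>S' - {y}. b x (P (p ^ (k - 1) * (r x * t)) y))"
        using finS' y(1) by (rule sum.remove)
      also have "(\<Sum>x\<in>S' - {y}. b x (P (p ^ (k - 1) * (r x * t)) y)) = 0"
      proof (rule sum.neutral, rule ballI)
        fix x assume "x \<in> S' - {y}"
        then have "res_orth p k x y" using S S'S yS by (auto simp: res_orth_set_def)
        then show "b x (P (p ^ (k - 1) * (r x * t)) y) = 0" by (simp add: res_orth_def)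
      qed
      finally show ?thesis by simp
    qed
    then have "cyc_orth (P (p ^ (k - 1) * r y) y) y"
      by (simp add: cyc_orth_def P_selfadjoint mult.assoc flip: P_mult)
    then have "p ^ k dvd p ^ (k - 1) * r y" by (rule cyclic_faithful[OF reg[OF yS]])
    moreover have "p ^ k = p ^ (k - 1) * p" using k by (simp add: power_eq_if mult.commute)
    ultimately have "p dvd r y" using IrrD(3)[OF p] by simp
    then have "a v = \<zero>\<^bsub>res_field p\<^esub>" using r[OF y(1)] y(2) by (simp add: res_field_zero cls_eq_iff)
    then show False using A(6) by contradiction
  qed
  ultimately show ?thesis using sub by (simp add: V.basis_def)
qed

text \<open>On a vector \<open>x\<close> with \<open>s x = x\<close> or \<open>s x = - x\<close>, transport by \<open>s\<close> shows that \<open>r \<mapsto> b x (r(u) x)\<close>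
  changes sign under \<open>t \<mapsto> -t\<close>.\<close>
lemma skew_representable_of_skew_involution:
  assumes two: "(2::'a) \<noteq> 0" and s: "skew_involution s" and p0: "p \<in> Irr0" and k: "k \<ge> 1"
  shows "skew_representable (res_field p) res_refl (W p k)
            (attached_quadratic_form (C p k))"
proof -
  have p: "p \<in> Irr" using Irr0_imp[OF p0] by simp
  obtain S where eig: "\<And>x. x \<in> S \<Longrightarrow> s x = x \<or> s x = - x" and S: "res_orth_set p k S"
    and span: "\<And>z. z \<in> K p k \<Longrightarrow> \<exists>r. z - (\<Sum>x\<in>S. P (r x) x) \<in> N p k"
    using exists_eigen_residual_basis[OF two s p0 k] by blast
  have SK: "x \<in> K p k" if "x \<in> S" for x using S that by (auto simp: res_orth_set_def regular_gen_def)
  show ?thesis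
    unfolding skew_representable_def
  proof (intro exI[of _ "ker_cls p k ` S"] conjI ballI impI)
    show "finite (ker_cls p k ` S)" using S by (simp add: res_orth_set_def)
    show "vectorspace.basis (res_field p) (W p k) (ker_cls p k ` S)"
      by (rule res_orth_set_basis[OF p k S span])
  next
    fix A B assume "A \<in> ker_cls p k ` S" "B \<in> ker_cls p k ` S" "A \<noteq> B"
    then obtain x y where xy: "x \<in> S" "y \<in> S" "x \<noteq> y" "A = ker_cls p k x" "B = ker_cls p k y" by blast
    then have "res_orth p k x y" using S by (auto simp: res_orth_set_def)
    then show "attached_quadratic_form (C p k) (A \<oplus>\<^bsub>W p k\<^esub> B)
      \<ominus>\<^bsub>res_field p\<^esub> attached_quadratic_form (C p k) A
      \<ominus>\<^bsub>res_field p\<^esub> attached_quadratic_form (C p k) B = \<zero>\<^bsub>res_field p\<^esub>"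
      unfolding xy(4,5) polar_zero_iff[OF two p k SK[OF xy(1)] SK[OF xy(2)]] .
  next
    fix A assume "A \<in> ker_cls p k ` S"
    then obtain x where x: "x \<in> S" "A = ker_cls p k x" by blast
    have "b x (P (subst_neg t) x) = - b x (P t x)" for t
    proof -
      have "b (s x) (P (subst_neg t) (s x)) = - b x (P t x)"
        using skew_involutionD(6,7)[OF s] by metis
      then show ?thesis using eig[OF x(1)] by (auto simp: b_left b_right P_right)
    qed
    then show "res_refl (attached_quadratic_form (C p k) A)
      = \<ominus>\<^bsub>res_field p\<^esub> attached_quadratic_form (C p k) A"
      unfolding x(2) attached_quadratic_form_def using skew_value_iff[OF p0 k SK[OF x(1)]] by blast
  qed
qed

text \<open>The equivalence is the direct image of cosets under \<open>s\<close>, which exchanges \<open>p\<close> and \<open>p^op\<close>.\<close>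
lemma equivalent_forms_of_skew_involution:
  assumes s: "skew_involution s" and p: "p \<in> Irr" and k: "k \<ge> 1"
  shows "equivalent_forms (res_field p)
            (W p k)
            (C p k)
            (op_space (W (op_poly p) k))
            (\<lambda>A B. ((\<ominus>\<^bsub>res_field p\<^esub> \<one>\<^bsub>res_field p\<^esub>) [^]\<^bsub>res_field p\<^esub> (1 + (k - 1) * degree p))
               \<otimes>\<^bsub>res_field p\<^esub> op_form (C (op_poly p) k) A B)"
proof -
  note sD = skew_involutionD[OF s]
  have sK: "s x \<in> K (op_poly p) k" if "x \<in> K p k" for x using skew_involution_K[OF s] that by blast
  have sK': "s x \<in> K p k" if "x \<in> K (op_poly p) k" for x
    using skew_involution_K[OF s, of x "op_poly p"] that by simp
  have sN: "s x \<in> N (op_poly p) k \<longleftrightarrow> x \<in> N p k" for x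
    using skew_involution_N[OF s, of x p k] skew_involution_N[OF s, of "s x" "op_poly p" k] sD(5) by auto
  have f: "s ` ker_cls p k x = ker_cls (op_poly p) k (s x)" for x
  proof (rule Set.set_eqI)
    fix y
    have "y \<in> s ` ker_cls p k x \<longleftrightarrow> s y \<in> ker_cls p k x" by (metis image_iff sD(5))
    also have "\<dots> \<longleftrightarrow> s (s y - x) \<in> N (op_poly p) k" unfolding sN by (simp add: ker_cls_def)
    also have "\<dots> \<longleftrightarrow> y \<in> ker_cls (op_poly p) k (s x)" by (simp add: ker_cls_def sD(2,5))
    finally show "y \<in> s ` ker_cls p k x \<longleftrightarrow> y \<in> ker_cls (op_poly p) k (s x)" .
  qed
  have inj: "inj_on ((`) s) (carrier (W p k))"
    by (rule inj_onI) (metis inj_image_eq_iff injI sD(5))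
  have onto: "ker_cls (op_poly p) k y \<in> (`) s ` carrier (W p k)" if y: "y \<in> K (op_poly p) k" for y
  proof -
    have "ker_cls (op_poly p) k y = s ` ker_cls p k (s y)" by (simp add: f sD(5))
    then show ?thesis using sK'[OF y] by (intro image_eqI[of _ _ "ker_cls p k (s y)"]) simp_all
  qed
  show ?thesis
    unfolding equivalent_forms_def
  proof (intro bexI[of _ "(`) s"] conjI ballI)
    show "bij_betw ((`) s) (carrier (W p k)) (carrier (op_space (W (op_poly p) k)))"
      unfolding bij_betw_def
    proof (intro conjI inj equalityI subsetI)
      fix A assume "A \<in> (`) s ` carrier (W p k)"
      then show "A \<in> carrier (op_space (W (op_poly p) k))"
        using sK by (auto simp: op_space_def inv_space_carrier f)
    next
      fix A assume "A \<in> carrier (op_space (W (op_poly p) k))"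
      then show "A \<in> (`) s ` carrier (W p k)"
        using onto by (auto simp: op_space_def inv_space_carrier)
    qed
  next
    fix A B assume "A \<in> carrier (W p k)" "B \<in> carrier (W p k)"
    then obtain x y where xy: "x \<in> K p k" "A = ker_cls p k x" "y \<in> K p k" "B = ker_cls p k y"
      by (auto simp: inv_space_carrier)
    have "b (s x) (P (subst_neg t) (s y)) = - b x (P t y)" for t using sD(6,7) by metis
    then show "((\<ominus>\<^bsub>res_field p\<^esub> \<one>\<^bsub>res_field p\<^esub>) [^]\<^bsub>res_field p\<^esub> (1 + (k - 1) * degree p))
               \<otimes>\<^bsub>res_field p\<^esub> op_form (C (op_poly p) k) (s ` A) (s ` B)
      = C p k A B"
      unfolding xy(2,4) f op_form_def
      using quad_invariant_opposite_iff[OF p k xy(1,3) sK[OF xy(1)] sK[OF xy(3)]] by blast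
  next
    show "(`) s \<in> LinearCombinations.module_hom (res_field p) (W p k)
        (op_space (W (op_poly p) k))"
      unfolding LinearCombinations.module_hom_def
    proof (intro CollectI conjI allI impI)
      show "(`) s \<in> carrier (W p k) \<rightarrow> carrier (op_space (W (op_poly p) k))"
        using sK by (auto simp: op_space_def inv_space_carrier f)
    next
      fix A B assume "A \<in> carrier (W p k) \<and> B \<in> carrier (W p k)"
      then obtain x y where xy: "x \<in> K p k" "A = ker_cls p k x" "y \<in> K p k" "B = ker_cls p k y"
        by (auto simp: inv_space_carrier)
      show "s ` (A \<oplus>\<^bsub>W p k\<^esub> B)
          = s ` A \<oplus>\<^bsub>op_space (W (op_poly p) k)\<^esub> s ` B"
        by (simp add: xy(2,4) f inv_space_add op_space_def sD(1))
    next
      fix \<Lambda> A assume "\<Lambda> \<in> carrier (res_field p) \<and> A \<in> carrier (W p k)"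
      then obtain r x where rx: "\<Lambda> = cls p r" "x \<in> K p k" "A = ker_cls p k x"
        by (auto simp: inv_space_carrier res_field_carrier)
      show "s ` (\<Lambda> \<odot>\<^bsub>W p k\<^esub> A)
          = \<Lambda> \<odot>\<^bsub>op_space (W (op_poly p) k)\<^esub> s ` A"
        by (simp add: rx inv_space_smult f op_space_def res_refl_cls' inv_space_smult[OF sK[OF rx(2)]] sD(6))
    qed
  qed
qed

text \<open>Here \<open>g x\<close> represents the image under the equivalence of the class of \<open>x\<close>, for \<open>x\<close> in a residual
  orthogonal basis.\<close>
lemma opposite_residual_basis_of_equivalent_forms:
  assumes two: "(2::'a) \<noteq> 0" and p: "p \<in> Irr" and k: "k \<ge> 1"
    and eqv: "equivalent_forms (res_field p)
            (W p k)
            (C p k)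
            (op_space (W (op_poly p) k))
            (\<lambda>A B. ((\<ominus>\<^bsub>res_field p\<^esub> \<one>\<^bsub>res_field p\<^esub>) [^]\<^bsub>res_field p\<^esub> (1 + (k - 1) * degree p))
               \<otimes>\<^bsub>res_field p\<^esub> op_form (C (op_poly p) k) A B)"
  shows "\<exists>S g. res_orth_set p k S \<and> (\<forall>z\<in>K p k. \<exists>r. z - (\<Sum>x\<in>S. P (r x) x) \<in> N p k) \<and>
    (\<forall>x\<in>S. g x \<in> K (op_poly p) k) \<and>
    (\<forall>z\<in>K (op_poly p) k. \<exists>r. z - (\<Sum>x\<in>S. P (r x) (g x)) \<in> N (op_poly p) k) \<and>
    (\<forall>x\<in>S. \<forall>y\<in>S. \<forall>s. p ^ (k - 1) dvd s \<longrightarrow> b (g x) (P (subst_neg s) (g y)) = - b x (P s y))"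
proof -
  let ?V = "W p k" and ?W = "W (op_poly p) k"
  obtain S where S: "res_orth_set p k S"
    and span: "\<And>z. z \<in> K p k \<Longrightarrow> \<exists>r. z - (\<Sum>x\<in>S. P (r x) x) \<in> N p k"
    using exists_orthogonal_residual_basis[OF two p k] by blast
  have finS: "finite S" using S by (simp add: res_orth_set_def)
  have SK: "x \<in> K p k" if "x \<in> S" for x using S that by (auto simp: res_orth_set_def regular_gen_def)
  obtain f where hom: "f \<in> LinearCombinations.module_hom (res_field p) ?V (op_space ?W)"
    and bij: "bij_betw f (carrier ?V) (carrier (op_space ?W))"
    and form: "\<forall>A\<in>carrier ?V. \<forall>B\<in>carrier ?V.
      ((\<ominus>\<^bsub>res_field p\<^esub> \<one>\<^bsub>res_field p\<^esub>) [^]\<^bsub>res_field p\<^esub> (1 + (k - 1) * degree p))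
               \<otimes>\<^bsub>res_field p\<^esub> op_form (C (op_poly p) k) (f A) (f B)
      = C p k A B"
    using eqv unfolding equivalent_forms_def by (elim bexE conjE) (rule that)
  have carrier_op: "carrier (op_space ?W) = carrier ?W" by (simp add: op_space_def)
  have f_carrier: "f (ker_cls p k x) \<in> carrier ?W" if "x \<in> K p k" for x
    using bij_betwE[OF bij] that carrier_op by (metis ker_cls_in_carrier)
  have hom_add: "f (A \<oplus>\<^bsub>?V\<^esub> B) = f A \<oplus>\<^bsub>op_space ?W\<^esub> f B"
    if "A \<in> carrier ?V" "B \<in> carrier ?V" for A B
    using hom that by (simp add: LinearCombinations.module_hom_def)
  have hom_smult: "f (\<Lambda> \<odot>\<^bsub>?V\<^esub> A) = \<Lambda> \<odot>\<^bsub>op_space ?W\<^esub> f A"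
    if "\<Lambda> \<in> carrier (res_field p)" "A \<in> carrier ?V" for \<Lambda> A
    using hom that by (simp add: LinearCombinations.module_hom_def)
  have f_add: "f (ker_cls p k (x + y)) = f (ker_cls p k x) \<oplus>\<^bsub>?W\<^esub> f (ker_cls p k y)" if "x \<in> K p k" "y \<in> K p k" for x y
  proof -
    have "f (ker_cls p k x \<oplus>\<^bsub>?V\<^esub> ker_cls p k y) = f (ker_cls p k x) \<oplus>\<^bsub>op_space ?W\<^esub> f (ker_cls p k y)"
      by (rule hom_add[OF ker_cls_in_carrier[OF that(1)] ker_cls_in_carrier[OF that(2)]])
    then show ?thesis by (simp add: inv_space_add op_space_def)
  qed
  have f_smult: "f (ker_cls p k (P r x)) = cls (op_poly p) (subst_neg r) \<odot>\<^bsub>?W\<^esub> f (ker_cls p k x)" if "x \<in> K p k" for r x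
  proof -
    have "f (cls p r \<odot>\<^bsub>?V\<^esub> ker_cls p k x) = cls p r \<odot>\<^bsub>op_space ?W\<^esub> f (ker_cls p k x)"
      by (rule hom_smult[OF cls_in_carrier ker_cls_in_carrier[OF that]])
    then show ?thesis by (simp add: inv_space_smult[OF that] op_space_def res_refl_cls')
  qed
  have "\<exists>y. y \<in> K (op_poly p) k \<and> f (ker_cls p k x) = ker_cls (op_poly p) k y" if "x \<in> S" for x
    using f_carrier[OF SK[OF that]] by (auto simp: inv_space_carrier)
  then obtain g where g: "\<And>x. x \<in> S \<Longrightarrow> g x \<in> K (op_poly p) k"
    and fg: "\<And>x. x \<in> S \<Longrightarrow> f (ker_cls p k x) = ker_cls (op_poly p) k (g x)" by metis
  have f_sum: "f (ker_cls p k (\<Sum>x\<in>T. P (r x) x)) = ker_cls (op_poly p) k (\<Sum>x\<in>T. P (subst_neg (r x)) (g x))"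
    if "T \<subseteq> S" for T r
    using finite_subset[OF that finS] that
  proof (induction T rule: finite_induct)
    case empty
    obtain y where y: "y \<in> K (op_poly p) k" "f (ker_cls p k 0) = ker_cls (op_poly p) k y"
      using f_carrier[of 0] by (auto simp: inv_space_carrier)
    have "f (ker_cls p k (P 0 0)) = cls (op_poly p) (subst_neg 0) \<odot>\<^bsub>?W\<^esub> f (ker_cls p k 0)"
      by (rule f_smult) simp
    then show ?case by (simp add: y(2) inv_space_smult[OF y(1)])
  next
    case (insert x T)
    have x: "x \<in> S" and T: "T \<subseteq> S" using insert.prems by auto
    have "(\<Sum>x\<in>T. P (r x) x) \<in> K p k" using T SK by (intro K_sum K_P) auto
    then have "f (ker_cls p k (P (r x) x + (\<Sum>x\<in>T. P (r x) x)))
        = f (ker_cls p k (P (r x) x)) \<oplus>\<^bsub>?W\<^esub> f (ker_cls p k (\<Sum>x\<in>T. P (r x) x))"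
      using SK[OF x] by (intro f_add K_P)
    also have "\<dots> = ker_cls (op_poly p) k (P (subst_neg (r x)) (g x) + (\<Sum>x\<in>T. P (subst_neg (r x)) (g x)))"
      by (simp add: f_smult[OF SK[OF x]] fg[OF x] inv_space_smult[OF g[OF x]] insert.IH[OF T] inv_space_add)
    finally show ?case using insert.hyps by simp
  qed
  have span': "\<exists>r. z - (\<Sum>x\<in>S. P (r x) (g x)) \<in> N (op_poly p) k" if z: "z \<in> K (op_poly p) k" for z
  proof -
    have "ker_cls (op_poly p) k z \<in> f ` carrier ?V"
      using bij_betw_imp_surj_on[OF bij] z carrier_op by simp
    then obtain w where w: "w \<in> K p k" "ker_cls (op_poly p) k z = f (ker_cls p k w)" by (auto simp: inv_space_carrier)
    obtain r where "w - (\<Sum>x\<in>S. P (r x) x) \<in> N p k" using span[OF w(1)] by blast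
    then have "ker_cls p k w = ker_cls p k (\<Sum>x\<in>S. P (r x) x)" by (simp add: ker_cls_eq_iff)
    then have "ker_cls (op_poly p) k z = ker_cls (op_poly p) k (\<Sum>x\<in>S. P (subst_neg (r x)) (g x))"
      using w(2) f_sum[OF subset_refl] by simp
    then show ?thesis unfolding ker_cls_eq_iff by (rule exI[of _ "\<lambda>x. subst_neg (r x)"])
  qed
  have "b (g x) (P (subst_neg s) (g y)) = - b x (P s y)"
    if xy: "x \<in> S" "y \<in> S" and s: "p ^ (k - 1) dvd s" for x y s
  proof -
    have "((\<ominus>\<^bsub>res_field p\<^esub> \<one>\<^bsub>res_field p\<^esub>) [^]\<^bsub>res_field p\<^esub> (1 + (k - 1) * degree p))
               \<otimes>\<^bsub>res_field p\<^esub> res_refl (C (op_poly p) k (ker_cls (op_poly p) k (g x)) (ker_cls (op_poly p) k (g y)))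
      = C p k (ker_cls p k x) (ker_cls p k y)"
      using form[rule_format, OF ker_cls_in_carrier[OF SK[OF xy(1)]] ker_cls_in_carrier[OF SK[OF xy(2)]]]
      unfolding op_form_def fg[OF xy(1)] fg[OF xy(2)] .
    then show ?thesis
      using quad_invariant_opposite_iff[OF p k SK[OF xy(1)] SK[OF xy(2)] g[OF xy(1)] g[OF xy(2)]] s by blast
  qed
  with S span g span' show ?thesis by blast
qed

section \<open>Assembling the primary parts\<close>

text \<open>A finite family of cyclic generators for the exponent \<open>k\<close> and the pair \<open>Q = {p, p^op}\<close>,
  indexed by the same set \<open>S\<close> on both sides. Only the unordered pair enters, so that a choice for
  each pair is compatible with the exchange of \<open>p\<close> and \<open>p^op\<close>.\<close>
definition matched_pair :: "'a poly set \<Rightarrow> nat \<Rightarrow> 'v set \<Rightarrow> ('a poly \<Rightarrow> 'v \<Rightarrow> 'v) \<Rightarrow> bool" where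
  "matched_pair Q k S h \<longleftrightarrow> finite S \<and> (\<forall>q\<in>Q.
     (\<forall>x\<in>S. regular_gen q k (h q x)) \<and>
     (\<forall>x\<in>S. \<forall>y\<in>S. x \<noteq> y \<longrightarrow> res_orth q k (h q x) (h q y)) \<and>
     (\<forall>z\<in>K q k. \<exists>r. z - (\<Sum>x\<in>S. P (r x) (h q x)) \<in> N q k) \<and>
     (\<forall>x\<in>S. \<forall>s. q ^ (k - 1) dvd s \<longrightarrow>
        b (h (op_poly q) x) (P (subst_neg s) (h (op_poly q) x)) = - b (h q x) (P s (h q x))))"

lemma regular_gen_power_dvd:
  assumes x: "regular_gen q k x" and m: "m \<noteq> 0" "\<And>x. P m x = 0"
  shows "q ^ k dvd m"
proof -
  have q: "q \<in> Irr" and xK: "x \<in> K q k" using x by (auto simp: regular_gen_def)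
  obtain a m' where a: "m = q ^ a * m'" "\<not> q dvd m'"
    using exact_power_factor[OF IrrD(3)[OF q] irreducible_not_unit[OF IrrD(1)[OF q]] m(1)] by blast
  have xa: "x \<in> K q a" by (rule torsion_bounded[OF q a m(2) xK])
  have "k \<le> a"
  proof (rule ccontr)
    assume "\<not> k \<le> a"
    then have "x \<in> K q (k - 1)" using K_mono[OF xa] by simp
    moreover obtain r where "b x (P (q ^ (k - 1) * r) x) \<noteq> 0" using x by (auto simp: regular_gen_def)
    ultimately show False using cyclic_form_vanishes(1) by blast
  qed
  then show ?thesis using a(1) by (simp add: le_imp_power_dvd)
qed

lemma matched_pairD:
  assumes "matched_pair Q k S h" and "q \<in> Q"
  shows "finite S" "x \<in> S \<Longrightarrow> regular_gen q k (h q x)"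
    "x \<in> S \<Longrightarrow> y \<in> S \<Longrightarrow> x \<noteq> y \<Longrightarrow> res_orth q k (h q x) (h q y)"
    "z \<in> K q k \<Longrightarrow> \<exists>r. z - (\<Sum>x\<in>S. P (r x) (h q x)) \<in> N q k"
    "x \<in> S \<Longrightarrow> q ^ (k - 1) dvd s \<Longrightarrow>
        b (h (op_poly q) x) (P (subst_neg s) (h (op_poly q) x)) = - b (h q x) (P s (h q x))"
  using assms(1)[unfolded matched_pair_def, THEN conjunct1]
    bspec[OF assms(1)[unfolded matched_pair_def, THEN conjunct2] assms(2)]
  by simp_all

lemma matched_pair_symmetric:
  assumes "op_poly p = p" and S: "res_orth_set p k S"
    and "\<And>z. z \<in> K p k \<Longrightarrow> \<exists>r. z - (\<Sum>x\<in>S. P (r x) x) \<in> N p k"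
    and "\<And>x s. x \<in> S \<Longrightarrow> p ^ (k - 1) dvd s \<Longrightarrow> b x (P (subst_neg s) x) = - b x (P s x)"
  shows "matched_pair {p, op_poly p} k S (\<lambda>_ x. x)"
  using assms by (simp add: matched_pair_def res_orth_set_def)

lemma matched_pair_opposite:
  assumes p: "p \<in> Irr" and k: "k \<ge> 1" and ne: "op_poly p \<noteq> p" and S: "res_orth_set p k S"
    and span: "\<And>z. z \<in> K p k \<Longrightarrow> \<exists>r. z - (\<Sum>x\<in>S. P (r x) x) \<in> N p k"
    and g: "\<And>x. x \<in> S \<Longrightarrow> g x \<in> K (op_poly p) k"
    and span': "\<And>z. z \<in> K (op_poly p) k \<Longrightarrow> \<exists>r. z - (\<Sum>x\<in>S. P (r x) (g x)) \<in> N (op_poly p) k"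
    and form: "\<And>x y s. x \<in> S \<Longrightarrow> y \<in> S \<Longrightarrow> p ^ (k - 1) dvd s \<Longrightarrow> b (g x) (P (subst_neg s) (g y)) = - b x (P s y)"
  shows "matched_pair {p, op_poly p} k S (\<lambda>q x. if q = p then x else g x)"
proof -
  have form': "b (g x) (P s (g y)) = - b x (P (subst_neg s) y)"
    if "x \<in> S" "y \<in> S" "op_poly p ^ (k - 1) dvd s" for x y s
    using form[of x y "subst_neg s"] that by (simp add: op_poly_dvd_iff)
  have reg: "regular_gen p k x" if "x \<in> S" for x using S that by (simp add: res_orth_set_def)
  have orth: "res_orth p k x y" if "x \<in> S" "y \<in> S" "x \<noteq> y" for x y using S that by (simp add: res_orth_set_def)
  have reg': "regular_gen (op_poly p) k (g x)" if x: "x \<in> S" for x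
  proof -
    obtain r where r: "b x (P (p ^ (k - 1) * r) x) \<noteq> 0" using reg[OF x] by (auto simp: regular_gen_def)
    show ?thesis
    proof (rule regular_genI[OF op_poly_Irr[OF p] k g[OF x]])
      show "op_poly p ^ (k - 1) dvd subst_neg (p ^ (k - 1) * r)"
        unfolding op_poly_dvd_iff subst_neg_subst_neg by simp
      show "b (g x) (P (subst_neg (p ^ (k - 1) * r)) (g x)) \<noteq> 0" using form[OF x x, of "p ^ (k - 1) * r"] r by simp
    qed
  qed
  have orth': "res_orth (op_poly p) k (g x) (g y)" if xy: "x \<in> S" "y \<in> S" "x \<noteq> y" for x y
    unfolding res_orth_def
  proof (intro allI impI)
    fix s assume s: "op_poly p ^ (k - 1) dvd s"
    then have "b x (P (subst_neg s) y) = 0" using orth[OF xy] by (simp add: res_orth_def op_poly_dvd_iff)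
    then show "b (g x) (P s (g y)) = 0" using form'[OF xy(1,2) s] by simp
  qed
  have "finite S" using S by (simp add: res_orth_set_def)
  then show ?thesis
    unfolding matched_pair_def using ne reg orth span reg' orth' span' form form'
    by (simp add: ball_simps)
qed

text \<open>A member of the combined family is indexed by a triple \<open>(q, k, x)\<close> with \<open>x\<close> in the set chosen for
  the pair \<open>{q, q^op}\<close>; the matching involution replaces \<open>q\<close> by \<open>q^op\<close>. The family is finite since
  \<open>q^k\<close> divides each polynomial that annihilates \<open>u\<close>.\<close>
lemma square_zero_sum_of_matched_pairs:
  assumes two: "(2::'a) \<noteq> 0"
    and pairs: "\<And>p k. p \<in> Irr \<Longrightarrow> k \<ge> 1 \<Longrightarrow> \<exists>S h. matched_pair {p, op_poly p} k S h"
  shows square_zero_sum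
proof -
  have "\<forall>Q k. \<exists>S h. (\<exists>p\<in>Irr. Q = {p, op_poly p}) \<and> k \<ge> 1 \<longrightarrow> matched_pair Q k S h" using pairs by blast
  then obtain S h where Sh: "\<And>Q k. (\<exists>p\<in>Irr. Q = {p, op_poly p}) \<Longrightarrow> k \<ge> 1 \<Longrightarrow> matched_pair Q k (S Q k) (h Q k)"
    by metis
  define T where "T q k = S {q, op_poly q} k" for q k
  define g where "g q k = h {q, op_poly q} k q" for q k
  have T_op: "T (op_poly q) k = T q k" for q k by (simp add: T_def insert_commute)
  have g_op: "g (op_poly q) k = h {q, op_poly q} k (op_poly q)" for q k by (simp add: g_def insert_commute)
  have pair: "matched_pair {q, op_poly q} k (T q k) (h {q, op_poly q} k)" if "q \<in> Irr" "k \<ge> 1" for q k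
    unfolding T_def by (rule Sh) (use that in auto)
  have fin: "finite (T q k)"
    and reg: "\<And>x. x \<in> T q k \<Longrightarrow> regular_gen q k (g q k x)"
    and orth: "\<And>x y. x \<in> T q k \<Longrightarrow> y \<in> T q k \<Longrightarrow> x \<noteq> y \<Longrightarrow> res_orth q k (g q k x) (g q k y)"
    and span: "\<And>z. z \<in> K q k \<Longrightarrow> \<exists>r. z - (\<Sum>x\<in>T q k. P (r x) (g q k x)) \<in> N q k"
    and matched: "\<And>x s. x \<in> T q k \<Longrightarrow> q ^ (k - 1) dvd s \<Longrightarrow>
      b (g (op_poly q) k x) (P (subst_neg s) (g (op_poly q) k x)) = - b (g q k x) (P s (g q k x))"
    if "q \<in> Irr" "k \<ge> 1" for q k
    unfolding g_op unfolding g_def by (fact matched_pairD[OF pair[OF that] insertI1])+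
  obtain m where m: "m \<noteq> 0" "\<And>x. P m x = 0" using exists_annihilator by blast
  define I where "I = {(q, k, x). q \<in> Irr \<and> k \<ge> 1 \<and> x \<in> T q k}"
  define p where "p i = fst i" for i :: "'a poly \<times> nat \<times> 'v"
  define k where "k i = fst (snd i)" for i :: "'a poly \<times> nat \<times> 'v"
  define G where "G i = g (p i) (k i) (snd (snd i))" for i
  define \<tau> where "\<tau> i = (op_poly (p i), snd i)" for i
  have I_iff: "i \<in> I \<longleftrightarrow> p i \<in> Irr \<and> k i \<ge> 1 \<and> snd (snd i) \<in> T (p i) (k i)" for i
    by (auto simp: I_def p_def k_def)
  have "I \<subseteq> (\<Union>q\<in>{q \<in> Irr. q dvd m}. \<Union>l\<in>{1..degree m}. (\<lambda>x. (q, l, x)) ` T q l)"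
  proof
    fix i assume i: "i \<in> I"
    then have dvd: "p i ^ k i dvd m"
      using regular_gen_power_dvd[OF reg m] unfolding I_iff by blast
    have pi: "p i \<in> Irr" and ki: "k i \<ge> 1" using i by (simp_all add: I_iff)
    have "1 \<le> degree (p i)" using Irr_degree_pos[OF pi] by linarith
    then have "k i * 1 \<le> k i * degree (p i)" by (rule mult_le_mono2)
    also have "\<dots> = degree (p i ^ k i)" by (simp add: degree_power_eq IrrD(3)[OF pi])
    also have "\<dots> \<le> degree m" using dvd m(1) by (rule dvd_imp_degree_le)
    finally have "k i \<le> degree m" by simp
    moreover have "p i dvd m" using dvd_trans[OF dvd_power dvd] ki by simp
    moreover have "i = (p i, k i, snd (snd i))" by (simp add: p_def k_def)
    ultimately show "i \<in> (\<Union>q\<in>{q \<in> Irr. q dvd m}. \<Union>l\<in>{1..degree m}. (\<lambda>x. (q, l, x)) ` T q l)"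
      using i ki pi unfolding I_iff by (intro UN_I[of "p i"] UN_I[of "k i"] image_eqI[of _ _ "snd (snd i)"]) auto
  qed
  moreover have "finite (\<Union>q\<in>{q \<in> Irr. q dvd m}. \<Union>l\<in>{1..degree m}. (\<lambda>x. (q, l, x)) ` T q l)"
    using finite_Irr_divisors[OF m(1)] fin by (intro finite_UN_I) auto
  ultimately have "finite I" by (rule finite_subset)
  show ?thesis
  proof (rule square_zero_sum_of_matched_residual_family[OF two])
    show "residual_family I p k G"
      unfolding residual_family_def
    proof (intro conjI ballI impI)
      show "finite I" by fact
      show "regular_gen (p i) (k i) (G i)" if "i \<in> I" for i using that reg by (simp add: I_iff G_def)
      fix i j assume ij: "i \<in> I" "j \<in> I" "i \<noteq> j \<and> p i = p j \<and> k i = k j"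
      then have "snd (snd i) \<noteq> snd (snd j)" by (auto simp: p_def k_def prod_eq_iff)
      then show "res_orth (p i) (k i) (G i) (G j)" using ij orth by (simp add: I_iff G_def)
    qed
    show "residually_spanning I p k G"
      unfolding residually_spanning_def
    proof (intro ballI allI impI)
      fix q :: "'a poly" and l :: nat and z assume ql: "q \<in> Irr" "1 \<le> l" and z: "z \<in> K q l"
      obtain r where r: "z - (\<Sum>x\<in>T q l. P (r x) (g q l x)) \<in> N q l" using span[OF ql z] by blast
      have "{i \<in> I. p i = q \<and> k i = l} = (\<lambda>x. (q, l, x)) ` T q l" using ql by (auto simp: I_def p_def k_def)
      then have "(\<Sum>i\<in>{i \<in> I. p i = q \<and> k i = l}. P (r (snd (snd i))) (G i)) = (\<Sum>x\<in>T q l. P (r x) (g q l x))"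
        by (simp add: sum.reindex inj_on_def G_def p_def k_def)
      then show "\<exists>r. z - (\<Sum>i\<in>{i \<in> I. p i = q \<and> k i = l}. P (r i) (G i)) \<in> N q l"
        using r by (intro exI[of _ "\<lambda>i. r (snd (snd i))"]) simp
    qed
    fix i assume i: "i \<in> I"
    show "\<tau> i \<in> I" using i by (simp add: I_iff \<tau>_def p_def k_def T_op op_poly_Irr)
    show "\<tau> (\<tau> i) = i" by (simp add: \<tau>_def p_def)
    show "p (\<tau> i) = op_poly (p i)" "k (\<tau> i) = k i" by (simp_all add: \<tau>_def p_def k_def)
    show "b (G (\<tau> i)) (P (subst_neg s) (G (\<tau> i))) = - b (G i) (P s (G i))" if "p i ^ (k i - 1) dvd s" for s
      using matched[of "p i" "k i" "snd (snd i)" s] i that by (simp add: I_iff G_def \<tau>_def p_def k_def)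
  qed
qed

end

section \<open>The theorem\<close>

theorem theorem1p13:
  fixes scale :: "'a::field \<Rightarrow> 'v::ab_group_add \<Rightarrow> 'v"
    and Basis :: "'v set"
    and b :: "'v \<Rightarrow> 'v \<Rightarrow> 'a"
    and u :: "'v \<Rightarrow> 'v"
  assumes "CHAR('a) \<noteq> 2"
    and "finite_dimensional_vector_space scale Basis"
    and "sym_bilinear_form scale b"
    and "nondegenerate_form b"
    and "selfadjoint_endo scale b u"
    and "bij u"
  shows "(\<exists>a1 a2. selfadjoint_endo scale b a1 \<and> selfadjoint_endo scale b a2 \<and>
            (\<forall>x. a1 (a1 x) = 0) \<and> (\<forall>x. a2 (a2 x) = 0) \<and> (\<forall>x. u x = a1 x + a2 x))
     \<longleftrightarrow>
       (\<forall>p\<in>Irr0. \<forall>k\<ge>1.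
          skew_representable (res_field p) res_refl (inv_space scale u p k)
            (attached_quadratic_form (quad_invariant scale b u p k))) \<and>
       (\<forall>p\<in>Irr - Irr0. \<forall>k\<ge>1.
          equivalent_forms (res_field p)
            (inv_space scale u p k)
            (quad_invariant scale b u p k)
            (op_space (inv_space scale u (op_poly p) k))
            (\<lambda>A B. ((\<ominus>\<^bsub>res_field p\<^esub> \<one>\<^bsub>res_field p\<^esub>) [^]\<^bsub>res_field p\<^esub> (1 + (k - 1) * degree p))
               \<otimes>\<^bsub>res_field p\<^esub> op_form (quad_invariant scale b u (op_poly p) k) A B))"
    (is "?a \<longleftrightarrow> ?b0 \<and> ?b1")
proof -
  have two: "(2::'a) \<noteq> 0"
  proof
    assume "(2::'a) = 0"
    then have "CHAR('a) dvd 2" using of_nat_eq_0_iff_char_dvd[where 'a = 'a, of 2] by simp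
    then have "CHAR('a) = 1 \<or> CHAR('a) = 2" using prime_nat_iff two_is_prime_nat by blast
    then show False using assms(1) CHAR_not_1[where 'a = 'a] by simp
  qed
  interpret selfadjoint_space scale Basis b u
    using assms(2-5) by (simp add: selfadjoint_space_def selfadjoint_space_axioms_def)
  show ?thesis
  proof
    assume ?a
    then obtain s where "skew_involution s"
      using skew_involution_of_square_zero_sum[OF \<open>bij u\<close>] unfolding square_zero_sum_def by blast
    then show "?b0 \<and> ?b1"
      using skew_representable_of_skew_involution[OF two] equivalent_forms_of_skew_involution by blast
  next
    assume b: "?b0 \<and> ?b1"
    have square_zero_sum
    proof (rule square_zero_sum_of_matched_pairs[OF two])
      fix p :: "'a poly" and k :: nat assume p: "p \<in> Irr" and k: "k \<ge> 1"
      consider "p \<in> Irr0" | "p \<notin> Irr0" "op_poly p \<noteq> p" | "p = [:0, 1:]"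
        using op_poly_fixed[OF two p] by blast
      then show "\<exists>S h. matched_pair {p, op_poly p} k S h"
      proof cases
        case 1
        then show ?thesis
          using skew_residual_basis_of_skew_representable[OF two 1 k] b k
            matched_pair_symmetric[OF Irr0_imp(4)[OF 1]] by meson
      next
        case 2
        then have "p \<in> Irr - Irr0" using p by blast
        from opposite_residual_basis_of_equivalent_forms[OF two p k b[THEN conjunct2, rule_format, OF this k]]
        obtain S g where S: "res_orth_set p k S"
          and span: "\<forall>z\<in>K p k. \<exists>r. z - (\<Sum>x\<in>S. P (r x) x) \<in> N p k"
          and g: "\<forall>x\<in>S. g x \<in> K (op_poly p) k"
          and span': "\<forall>z\<in>K (op_poly p) k. \<exists>r. z - (\<Sum>x\<in>S. P (r x) (g x)) \<in> N (op_poly p) k"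
          and form: "\<forall>x\<in>S. \<forall>y\<in>S. \<forall>s. p ^ (k - 1) dvd s \<longrightarrow>
            b (g x) (P (subst_neg s) (g y)) = - b x (P s y)"
          by (elim exE conjE) (rule that)
        from matched_pair_opposite[OF p k 2(2) S span[rule_format] g[rule_format] span'[rule_format] form[rule_format]]
        show ?thesis by blast
      next
        case 3
        \<comment> \<open>The polynomial \<open>t\<close> equals its opposite without being in \<open>Irr0\<close>, but \<open>u\<close> has no kernel.\<close>
        have "x = 0" if "P ([:0, 1:] ^ n) x = 0" for n x
          using that
        proof (induction n)
          case (Suc n)
          then have "u (P ([:0, 1:] ^ n) x) = u 0" by (simp only: power_Suc P_mult P_X u_linear)
          then show ?case using Suc.IH \<open>bij u\<close> by (metis bij_is_inj injD)
        qed simp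
        then have zero: "z = 0" if "z \<in> K p k" for z using that unfolding K_iff 3 .
        have "op_poly p = p" by (simp add: 3 op_poly_eq subst_neg_def pcompose_pCons)
        then have "matched_pair {p, op_poly p} k {} (\<lambda>_ x. x)"
          by (rule matched_pair_symmetric) (auto simp: res_orth_set_def dest: zero)
        then show ?thesis by blast
      qed
    qed
    then show ?a unfolding square_zero_sum_def .
  qed
qed

end
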